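(* Let $k$ be a field, let $H$ be a Hopf algebra over $k$ and let $\pi: H \to \overline H$ be a surjective Hopf algebra map. Suppose that $H$ is right faithfully coflat over $\overline H$. Then $\pi$ induces an isomorphism of Hopf algebras $H/HK^+ \cong \overline H$, where $K = {}^{\mathrm{co}\,\pi}H$.
   Context: For a Hopf algebra map $\pi:H\to\overline H$, put ${}^{\mathrm{co}\,\pi}H = \{h\in H : (\pi\otimes \mathrm{id})\Delta(h) = 1\otimes h\}$. It is a right coideal subalgebra of $H$ that is right normal, i.e. stable under the right adjoint action $a.h=\mathcal S(h_{(1)})ah_{(2)}$ of $H$. For a right normal right coideal subalgebra $K\subseteq H$, with $K^+=K\cap\ker\epsilon$, the left ideal $HK^+$ is a Hopf ideal of $H$, so $H/HK^+$ is a quotient Hopf algebra. $H$ is right faithfully coflat over $\overline H$ if $H$, viewed as a right $\overline H$-comodule via $(\mathrm{id}\otimes\pi)\Delta$, is faithfully coflat, i.e. the cotensor functor $H\,\square_{\overline H}\,-$ on left $\overline H$-comodules preserves and reflects exact sequences. $H$ need not be finite dimensional. *)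

theory Defs
  imports "HOL-Algebra.Module" "HOL-Algebra.QuotRing" "HOL-Algebra.Ideal_Product"
begin

section \<open>Linear maps and quotient spaces\<close>

text \<open>Vector spaces are \<^locale>\<open>module\<close>s over a field.  The \<^const>\<open>mult\<close> and \<^const>\<open>one\<close>
  fields that every module record carries are meaningful for algebras only.\<close>

definition lin_maps ::
  "('k, 'z) ring_scheme \<Rightarrow> ('k, 'a, 'x) module_scheme \<Rightarrow> ('k, 'b, 'y) module_scheme \<Rightarrow> ('a \<Rightarrow> 'b) set"
  where "lin_maps K V W = {f \<in> carrier V \<rightarrow> carrier W.
    (\<forall>x\<in>carrier V. \<forall>y\<in>carrier V. f (x \<oplus>\<^bsub>V\<^esub> y) = f x \<oplus>\<^bsub>W\<^esub> f y) \<and>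
    (\<forall>c\<in>carrier K. \<forall>x\<in>carrier V. f (c \<odot>\<^bsub>V\<^esub> x) = c \<odot>\<^bsub>W\<^esub> f x)}"

definition quot_module :: "('k, 'a, 'x) module_scheme \<Rightarrow> 'a set \<Rightarrow> ('k, 'a set) module"
  where "quot_module V N =
    \<lparr>carrier = carrier (V Quot N), mult = mult (V Quot N), one = one (V Quot N),
     zero = zero (V Quot N), add = add (V Quot N),
     smult = (\<lambda>c Y. \<Union>y\<in>Y. N +>\<^bsub>V\<^esub> (c \<odot>\<^bsub>V\<^esub> y))\<rparr>"


section \<open>Tensor products\<close>

text \<open>\<open>V \<otimes> W\<close> is the space of finitely supported functions on
  \<open>carrier V \<times> carrier W\<close> modulo the subspace generated by the bilinearity relations, so its
  elements are cosets of such functions.\<close>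

type_synonym ('k, 'a, 'b) tens = "('a \<times> 'b \<Rightarrow> 'k) set"

definition free_module :: "('k, 'z) ring_scheme \<Rightarrow> 'i set \<Rightarrow> ('k, 'i \<Rightarrow> 'k) module"
  where "free_module K I =
    \<lparr>carrier = {x. finite {i. x i \<noteq> \<zero>\<^bsub>K\<^esub>} \<and> {i. x i \<noteq> \<zero>\<^bsub>K\<^esub>} \<subseteq> I \<and> range x \<subseteq> carrier K},
     mult = undefined, one = undefined,
     zero = (\<lambda>_. \<zero>\<^bsub>K\<^esub>), add = (\<lambda>x y i. x i \<oplus>\<^bsub>K\<^esub> y i), smult = (\<lambda>c x i. c \<otimes>\<^bsub>K\<^esub> x i)\<rparr>"

definition single :: "('k, 'z) ring_scheme \<Rightarrow> 'i \<Rightarrow> 'i \<Rightarrow> 'k"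
  where "single K i = (\<lambda>j. if j = i then \<one>\<^bsub>K\<^esub> else \<zero>\<^bsub>K\<^esub>)"

definition tensor_gens ::
  "('k, 'z) ring_scheme \<Rightarrow> ('k, 'a, 'x) module_scheme \<Rightarrow> ('k, 'b, 'y) module_scheme
    \<Rightarrow> ('a \<times> 'b \<Rightarrow> 'k) set"
  where "tensor_gens K V W = (let F = free_module K (carrier V \<times> carrier W); e = single K in
      {e (v \<oplus>\<^bsub>V\<^esub> v', w) \<ominus>\<^bsub>F\<^esub> (e (v, w) \<oplus>\<^bsub>F\<^esub> e (v', w)) | v v' w.
         v \<in> carrier V \<and> v' \<in> carrier V \<and> w \<in> carrier W}
    \<union> {e (v, w \<oplus>\<^bsub>W\<^esub> w') \<ominus>\<^bsub>F\<^esub> (e (v, w) \<oplus>\<^bsub>F\<^esub> e (v, w')) | v w w'.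
         v \<in> carrier V \<and> w \<in> carrier W \<and> w' \<in> carrier W}
    \<union> {e (c \<odot>\<^bsub>V\<^esub> v, w) \<ominus>\<^bsub>F\<^esub> (c \<odot>\<^bsub>F\<^esub> e (v, w)) | c v w.
         c \<in> carrier K \<and> v \<in> carrier V \<and> w \<in> carrier W}
    \<union> {e (v, c \<odot>\<^bsub>W\<^esub> w) \<ominus>\<^bsub>F\<^esub> (c \<odot>\<^bsub>F\<^esub> e (v, w)) | c v w.
         c \<in> carrier K \<and> v \<in> carrier V \<and> w \<in> carrier W})"

definition tensor_rels ::
  "('k, 'z) ring_scheme \<Rightarrow> ('k, 'a, 'x) module_scheme \<Rightarrow> ('k, 'b, 'y) module_scheme
    \<Rightarrow> ('a \<times> 'b \<Rightarrow> 'k) set"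
  where "tensor_rels K V W =
    \<Inter>{N. submodule N K (free_module K (carrier V \<times> carrier W)) \<and> tensor_gens K V W \<subseteq> N}"

definition tensor_space ::
  "('k, 'z) ring_scheme \<Rightarrow> ('k, 'a, 'x) module_scheme \<Rightarrow> ('k, 'b, 'y) module_scheme
    \<Rightarrow> ('k, ('k, 'a, 'b) tens) module"
  where "tensor_space K V W =
    quot_module (free_module K (carrier V \<times> carrier W)) (tensor_rels K V W)"

text \<open>The pure tensor \<open>v \<otimes> w\<close>.\<close>

definition tens ::
  "('k, 'z) ring_scheme \<Rightarrow> ('k, 'a, 'x) module_scheme \<Rightarrow> ('k, 'b, 'y) module_scheme
    \<Rightarrow> 'a \<Rightarrow> 'b \<Rightarrow> ('k, 'a, 'b) tens"
  where "tens K V W v w =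
    tensor_rels K V W +>\<^bsub>free_module K (carrier V \<times> carrier W)\<^esub> single K (v, w)"

text \<open>For a bilinear map \<open>b\<close> into \<open>U\<close>, \<open>tens_lift K U b\<close> is the induced linear map, sending the class
  of \<open>x\<close> to \<open>\<Sum> x(v,w) b(v,w)\<close>; all representatives \<open>x\<close> of a tensor give the same value.\<close>

definition tens_lift ::
  "('k, 'z) ring_scheme \<Rightarrow> ('k, 'u, 'x) module_scheme \<Rightarrow> ('a \<Rightarrow> 'b \<Rightarrow> 'u) \<Rightarrow> ('k, 'a, 'b) tens \<Rightarrow> 'u"
  where "tens_lift K U b t = the_elem
    ((\<lambda>x. \<Oplus>\<^bsub>U\<^esub>p\<in>{p. x p \<noteq> \<zero>\<^bsub>K\<^esub>}. x p \<odot>\<^bsub>U\<^esub> b (fst p) (snd p)) ` t)"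

text \<open>The space \<open>V \<otimes> W\<close> together with the multiplication \<open>(a \<otimes> b)(c \<otimes> d) = ac \<otimes> bd\<close> and unit \<open>1 \<otimes> 1\<close>
  (of significance only if \<open>V\<close> and \<open>W\<close> are algebras).\<close>

definition tensor ::
  "('k, 'z) ring_scheme \<Rightarrow> ('k, 'a, 'x) module_scheme \<Rightarrow> ('k, 'b, 'y) module_scheme
    \<Rightarrow> ('k, ('k, 'a, 'b) tens) module"
  where "tensor K V W = (let T = tensor_space K V W in T
    \<lparr>mult := (\<lambda>s t. tens_lift K T
        (\<lambda>a b. tens_lift K T (\<lambda>c d. tens K V W (a \<otimes>\<^bsub>V\<^esub> c) (b \<otimes>\<^bsub>W\<^esub> d)) t) s),
     one := tens K V W \<one>\<^bsub>V\<^esub> \<one>\<^bsub>W\<^esub>\<rparr>)"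

text \<open>\<open>tens_map K V' W' f g\<close> is \<open>f \<otimes> g\<close> with values in \<open>V' \<otimes> W'\<close>, and \<open>tens_assoc K U V W\<close> is
  \<open>(U \<otimes> V) \<otimes> W \<rightarrow> U \<otimes> (V \<otimes> W)\<close>.\<close>

definition tens_map ::
  "('k, 'z) ring_scheme \<Rightarrow> ('k, 'c, 'x) module_scheme \<Rightarrow> ('k, 'd, 'y) module_scheme
    \<Rightarrow> ('a \<Rightarrow> 'c) \<Rightarrow> ('b \<Rightarrow> 'd) \<Rightarrow> ('k, 'a, 'b) tens \<Rightarrow> ('k, 'c, 'd) tens"
  where "tens_map K V' W' f g =
    tens_lift K (tensor K V' W') (\<lambda>v w. tens K V' W' (f v) (g w))"

definition tens_assoc ::
  "('k, 'z) ring_scheme \<Rightarrow> ('k, 'a, 'x) module_scheme \<Rightarrow> ('k, 'b, 'y) module_scheme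
    \<Rightarrow> ('k, 'c, 'w) module_scheme \<Rightarrow> ('k, ('k, 'a, 'b) tens, 'c) tens \<Rightarrow> ('k, 'a, ('k, 'b, 'c) tens) tens"
  where "tens_assoc K U V W = (let T = tensor K U (tensor K V W) in
    tens_lift K T (\<lambda>s w. tens_lift K T (\<lambda>u v. tens K U (tensor K V W) u (tens K V W v w)) s))"


section \<open>Algebras, coalgebras, Hopf algebras\<close>

text \<open>The library's \<^locale>\<open>algebra\<close> is commutative.\<close>

locale assoc_algebra = field K + ring A + module K A
  for K :: "('k, 'z) ring_scheme" and A :: "('k, 'a, 'x) module_scheme" +
  assumes smult_mult_left: "\<lbrakk>c \<in> carrier K; x \<in> carrier A; y \<in> carrier A\<rbrakk> \<Longrightarrow>
      (c \<odot>\<^bsub>A\<^esub> x) \<otimes>\<^bsub>A\<^esub> y = c \<odot>\<^bsub>A\<^esub> (x \<otimes>\<^bsub>A\<^esub> y)"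
    and smult_mult_right: "\<lbrakk>c \<in> carrier K; x \<in> carrier A; y \<in> carrier A\<rbrakk> \<Longrightarrow>
      x \<otimes>\<^bsub>A\<^esub> (c \<odot>\<^bsub>A\<^esub> y) = c \<odot>\<^bsub>A\<^esub> (x \<otimes>\<^bsub>A\<^esub> y)"

definition base_module :: "('k, 'z) ring_scheme \<Rightarrow> ('k, 'k) module"
  where "base_module K = \<lparr>carrier = carrier K, mult = mult K, one = one K,
     zero = zero K, add = add K, smult = mult K\<rparr>"

record ('k, 'a) coalgebra = "('k, 'a) module" +
  comult :: "'a \<Rightarrow> ('k, 'a, 'a) tens"
  counit :: "'a \<Rightarrow> 'k"

record ('k, 'a) hopf = "('k, 'a) coalgebra" +
  antipode :: "'a \<Rightarrow> 'a"

locale coalgebra = field K + module K C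
  for K :: "('k, 'z) ring_scheme" and C :: "('k, 'a, 'x) coalgebra_scheme" +
  assumes comult_lin: "comult C \<in> lin_maps K C (tensor K C C)"
    and counit_lin: "counit C \<in> lin_maps K C (base_module K)"
    and coassoc: "x \<in> carrier C \<Longrightarrow>
      tens_assoc K C C C (tens_map K (tensor K C C) C (comult C) id (comult C x)) =
      tens_map K C (tensor K C C) id (comult C) (comult C x)"
    and counit_left: "x \<in> carrier C \<Longrightarrow>
      tens_lift K C (\<lambda>a b. counit C a \<odot>\<^bsub>C\<^esub> b) (comult C x) = x"
    and counit_right: "x \<in> carrier C \<Longrightarrow>
      tens_lift K C (\<lambda>a b. counit C b \<odot>\<^bsub>C\<^esub> a) (comult C x) = x"

locale hopf_algebra = assoc_algebra K H + coalgebra K H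
  for K :: "('k, 'z) ring_scheme" and H :: "('k, 'a, 'x) hopf_scheme" +
  assumes comult_hom: "comult H \<in> ring_hom H (tensor K H H)"
    and counit_hom: "counit H \<in> ring_hom H K"
    and antipode_lin: "antipode H \<in> lin_maps K H H"
    and antipode_left: "x \<in> carrier H \<Longrightarrow>
      tens_lift K H (\<lambda>a b. antipode H a \<otimes>\<^bsub>H\<^esub> b) (comult H x) = counit H x \<odot>\<^bsub>H\<^esub> \<one>\<^bsub>H\<^esub>"
    and antipode_right: "x \<in> carrier H \<Longrightarrow>
      tens_lift K H (\<lambda>a b. a \<otimes>\<^bsub>H\<^esub> antipode H b) (comult H x) = counit H x \<odot>\<^bsub>H\<^esub> \<one>\<^bsub>H\<^esub>"

definition hopf_hom ::
  "('k, 'z) ring_scheme \<Rightarrow> ('k, 'a, 'x) hopf_scheme \<Rightarrow> ('k, 'b, 'y) hopf_scheme \<Rightarrow> ('a \<Rightarrow> 'b) set"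
  where "hopf_hom K H L = {f \<in> lin_maps K H L \<inter> ring_hom H L. \<forall>x\<in>carrier H.
    comult L (f x) = tens_map K L L f f (comult H x) \<and>
    counit L (f x) = counit H x \<and>
    antipode L (f x) = f (antipode H x)}"

definition hopf_iso ::
  "('k, 'z) ring_scheme \<Rightarrow> ('k, 'a, 'x) hopf_scheme \<Rightarrow> ('k, 'b, 'y) hopf_scheme \<Rightarrow> ('a \<Rightarrow> 'b) set"
  where "hopf_iso K H L = {f \<in> hopf_hom K H L. bij_betw f (carrier H) (carrier L)}"

text \<open>The structure induced on \<open>H/I\<close> through the projection \<open>p\<close>; it is well defined if \<open>I\<close> is a Hopf ideal.\<close>

definition quot_hopf ::
  "('k, 'z) ring_scheme \<Rightarrow> ('k, 'a, 'x) hopf_scheme \<Rightarrow> 'a set \<Rightarrow> ('k, 'a set) hopf"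
  where "quot_hopf K H I = (let Q = quot_module H I; p = (\<lambda>h. I +>\<^bsub>H\<^esub> h) in
    \<lparr>carrier = carrier Q, mult = mult Q, one = one Q, zero = zero Q, add = add Q, smult = smult Q,
     comult = (\<lambda>Y. the_elem ((\<lambda>h. tens_map K Q Q p p (comult H h)) ` Y)),
     counit = (\<lambda>Y. the_elem (counit H ` Y)),
     antipode = (\<lambda>Y. the_elem ((\<lambda>h. p (antipode H h)) ` Y))\<rparr>)"

text \<open>\<open>left_coinvariants\<close> is \<open>{h. (\<pi> \<otimes> id) \<Delta>(h) = 1 \<otimes> h}\<close>.\<close>

definition left_coinvariants ::
  "('k, 'z) ring_scheme \<Rightarrow> ('k, 'a, 'x) hopf_scheme \<Rightarrow> ('k, 'b, 'y) hopf_scheme \<Rightarrow> ('a \<Rightarrow> 'b) \<Rightarrow> 'a set"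
  where "left_coinvariants K H L \<pi> =
    {h \<in> carrier H. tens_map K L H \<pi> id (comult H h) = tens K L H \<one>\<^bsub>L\<^esub> h}"

definition augmentation_part ::
  "('k, 'z) ring_scheme \<Rightarrow> ('k, 'a, 'x) hopf_scheme \<Rightarrow> 'a set \<Rightarrow> 'a set"
  where "augmentation_part K H A = A \<inter> {h \<in> carrier H. counit H h = \<zero>\<^bsub>K\<^esub>}"


section \<open>Comodules, cotensor products and faithful coflatness\<close>

record ('k, 'c, 'm) lcomodule = "('k, 'm) module" +
  lcoact :: "'m \<Rightarrow> ('k, 'c, 'm) tens"

record ('k, 'c, 'm) rcomodule = "('k, 'm) module" +
  rcoact :: "'m \<Rightarrow> ('k, 'm, 'c) tens"

locale left_comodule = coalgebra K C + M?: module K M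
  for K :: "('k, 'z) ring_scheme" and C :: "('k, 'c, 'x) coalgebra_scheme"
    and M :: "('k, 'c, 'm, 'y) lcomodule_scheme" +
  assumes lcoact_lin: "lcoact M \<in> lin_maps K M (tensor K C M)"
    and lcoact_coassoc: "m \<in> carrier M \<Longrightarrow>
      tens_assoc K C C M (tens_map K (tensor K C C) M (comult C) id (lcoact M m)) =
      tens_map K C (tensor K C M) id (lcoact M) (lcoact M m)"
    and lcoact_counit: "m \<in> carrier M \<Longrightarrow>
      tens_lift K M (\<lambda>c n. counit C c \<odot>\<^bsub>M\<^esub> n) (lcoact M m) = m"

locale right_comodule = coalgebra K C + M?: module K M
  for K :: "('k, 'z) ring_scheme" and C :: "('k, 'c, 'x) coalgebra_scheme"
    and M :: "('k, 'c, 'm, 'y) rcomodule_scheme" +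
  assumes rcoact_lin: "rcoact M \<in> lin_maps K M (tensor K M C)"
    and rcoact_coassoc: "m \<in> carrier M \<Longrightarrow>
      tens_assoc K M C C (tens_map K (tensor K M C) C (rcoact M) id (rcoact M m)) =
      tens_map K M (tensor K C C) id (comult C) (rcoact M m)"
    and rcoact_counit: "m \<in> carrier M \<Longrightarrow>
      tens_lift K M (\<lambda>n c. counit C c \<odot>\<^bsub>M\<^esub> n) (rcoact M m) = m"

definition lcomodule_hom ::
  "('k, 'z) ring_scheme \<Rightarrow> ('k, 'c, 'x) coalgebra_scheme \<Rightarrow> ('k, 'c, 'm, 'y) lcomodule_scheme
    \<Rightarrow> ('k, 'c, 'n, 'w) lcomodule_scheme \<Rightarrow> ('m \<Rightarrow> 'n) set"
  where "lcomodule_hom K C M N =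
    {f \<in> lin_maps K M N. \<forall>m\<in>carrier M. lcoact N (f m) = tens_map K C N id f (lcoact M m)}"

text \<open>The cotensor product is the equalizer of \<open>\<rho> \<otimes> id\<close> and \<open>id \<otimes> \<lambda>\<close>; on morphisms the functor
  acts by restricting \<open>id \<otimes> f\<close>.\<close>

definition cotensor ::
  "('k, 'z) ring_scheme \<Rightarrow> ('k, 'c, 'x) coalgebra_scheme \<Rightarrow> ('k, 'c, 'm, 'y) rcomodule_scheme
    \<Rightarrow> ('k, 'c, 'n, 'w) lcomodule_scheme \<Rightarrow> ('k, ('k, 'm, 'n) tens) module"
  where "cotensor K C M N = (tensor K M N)\<lparr>carrier := {t \<in> carrier (tensor K M N).
    tens_assoc K M C N (tens_map K (tensor K M C) N (rcoact M) id t) =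
    tens_map K M (tensor K C N) id (lcoact N) t}\<rparr>"

abbreviation cotensor_map ::
  "('k, 'z) ring_scheme \<Rightarrow> ('k, 'c, 'm, 'y) rcomodule_scheme \<Rightarrow> ('k, 'c, 'n, 'w) lcomodule_scheme
    \<Rightarrow> ('l \<Rightarrow> 'n) \<Rightarrow> ('k, 'm, 'l) tens \<Rightarrow> ('k, 'm, 'n) tens"
  where "cotensor_map K M N f \<equiv> tens_map K M N id f"

definition exact_at ::
  "('k, 'a, 'x) module_scheme \<Rightarrow> ('k, 'b, 'y) module_scheme \<Rightarrow> ('k, 'c, 'w) module_scheme
    \<Rightarrow> ('a \<Rightarrow> 'b) \<Rightarrow> ('b \<Rightarrow> 'c) \<Rightarrow> bool"
  where "exact_at U V W f g \<longleftrightarrow> f ` carrier U = a_kernel V W g"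

text \<open>A formula of HOL cannot quantify over all types, so the left comodules that test faithful
  coflatness are those whose carrier is a subset of a given type \<open>'v\<close>.  As soon as \<open>'v\<close>
  is infinite and at least as large as the (nontrivial) coalgebra, it contains a copy
  of every finite-dimensional comodule, and by local finiteness of comodules the notion no longer depends on \<open>'v\<close>.\<close>

definition faithfully_coflat ::
  "'v itself \<Rightarrow> ('k, 'z) ring_scheme \<Rightarrow> ('k, 'c, 'x) coalgebra_scheme
    \<Rightarrow> ('k, 'c, 'm, 'y) rcomodule_scheme \<Rightarrow> bool"
  where "faithfully_coflat _ K C M \<longleftrightarrow> right_comodule K C M \<and>
    (\<forall>(L :: ('k, 'c, 'v) lcomodule) (N :: ('k, 'c, 'v) lcomodule) (P :: ('k, 'c, 'v) lcomodule) f g.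
      left_comodule K C L \<longrightarrow> left_comodule K C N \<longrightarrow> left_comodule K C P \<longrightarrow>
      f \<in> lcomodule_hom K C L N \<longrightarrow> g \<in> lcomodule_hom K C N P \<longrightarrow>
      (exact_at L N P f g \<longleftrightarrow>
       exact_at (cotensor K C M L) (cotensor K C M N) (cotensor K C M P)
         (cotensor_map K M N f) (cotensor_map K M P g)))"

text \<open>\<open>H\<close> as a right \<open>L\<close>-comodule via \<open>(id \<otimes> \<pi>) \<Delta>\<close>.\<close>

definition induced_rcomodule ::
  "('k, 'z) ring_scheme \<Rightarrow> ('k, 'a, 'x) hopf_scheme \<Rightarrow> ('k, 'b, 'y) hopf_scheme \<Rightarrow> ('a \<Rightarrow> 'b)
    \<Rightarrow> ('k, 'b, 'a) rcomodule"
  where "induced_rcomodule K H L \<pi> =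
    \<lparr>carrier = carrier H, mult = mult H, one = one H, zero = zero H, add = add H, smult = smult H,
     rcoact = (\<lambda>h. tens_map K H L id \<pi> (comult H h))\<rparr>"

text \<open>A range for the carriers of test comodules that is infinite, contains a copy of the type \<open>'h\<close>
  and, \<open>'u\<close> being arbitrary, may be as large as desired.\<close>

type_synonym ('h, 'u) universe = "'h + nat + 'u"

end

theory Submission
  imports Defs
begin

text \<open>Write \<open>L\<close> for the target of \<open>\<pi>\<close>, \<open>A\<close> for the algebra of left coinvariants and \<open>A\<^sup>+\<close> for its
augmentation part, and use Sweedler indices.  Once \<open>HA\<^sup>+ = ker \<pi>\<close> is known, the Hopf algebra structure
of \<open>L\<close> is carried over to the set of cosets by the bijection \<open>L \<rightarrow> H/ker \<pi>\<close> (\<open>hopf_transport\<close>,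
\<open>kernel_quotient\<close>), so that equality of subspaces is the heart of the matter
(\<open>kernel_eq_coinv_ideal\<close>).

The algebra \<open>H\<close> is a left \<open>L\<close>-comodule under \<open>\<lambda>(h) = \<pi>(h\<^sub>1) \<otimes> h\<^sub>2\<close>.  For \<open>k \<in> A\<close> one has
\<open>\<lambda>(hk) = \<lambda>(h)(1 \<otimes> k)\<close>, hence \<open>HA\<^sup>+\<close> is a subcomodule, and \<open>HA\<^sup>+ \<rightarrow> H \<rightarrow> L\<close> is a sequence of left
comodules with composite zero.  It is exact in the middle if and only if \<open>HA\<^sup>+ = ker \<pi>\<close>.  By faithful
coflatness it is enough to see this after cotensoring with \<open>H\<close>, where everything can be computed:
the map \<open>g \<otimes> x \<mapsto> g\<^sub>1 \<otimes> S(g\<^sub>2)x\<close> of \<open>H \<otimes> H\<close>, with inverse \<open>g \<otimes> x \<mapsto> g\<^sub>1 \<otimes> g\<^sub>2 x\<close>, takes the cotensor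
product of \<open>H\<close> with itself into \<open>H \<otimes> A\<close> and the part of it killed by \<open>id \<otimes> \<pi>\<close> into \<open>H \<otimes> A\<^sup>+\<close>.
The inverse map takes \<open>H \<otimes> A\<^sup>+\<close> into \<open>H \<otimes> HA\<^sup>+\<close> (\<open>cotensor_kernel\<close>).

Two devices keep this computation short.  The displayed map makes sense for every \<open>H\<close>-module in place
of the second factor and is natural in it (\<open>twist\<close>, \<open>twist_natural\<close>).  Naturality with respect to
the \<open>H\<close>-linear map \<open>\<lambda>\<close> replaces all computations of \<open>\<Delta>\<close> on antipodes.  Secondly, a linear map
\<open>f\<close> between vector spaces has a linear \<open>g\<close> with \<open>f g f = f\<close> (\<open>regular_inverse_exists\<close>).
Thus the kernel of \<open>id \<otimes> f\<close> consists of tensors fixed by \<open>id \<otimes> r\<close> for an operator \<open>r\<close> with \<open>f r = 0\<close>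
(\<open>tensor_kernel\<close>), and membership of a tensor in \<open>H \<otimes> W\<close> for a subspace \<open>W\<close> can be expressed by
such operators, without comparing the tensor products of different spaces.

Since faithful coflatness is tested on comodules inside one given type, the comodules \<open>HA\<^sup>+\<close>, \<open>H\<close> and
\<open>L\<close> have to be copied into it: \<open>faithfully_coflat_reflects_exact\<close> does so for arbitrary
comodules that embed there, and \<open>L\<close> embeds through a section of \<open>\<pi>\<close>.\<close>

locale base_field = field K for K :: "('k, 'z) ring_scheme" (structure)
begin

lemma module_abelian_group: "module K V \<Longrightarrow> abelian_group V"
  by (rule module.axioms(2))

lemma module_abelian_monoid: "module K V \<Longrightarrow> abelian_monoid V"
  by (rule abelian_group.axioms(1)[OF module_abelian_group])

lemmas module_simps [simp] =
  abelian_monoid.a_closed[OF module_abelian_monoid]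
  abelian_monoid.zero_closed[OF module_abelian_monoid]
  abelian_monoid.l_zero[OF module_abelian_monoid]
  abelian_monoid.r_zero[OF module_abelian_monoid]
  abelian_group.a_inv_closed[OF module_abelian_group]
  abelian_group.r_neg[OF module_abelian_group]
  abelian_group.l_neg[OF module_abelian_group]
  module.smult_closed[where R=K]
  module.smult_one[where R=K]
  module.smult_l_null[where R=K]
  module.smult_r_null[where R=K]

lemmas module_assoc = abelian_monoid.a_assoc[OF module_abelian_monoid]
lemmas module_comm = abelian_monoid.a_comm[OF module_abelian_monoid]
lemmas module_lcomm = abelian_monoid.a_lcomm[OF module_abelian_monoid]
lemmas module_ac = module_assoc module_comm module_lcomm

lemma module_minus_smult:
  assumes "module K V" "x \<in> carrier V"
  shows "\<ominus>\<^bsub>V\<^esub> x = (\<ominus> \<one>) \<odot>\<^bsub>V\<^esub> x"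
  using module.smult_l_minus[OF assms(1) one_closed assms(2)] assms by simp

text \<open>The additive monoids of records of different types are themselves of different types, so
that this cannot be had by rewriting with an equation between them.\<close>

lemma abelian_group_cong_iff:
  assumes "carrier V = carrier W" "zero V = zero W" "add V = add W"
  shows "abelian_group V \<longleftrightarrow> abelian_group W"
    unfolding abelian_group_def abelian_monoid_def abelian_group_axioms_def comm_group_def
      comm_monoid_def comm_monoid_axioms_def group_def monoid_def group_axioms_def Units_def
    by (simp add: assms)

lemma module_cong_iff:
  assumes "carrier V = carrier W" "zero V = zero W" "add V = add W" "smult V = smult W"
  shows "module K V \<longleftrightarrow> module K W"
  using abelian_group_cong_iff[OF assms(1-3)]
  unfolding module_def module_axioms_def by (simp add: assms)

section \<open>Linear maps\<close>

abbreviation lin where "lin V W \<equiv> lin_maps K V W"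

lemma linI:
  assumes "\<And>x. x \<in> carrier V \<Longrightarrow> f x \<in> carrier W"
    and "\<And>x y. x \<in> carrier V \<Longrightarrow> y \<in> carrier V \<Longrightarrow> f (x \<oplus>\<^bsub>V\<^esub> y) = f x \<oplus>\<^bsub>W\<^esub> f y"
    and "\<And>c x. c \<in> carrier K \<Longrightarrow> x \<in> carrier V \<Longrightarrow> f (c \<odot>\<^bsub>V\<^esub> x) = c \<odot>\<^bsub>W\<^esub> f x"
  shows "f \<in> lin V W"
  using assms by (auto simp: lin_maps_def)

lemma lin_closed: "f \<in> lin V W \<Longrightarrow> x \<in> carrier V \<Longrightarrow> f x \<in> carrier W"
  and lin_add: "f \<in> lin V W \<Longrightarrow> x \<in> carrier V \<Longrightarrow> y \<in> carrier V \<Longrightarrow>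
    f (x \<oplus>\<^bsub>V\<^esub> y) = f x \<oplus>\<^bsub>W\<^esub> f y"
  and lin_smult: "f \<in> lin V W \<Longrightarrow> c \<in> carrier K \<Longrightarrow> x \<in> carrier V \<Longrightarrow>
    f (c \<odot>\<^bsub>V\<^esub> x) = c \<odot>\<^bsub>W\<^esub> f x"
  by (auto simp: lin_maps_def)

lemma lin_zero:
  assumes "module K V" "module K W" "f \<in> lin V W"
  shows "f \<zero>\<^bsub>V\<^esub> = \<zero>\<^bsub>W\<^esub>"
proof -
  have "f (\<zero> \<odot>\<^bsub>V\<^esub> \<zero>\<^bsub>V\<^esub>) = \<zero> \<odot>\<^bsub>W\<^esub> f \<zero>\<^bsub>V\<^esub>"
    using assms by (intro lin_smult) auto
  then show ?thesis using assms lin_closed[OF assms(3)] by simp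
qed

lemma lin_uminus:
  assumes "module K V" "module K W" "f \<in> lin V W" "x \<in> carrier V"
  shows "f (\<ominus>\<^bsub>V\<^esub> x) = \<ominus>\<^bsub>W\<^esub> f x"
  using assms lin_smult[OF assms(3), of "\<ominus> \<one>" x] lin_closed[OF assms(3)]
  by (simp add: module_minus_smult)

lemma lin_comp: "f \<in> lin V W \<Longrightarrow> g \<in> lin W U \<Longrightarrow> (\<lambda>x. g (f x)) \<in> lin V U"
  by (auto simp: lin_maps_def Pi_iff)

lemma lin_id: "(\<lambda>x. x) \<in> lin V V"
  by (auto simp: lin_maps_def)

lemma lin_id': "id \<in> lin V V"
  by (auto simp: lin_maps_def)

lemma lin_cong:
  assumes "f \<in> lin V W" "module K V" "\<And>x. x \<in> carrier V \<Longrightarrow> g x = f x"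
  shows "g \<in> lin V W"
  using assms by (auto simp: lin_maps_def Pi_iff)

lemma lin_const_zero: "module K W \<Longrightarrow> (\<lambda>_. \<zero>\<^bsub>W\<^esub>) \<in> lin V W"
  by (intro linI) auto

lemma module_add4:
  assumes "module K V" "a \<in> carrier V" "b \<in> carrier V" "c \<in> carrier V" "d \<in> carrier V"
  shows "(a \<oplus>\<^bsub>V\<^esub> b) \<oplus>\<^bsub>V\<^esub> (c \<oplus>\<^bsub>V\<^esub> d) = (a \<oplus>\<^bsub>V\<^esub> c) \<oplus>\<^bsub>V\<^esub> (b \<oplus>\<^bsub>V\<^esub> d)"
  using assms by (simp add: module_ac)

lemma module_diff_zero:
  assumes "module K V" "a \<in> carrier V" "b \<in> carrier V"
  shows "a \<oplus>\<^bsub>V\<^esub> \<ominus>\<^bsub>V\<^esub> b = \<zero>\<^bsub>V\<^esub> \<longleftrightarrow> a = b"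
  using assms abelian_group.minus_equality[OF module_abelian_group[OF assms(1)], of a "\<ominus>\<^bsub>V\<^esub> b"]
  by (auto simp: abelian_group.minus_minus[OF module_abelian_group[OF assms(1)]])

lemma module_add_diff:
  assumes "module K V" "a \<in> carrier V" "b \<in> carrier V"
  shows "(a \<oplus>\<^bsub>V\<^esub> b) \<oplus>\<^bsub>V\<^esub> \<ominus>\<^bsub>V\<^esub> a = b"
  using assms by (simp add: module_comm[OF assms(1,2,3)] module_assoc)

lemma lin_plus:
  assumes "module K W" "f \<in> lin V W" "g \<in> lin V W"
  shows "(\<lambda>x. f x \<oplus>\<^bsub>W\<^esub> g x) \<in> lin V W"
  using assms lin_closed[OF assms(2)] lin_closed[OF assms(3)]
  by (intro linI)
     (auto simp: lin_add[OF assms(2)] lin_add[OF assms(3)] lin_smult[OF assms(2)]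
       lin_smult[OF assms(3)] module_add4[OF assms(1)] module.smult_r_distr[OF assms(1)])

lemma lin_scale:
  assumes "module K W" "f \<in> lin V W" "c \<in> carrier K"
  shows "(\<lambda>x. c \<odot>\<^bsub>W\<^esub> f x) \<in> lin V W"
proof (intro linI)
  fix d x assume "d \<in> carrier K" "x \<in> carrier V"
  then show "c \<odot>\<^bsub>W\<^esub> f (d \<odot>\<^bsub>V\<^esub> x) = d \<odot>\<^bsub>W\<^esub> (c \<odot>\<^bsub>W\<^esub> f x)"
    using assms lin_closed[OF assms(2)]
    by (simp add: lin_smult[OF assms(2)] module.smult_assoc1[OF assms(1), symmetric] m_comm)
qed (use assms lin_closed[OF assms(2)] in
      \<open>auto simp: lin_add[OF assms(2)] module.smult_r_distr[OF assms(1)]\<close>)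

lemma lin_minus:
  assumes "module K W" and V: "module K V" and "f \<in> lin V W" "g \<in> lin V W"
  shows "(\<lambda>x. f x \<oplus>\<^bsub>W\<^esub> \<ominus>\<^bsub>W\<^esub> g x) \<in> lin V W"
proof -
  have *: "(\<lambda>x. f x \<oplus>\<^bsub>W\<^esub> (\<ominus> \<one>) \<odot>\<^bsub>W\<^esub> g x) \<in> lin V W"
    using assms by (intro lin_plus lin_scale) auto
  show ?thesis
    by (rule lin_cong[OF * V]) (simp add: module_minus_smult[OF assms(1)] lin_closed[OF assms(4)])
qed

section \<open>Subspaces\<close>

text \<open>Closure under negation is subsumed under closure under multiplication by \<open>-1\<close>.\<close>

lemma submodule_iff:
  assumes V: "module K V"
  shows "submodule N K V \<longleftrightarrow> N \<subseteq> carrier V \<and> \<zero>\<^bsub>V\<^esub> \<in> N \<and>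
    (\<forall>x\<in>N. \<forall>y\<in>N. x \<oplus>\<^bsub>V\<^esub> y \<in> N) \<and> (\<forall>c\<in>carrier K. \<forall>x\<in>N. c \<odot>\<^bsub>V\<^esub> x \<in> N)"
proof
  assume N: "submodule N K V"
  note E = module.submoduleE[OF V N]
  obtain x where "x \<in> N" using E(2) by auto
  then have "\<zero> \<odot>\<^bsub>V\<^esub> x \<in> N" using E by auto
  then have "\<zero>\<^bsub>V\<^esub> \<in> N" using V E(1) \<open>x \<in> N\<close> by auto
  then show "N \<subseteq> carrier V \<and> \<zero>\<^bsub>V\<^esub> \<in> N \<and>
    (\<forall>x\<in>N. \<forall>y\<in>N. x \<oplus>\<^bsub>V\<^esub> y \<in> N) \<and> (\<forall>c\<in>carrier K. \<forall>x\<in>N. c \<odot>\<^bsub>V\<^esub> x \<in> N)"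
    using E by auto
next
  assume *: "N \<subseteq> carrier V \<and> \<zero>\<^bsub>V\<^esub> \<in> N \<and>
    (\<forall>x\<in>N. \<forall>y\<in>N. x \<oplus>\<^bsub>V\<^esub> y \<in> N) \<and> (\<forall>c\<in>carrier K. \<forall>x\<in>N. c \<odot>\<^bsub>V\<^esub> x \<in> N)"
  show "submodule N K V"
  proof (rule module.submoduleI[OF V])
    fix a assume "a \<in> N"
    then show "\<ominus>\<^bsub>V\<^esub> a \<in> N" using * V by (auto simp: module_minus_smult)
  qed (use * in auto)
qed

lemma submodule_module: "module K V \<Longrightarrow> submodule N K V \<Longrightarrow> module K (V\<lparr>carrier := N\<rparr>)"
  by (rule submodule.submodule_is_module)

lemma submodule_diff:
  assumes "module K V" "submodule N K V" "x \<in> N" "y \<in> N"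
  shows "x \<oplus>\<^bsub>V\<^esub> \<ominus>\<^bsub>V\<^esub> y \<in> N"
  using module.submoduleE[OF assms(1,2)] assms(3,4) by auto

lemma Inter_submodule:
  assumes V: "module K V" and "\<S> \<noteq> {}" and S: "\<And>N. N \<in> \<S> \<Longrightarrow> submodule N K V"
  shows "submodule (\<Inter>\<S>) K V"
proof -
  have S': "N \<subseteq> carrier V" "\<zero>\<^bsub>V\<^esub> \<in> N" "\<And>x y. x \<in> N \<Longrightarrow> y \<in> N \<Longrightarrow> x \<oplus>\<^bsub>V\<^esub> y \<in> N"
    "\<And>c x. c \<in> carrier K \<Longrightarrow> x \<in> N \<Longrightarrow> c \<odot>\<^bsub>V\<^esub> x \<in> N" if "N \<in> \<S>" for N
    using S[OF that] by (simp_all add: submodule_iff[OF V])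
  show ?thesis
    unfolding submodule_iff[OF V]
  proof (intro conjI ballI)
    show "\<Inter>\<S> \<subseteq> carrier V" using S'(1) assms(2) by fast
  qed (use S' in \<open>auto\<close>)
qed

lemma kernel_submodule:
  assumes "module K V" "module K W" "f \<in> lin V W"
  shows "submodule {x \<in> carrier V. f x = \<zero>\<^bsub>W\<^esub>} K V"
  using assms by (auto simp: submodule_iff lin_zero lin_add[OF assms(3)] lin_smult[OF assms(3)])

lemma image_submodule:
  assumes "module K V" "module K W" "f \<in> lin V W"
  shows "submodule (f ` carrier V) K W"
proof -
  have "f x \<oplus>\<^bsub>W\<^esub> f y \<in> f ` carrier V" if "x \<in> carrier V" "y \<in> carrier V" for x y
    using that assms(1) lin_add[OF assms(3), of x y, symmetric] by auto
  moreover have "c \<odot>\<^bsub>W\<^esub> f x \<in> f ` carrier V" if "x \<in> carrier V" "c \<in> carrier K" for x c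
    using that assms(1) lin_smult[OF assms(3), of c x, symmetric] by auto
  moreover have "\<zero>\<^bsub>W\<^esub> \<in> f ` carrier V"
    using lin_zero[OF assms, symmetric] assms(1) by auto
  ultimately show ?thesis
    using assms lin_closed[OF assms(3)] by (auto simp: submodule_iff)
qed

text \<open>Zorn's lemma gives a maximal subspace \<open>C\<close> meeting \<open>N\<close> in zero.  If \<open>v\<close> were outside \<open>N + C\<close>, then
\<open>C + Kv\<close> would still meet \<open>N\<close> in zero, because the coefficient of \<open>v\<close> in a common nonzero element
could be inverted.\<close>

lemma complement_exists:
  assumes V: "module K V" and N: "submodule N K V"
  obtains C where "submodule C K V" "N \<inter> C = {\<zero>\<^bsub>V\<^esub>}"
    "\<And>v. v \<in> carrier V \<Longrightarrow> \<exists>n\<in>N. \<exists>c\<in>C. v = n \<oplus>\<^bsub>V\<^esub> c"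
proof -
  define \<A> where "\<A> = {C. submodule C K V \<and> N \<inter> C = {\<zero>\<^bsub>V\<^esub>}}"
  note sub = submodule_iff[OF V]
  have "{\<zero>\<^bsub>V\<^esub>} \<in> \<A>" using V N by (auto simp: \<A>_def sub)
  then have ne: "\<A> \<noteq> {}" by auto
  have ch: "\<Union>\<C> \<in> \<A>" if \<C>ne: "\<C> \<noteq> {}" and chain: "subset.chain \<A> \<C>" for \<C>
  proof -
    have A: "C \<in> \<A>" if "C \<in> \<C>" for C
      using chain that by (auto simp: subset.chain_def)
    have "x \<oplus>\<^bsub>V\<^esub> y \<in> \<Union>\<C>" if xy: "x \<in> \<Union>\<C>" "y \<in> \<Union>\<C>" for x y
    proof -
      obtain X Y where XY: "X \<in> \<C>" "Y \<in> \<C>" "x \<in> X" "y \<in> Y" using xy by auto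
      then have "X \<subseteq> Y \<or> Y \<subseteq> X" using chain by (auto simp: subset_chain_def)
      then obtain Z where "Z \<in> \<C>" "x \<in> Z" "y \<in> Z" using XY by auto
      moreover have "submodule Z K V" using A[OF \<open>Z \<in> \<C>\<close>] by (auto simp: \<A>_def)
      ultimately show ?thesis by (auto simp: sub)
    qed
    note add = this
    obtain Z where Z: "Z \<in> \<C>" using \<C>ne by auto
    have B: "C \<subseteq> carrier V" "\<zero>\<^bsub>V\<^esub> \<in> C" "\<forall>c\<in>carrier K. \<forall>x\<in>C. c \<odot>\<^bsub>V\<^esub> x \<in> C"
      "N \<inter> C = {\<zero>\<^bsub>V\<^esub>}" if "C \<in> \<C>" for C
      using A[OF that] by (simp_all add: \<A>_def sub)
    have "submodule (\<Union>\<C>) K V"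
      unfolding sub
    proof (intro conjI ballI)
      show "\<Union>\<C> \<subseteq> carrier V" using B(1) by auto
      show "\<zero>\<^bsub>V\<^esub> \<in> \<Union>\<C>" using B(2) Z by auto
      fix c x assume "c \<in> carrier K" "x \<in> \<Union>\<C>"
      then show "c \<odot>\<^bsub>V\<^esub> x \<in> \<Union>\<C>" using B(3) by blast
    qed (use add in blast)
    moreover have "N \<inter> \<Union>\<C> = {\<zero>\<^bsub>V\<^esub>}"
    proof
      show "N \<inter> \<Union>\<C> \<subseteq> {\<zero>\<^bsub>V\<^esub>}" using B(4) by fast
      show "{\<zero>\<^bsub>V\<^esub>} \<subseteq> N \<inter> \<Union>\<C>" using B(4)[OF Z] Z by fast
    qed
    ultimately show ?thesis by (auto simp: \<A>_def)
  qed
  obtain C where C: "C \<in> \<A>" and max: "\<And>X. X \<in> \<A> \<Longrightarrow> C \<subseteq> X \<Longrightarrow> X = C"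
    using subset_Zorn_nonempty[OF ne ch] by blast
  have Cs: "submodule C K V" and NC: "N \<inter> C = {\<zero>\<^bsub>V\<^esub>}" using C by (auto simp: \<A>_def)
  have Cc: "C \<subseteq> carrier V" and Nc: "N \<subseteq> carrier V" using Cs N by (auto simp: sub)
  have "\<exists>n\<in>N. \<exists>c\<in>C. v = n \<oplus>\<^bsub>V\<^esub> c" if v: "v \<in> carrier V" for v
  proof (rule ccontr)
    assume nv: "\<not> ?thesis"
    define X where "X = {c \<oplus>\<^bsub>V\<^esub> a \<odot>\<^bsub>V\<^esub> v |c a. c \<in> C \<and> a \<in> carrier K}"
    have "submodule X K V"
      unfolding sub
    proof (intro conjI ballI)
      show "X \<subseteq> carrier V" using V v Cc by (auto simp: X_def)
      have "\<zero>\<^bsub>V\<^esub> = \<zero>\<^bsub>V\<^esub> \<oplus>\<^bsub>V\<^esub> \<zero> \<odot>\<^bsub>V\<^esub> v" using V v by simp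
      then show "\<zero>\<^bsub>V\<^esub> \<in> X" using Cs by (auto simp: X_def sub)
    next
      fix x y assume "x \<in> X" "y \<in> X"
      then obtain c a d b where *: "x = c \<oplus>\<^bsub>V\<^esub> a \<odot>\<^bsub>V\<^esub> v" "y = d \<oplus>\<^bsub>V\<^esub> b \<odot>\<^bsub>V\<^esub> v"
        "c \<in> C" "d \<in> C" "a \<in> carrier K" "b \<in> carrier K" by (auto simp: X_def)
      then have "x \<oplus>\<^bsub>V\<^esub> y = (c \<oplus>\<^bsub>V\<^esub> d) \<oplus>\<^bsub>V\<^esub> (a \<oplus> b) \<odot>\<^bsub>V\<^esub> v"
        using V v Cc module_add4[OF V, of c "a \<odot>\<^bsub>V\<^esub> v" d "b \<odot>\<^bsub>V\<^esub> v"]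
        by (auto simp: module.smult_l_distr[OF V])
      moreover have "c \<oplus>\<^bsub>V\<^esub> d \<in> C" using Cs * by (auto simp: sub)
      ultimately show "x \<oplus>\<^bsub>V\<^esub> y \<in> X" using * by (auto simp: X_def)
    next
      fix e x assume e: "e \<in> carrier K" and "x \<in> X"
      then obtain c a where *: "x = c \<oplus>\<^bsub>V\<^esub> a \<odot>\<^bsub>V\<^esub> v" "c \<in> C" "a \<in> carrier K" by (auto simp: X_def)
      then have "e \<odot>\<^bsub>V\<^esub> x = e \<odot>\<^bsub>V\<^esub> c \<oplus>\<^bsub>V\<^esub> (e \<otimes> a) \<odot>\<^bsub>V\<^esub> v"
        using V v Cc e by (auto simp: module.smult_r_distr[OF V] module.smult_assoc1[OF V])
      moreover have "e \<odot>\<^bsub>V\<^esub> c \<in> C" using Cs * e by (auto simp: sub)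
      ultimately show "e \<odot>\<^bsub>V\<^esub> x \<in> X" using * e by (auto simp: X_def)
    qed
    moreover have "N \<inter> X = {\<zero>\<^bsub>V\<^esub>}"
    proof -
      have "x = \<zero>\<^bsub>V\<^esub>" if xN: "x \<in> N" and "x \<in> X" for x
      proof -
        obtain c a where *: "x = c \<oplus>\<^bsub>V\<^esub> a \<odot>\<^bsub>V\<^esub> v" "c \<in> C" "a \<in> carrier K"
          using \<open>x \<in> X\<close> by (auto simp: X_def)
        show ?thesis
        proof (cases "a = \<zero>")
          case True
          then have "x = c" using * V v Cc by auto
          then show ?thesis using NC * xN by auto
        next
          case False
          then have iK: "inv a \<in> carrier K" "inv a \<otimes> a = \<one>"
            using * field_Units by (auto intro: Units_l_inv)
          have cc: "c \<in> carrier V" using * Cc by auto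
          have xc: "x \<in> carrier V" using xN Nc by auto
          have "a \<odot>\<^bsub>V\<^esub> v = x \<oplus>\<^bsub>V\<^esub> \<ominus>\<^bsub>V\<^esub> c"
            unfolding *(1) using module_add_diff[OF V cc] V v *(3) by simp
          then have "inv a \<odot>\<^bsub>V\<^esub> (a \<odot>\<^bsub>V\<^esub> v) = inv a \<odot>\<^bsub>V\<^esub> x \<oplus>\<^bsub>V\<^esub> inv a \<odot>\<^bsub>V\<^esub> (\<ominus>\<^bsub>V\<^esub> c)"
            using iK xc cc V by (simp add: module.smult_r_distr[OF V])
          then have "v = inv a \<odot>\<^bsub>V\<^esub> x \<oplus>\<^bsub>V\<^esub> inv a \<odot>\<^bsub>V\<^esub> (\<ominus>\<^bsub>V\<^esub> c)"
            using iK v *(3) V by (simp add: module.smult_assoc1[OF V, symmetric])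
          moreover have "inv a \<odot>\<^bsub>V\<^esub> x \<in> N" using N iK xN by (auto simp: sub)
          moreover have "inv a \<odot>\<^bsub>V\<^esub> (\<ominus>\<^bsub>V\<^esub> c) \<in> C"
            using Cs iK *(2) module.submoduleE(3)[OF V Cs] by (auto simp: sub)
          ultimately show ?thesis using nv by blast
        qed
      qed
      moreover have "\<zero>\<^bsub>V\<^esub> \<in> N \<inter> X" using \<open>submodule X K V\<close> N by (auto simp: sub)
      ultimately show ?thesis by auto
    qed
    ultimately have "X \<in> \<A>" by (auto simp: \<A>_def)
    moreover have "C \<subseteq> X"
    proof
      fix c assume "c \<in> C"
      then have "c = c \<oplus>\<^bsub>V\<^esub> \<zero> \<odot>\<^bsub>V\<^esub> v" using V v Cc by auto
      then show "c \<in> X" using \<open>c \<in> C\<close> by (auto simp: X_def)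
    qed
    ultimately have "X = C" by (rule max)
    have "v = \<zero>\<^bsub>V\<^esub> \<oplus>\<^bsub>V\<^esub> \<one> \<odot>\<^bsub>V\<^esub> v" using V v by simp
    then have "v \<in> X" using Cs by (auto simp: X_def sub)
    then have "v \<in> C" using \<open>X = C\<close> by simp
    moreover have "v = \<zero>\<^bsub>V\<^esub> \<oplus>\<^bsub>V\<^esub> v" using V v by simp
    moreover have "\<zero>\<^bsub>V\<^esub> \<in> N" using N by (auto simp: sub)
    ultimately show False using nv by blast
  qed
  then show thesis using that Cs NC by blast
qed

text \<open>Choose complements \<open>C\<close> of \<open>ker f\<close> and \<open>D\<close> of \<open>im f\<close>; \<open>g\<close> sends \<open>f(c) + d\<close> to \<open>c\<close>.  This one statement
stands in for all exactness properties of tensor products over a field: for an inclusion \<open>f\<close> it yields a retraction, and in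
general \<open>id - g f\<close> is an operator whose values lie in the kernel of \<open>f\<close>.\<close>

lemma regular_inverse_exists:
  assumes V: "module K V" and W: "module K W" and f: "f \<in> lin V W"
  obtains g where "g \<in> lin W V" "\<And>x. x \<in> carrier V \<Longrightarrow> f (g (f x)) = f x"
proof -
  note subV = submodule_iff[OF V] and subW = submodule_iff[OF W]
  obtain C where C: "submodule C K V" "{x \<in> carrier V. f x = \<zero>\<^bsub>W\<^esub>} \<inter> C = {\<zero>\<^bsub>V\<^esub>}"
    "\<And>v. v \<in> carrier V \<Longrightarrow> \<exists>n\<in>{x \<in> carrier V. f x = \<zero>\<^bsub>W\<^esub>}. \<exists>c\<in>C. v = n \<oplus>\<^bsub>V\<^esub> c"
    using complement_exists[OF V kernel_submodule[OF V W f]] by blast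
  obtain D where D: "submodule D K W" "f ` carrier V \<inter> D = {\<zero>\<^bsub>W\<^esub>}"
    "\<And>w. w \<in> carrier W \<Longrightarrow> \<exists>n\<in>f ` carrier V. \<exists>d\<in>D. w = n \<oplus>\<^bsub>W\<^esub> d"
    using complement_exists[OF W image_submodule[OF V W f]] by blast
  have Cc: "c \<in> carrier V" if "c \<in> C" for c using C(1) that by (auto simp: subV)
  have Dc: "d \<in> carrier W" if "d \<in> D" for d using D(1) that by (auto simp: subW)
  (* c is the component in C of a preimage of the im f-part of w *)
  define P where "P w c \<longleftrightarrow> c \<in> C \<and> (\<exists>d\<in>D. w = f c \<oplus>\<^bsub>W\<^esub> d)" for w c
  have ex: "\<exists>c. P w c" if w: "w \<in> carrier W" for w
  proof -
    obtain v d where vd: "v \<in> carrier V" "d \<in> D" "w = f v \<oplus>\<^bsub>W\<^esub> d" using D(3)[OF w] by auto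
    obtain n c where nc: "n \<in> carrier V" "f n = \<zero>\<^bsub>W\<^esub>" "c \<in> C" "v = n \<oplus>\<^bsub>V\<^esub> c"
      using C(3)[OF vd(1)] by auto
    have "f v = f c" using nc W lin_closed[OF f] Cc by (simp add: lin_add[OF f])
    then show ?thesis using vd nc by (auto simp: P_def)
  qed
  have uniq: "c = c'" if Pc: "P w c" "P w c'" for w c c'
  proof -
    obtain d d' where *: "c \<in> C" "c' \<in> C" "d \<in> D" "d' \<in> D" "f c \<oplus>\<^bsub>W\<^esub> d = f c' \<oplus>\<^bsub>W\<^esub> d'"
      using Pc by (auto simp: P_def)
    have cl: "c \<in> carrier V" "c' \<in> carrier V" "d \<in> carrier W" "d' \<in> carrier W" using * Cc Dc by auto
    have fc: "f c \<in> carrier W" "f c' \<in> carrier W" using cl lin_closed[OF f] by auto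
    have eq: "f c \<oplus>\<^bsub>W\<^esub> \<ominus>\<^bsub>W\<^esub> f c' = d' \<oplus>\<^bsub>W\<^esub> \<ominus>\<^bsub>W\<^esub> d"
    proof -
      have "f c = (f c \<oplus>\<^bsub>W\<^esub> d) \<oplus>\<^bsub>W\<^esub> \<ominus>\<^bsub>W\<^esub> d" using fc cl W by (simp add: module_assoc)
      also have "\<dots> = (f c' \<oplus>\<^bsub>W\<^esub> d') \<oplus>\<^bsub>W\<^esub> \<ominus>\<^bsub>W\<^esub> d" by (simp add: *(5))
      also have "\<dots> = f c' \<oplus>\<^bsub>W\<^esub> (d' \<oplus>\<^bsub>W\<^esub> \<ominus>\<^bsub>W\<^esub> d)" using fc cl W by (simp add: module_assoc)
      finally have "f c \<oplus>\<^bsub>W\<^esub> \<ominus>\<^bsub>W\<^esub> f c' = (d' \<oplus>\<^bsub>W\<^esub> \<ominus>\<^bsub>W\<^esub> d) \<oplus>\<^bsub>W\<^esub> (f c' \<oplus>\<^bsub>W\<^esub> \<ominus>\<^bsub>W\<^esub> f c')"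
        using fc cl W by (simp add: module_comm[OF W, of "f c'"] module_assoc)
      then show ?thesis using fc cl W by simp
    qed
    have fd: "f (c \<oplus>\<^bsub>V\<^esub> \<ominus>\<^bsub>V\<^esub> c') = f c \<oplus>\<^bsub>W\<^esub> \<ominus>\<^bsub>W\<^esub> f c'"
      using cl V W f by (simp add: lin_add[OF f] lin_uminus)
    have "f (c \<oplus>\<^bsub>V\<^esub> \<ominus>\<^bsub>V\<^esub> c') \<in> f ` carrier V \<inter> D"
      using submodule_diff[OF W D(1) *(4,3)] cl V unfolding fd eq[symmetric] by (auto simp: fd[symmetric])
    then have "f (c \<oplus>\<^bsub>V\<^esub> \<ominus>\<^bsub>V\<^esub> c') = \<zero>\<^bsub>W\<^esub>" using D(2) by auto
    then have "c \<oplus>\<^bsub>V\<^esub> \<ominus>\<^bsub>V\<^esub> c' \<in> {x \<in> carrier V. f x = \<zero>\<^bsub>W\<^esub>} \<inter> C"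
      using submodule_diff[OF V C(1) *(1,2)] cl V by auto
    then have "c \<oplus>\<^bsub>V\<^esub> \<ominus>\<^bsub>V\<^esub> c' = \<zero>\<^bsub>V\<^esub>" using C(2) by auto
    then show ?thesis using module_diff_zero[OF V] cl by auto
  qed
  define g where "g w = (THE c. P w c)" for w
  have gP: "P w (g w)" if "w \<in> carrier W" for w
    unfolding g_def using ex[OF that] uniq by (metis theI)
  have geq: "g w = c" if "w \<in> carrier W" "P w c" for w c using gP uniq that by blast
  have "g \<in> lin W V"
  proof (rule linI)
    fix x assume "x \<in> carrier W"
    then show "g x \<in> carrier V" using gP Cc by (auto simp: P_def)
  next
    fix x y assume xy: "x \<in> carrier W" "y \<in> carrier W"
    obtain d d' where *: "d \<in> D" "d' \<in> D" "x = f (g x) \<oplus>\<^bsub>W\<^esub> d" "y = f (g y) \<oplus>\<^bsub>W\<^esub> d'"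
      and gC: "g x \<in> C" "g y \<in> C"
      using gP[OF xy(1)] gP[OF xy(2)] by (auto simp: P_def)
    have "x \<oplus>\<^bsub>W\<^esub> y = (f (g x) \<oplus>\<^bsub>W\<^esub> d) \<oplus>\<^bsub>W\<^esub> (f (g y) \<oplus>\<^bsub>W\<^esub> d')" using * by simp
    also have "\<dots> = f (g x \<oplus>\<^bsub>V\<^esub> g y) \<oplus>\<^bsub>W\<^esub> (d \<oplus>\<^bsub>W\<^esub> d')"
      using * gC Cc Dc lin_closed[OF f] by (simp add: lin_add[OF f] module_add4[OF W])
    finally have "P (x \<oplus>\<^bsub>W\<^esub> y) (g x \<oplus>\<^bsub>V\<^esub> g y)"
      using C(1) D(1) gC * by (auto simp: P_def subV subW)
    then show "g (x \<oplus>\<^bsub>W\<^esub> y) = g x \<oplus>\<^bsub>V\<^esub> g y" using geq xy W by simp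
  next
    fix a x assume ax: "a \<in> carrier K" "x \<in> carrier W"
    obtain d where *: "d \<in> D" "x = f (g x) \<oplus>\<^bsub>W\<^esub> d" and gC: "g x \<in> C"
      using gP[OF ax(2)] by (auto simp: P_def)
    have "a \<odot>\<^bsub>W\<^esub> x = a \<odot>\<^bsub>W\<^esub> (f (g x) \<oplus>\<^bsub>W\<^esub> d)" using *(2) by simp
    also have "\<dots> = f (a \<odot>\<^bsub>V\<^esub> g x) \<oplus>\<^bsub>W\<^esub> a \<odot>\<^bsub>W\<^esub> d"
      using *(1) ax gC Cc Dc V lin_closed[OF f] by (simp add: lin_smult[OF f] module.smult_r_distr[OF W])
    finally have "P (a \<odot>\<^bsub>W\<^esub> x) (a \<odot>\<^bsub>V\<^esub> g x)"
      using C(1) D(1) gC * ax by (auto simp: P_def subV subW)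
    then show "g (a \<odot>\<^bsub>W\<^esub> x) = a \<odot>\<^bsub>V\<^esub> g x" using geq ax W by simp
  qed
  moreover have "f (g (f x)) = f x" if x: "x \<in> carrier V" for x
  proof -
    obtain n c where nc: "n \<in> carrier V" "f n = \<zero>\<^bsub>W\<^esub>" "c \<in> C" "x = n \<oplus>\<^bsub>V\<^esub> c"
      using C(3)[OF x] by auto
    have fx: "f x = f c" using nc W lin_closed[OF f] Cc by (simp add: lin_add[OF f])
    have "P (f x) c" using nc W D(1) lin_closed[OF f] Cc unfolding P_def fx
      by (auto simp: subW intro!: bexI[of _ "\<zero>\<^bsub>W\<^esub>"])
    then have "g (f x) = c" using geq lin_closed[OF f x] by blast
    then show ?thesis using fx by simp
  qed
  ultimately show thesis using that by blast
qed

section \<open>Quotient spaces\<close>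

lemma submodule_abelian_subgroup:
  assumes "module K V" "submodule N K V"
  shows "abelian_subgroup N V"
  using assms by (intro abelian_subgroupI3 additive_subgroup.intro module_abelian_group)
    (auto dest: submodule.axioms(1))

lemma quot_carrier: "carrier (quot_module V N) = (\<lambda>v. N +>\<^bsub>V\<^esub> v) ` carrier V"
  by (auto simp: quot_module_def FactRing_def A_RCOSETS_def')

lemma quot_add:
  assumes "module K V" "submodule N K V" "v \<in> carrier V" "w \<in> carrier V"
  shows "(N +>\<^bsub>V\<^esub> v) \<oplus>\<^bsub>quot_module V N\<^esub> (N +>\<^bsub>V\<^esub> w) = N +>\<^bsub>V\<^esub> (v \<oplus>\<^bsub>V\<^esub> w)"
  using abelian_subgroup.a_rcos_sum[OF submodule_abelian_subgroup] assms
  by (simp add: quot_module_def FactRing_def)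

lemma mem_coset: "x \<in> N +>\<^bsub>V\<^esub> v \<longleftrightarrow> (\<exists>n\<in>N. x = n \<oplus>\<^bsub>V\<^esub> v)"
  by (auto simp: a_r_coset_def')

lemma coset_eq_iff:
  assumes V: "module K V" "submodule N K V" and vw: "v \<in> carrier V" "w \<in> carrier V"
  shows "N +>\<^bsub>V\<^esub> v = N +>\<^bsub>V\<^esub> w \<longleftrightarrow> v \<oplus>\<^bsub>V\<^esub> \<ominus>\<^bsub>V\<^esub> w \<in> N"
proof -
  interpret abelian_subgroup N V by (rule submodule_abelian_subgroup[OF V])
  have "N +>\<^bsub>V\<^esub> v = N +>\<^bsub>V\<^esub> w \<longleftrightarrow> v \<in> N +>\<^bsub>V\<^esub> w"
    using a_repr_independence'[of v w] a_rcos_self[of v] vw by metis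
  also have "\<dots> \<longleftrightarrow> v \<oplus>\<^bsub>V\<^esub> \<ominus>\<^bsub>V\<^esub> w \<in> N"
    using a_rcos_module[OF vw(2,1)] by simp
  finally show ?thesis .
qed

lemma quot_smult:
  assumes V: "module K V" "submodule N K V" and "v \<in> carrier V" "c \<in> carrier K"
  shows "c \<odot>\<^bsub>quot_module V N\<^esub> (N +>\<^bsub>V\<^esub> v) = N +>\<^bsub>V\<^esub> (c \<odot>\<^bsub>V\<^esub> v)"
proof -
  have N: "N \<subseteq> carrier V" "\<zero>\<^bsub>V\<^esub> \<in> N" "\<And>x. x \<in> N \<Longrightarrow> c \<odot>\<^bsub>V\<^esub> x \<in> N"
    using V(2) assms(4) by (auto simp: submodule_iff[OF V(1)])
  have "N +>\<^bsub>V\<^esub> (c \<odot>\<^bsub>V\<^esub> (n \<oplus>\<^bsub>V\<^esub> v)) = N +>\<^bsub>V\<^esub> (c \<odot>\<^bsub>V\<^esub> v)" if n: "n \<in> N" for n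
  proof -
    have nc: "n \<in> carrier V" using N n by auto
    have "c \<odot>\<^bsub>V\<^esub> (n \<oplus>\<^bsub>V\<^esub> v) = c \<odot>\<^bsub>V\<^esub> v \<oplus>\<^bsub>V\<^esub> c \<odot>\<^bsub>V\<^esub> n"
      using assms nc by (simp add: module.smult_r_distr[OF V(1)] module_comm[OF V(1), of "c \<odot>\<^bsub>V\<^esub> n"])
    then have "c \<odot>\<^bsub>V\<^esub> (n \<oplus>\<^bsub>V\<^esub> v) \<oplus>\<^bsub>V\<^esub> \<ominus>\<^bsub>V\<^esub> (c \<odot>\<^bsub>V\<^esub> v) = c \<odot>\<^bsub>V\<^esub> n"
      using module_add_diff[OF V(1), of "c \<odot>\<^bsub>V\<^esub> v" "c \<odot>\<^bsub>V\<^esub> n"] assms nc by simp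
    then show ?thesis using coset_eq_iff[OF V] assms nc N n by simp
  qed
  then have "(\<Union>y\<in>N +>\<^bsub>V\<^esub> v. N +>\<^bsub>V\<^esub> (c \<odot>\<^bsub>V\<^esub> y)) = (\<Union>y\<in>N +>\<^bsub>V\<^esub> v. N +>\<^bsub>V\<^esub> (c \<odot>\<^bsub>V\<^esub> v))"
    by (intro SUP_cong refl) (auto simp: mem_coset)
  moreover have "\<zero>\<^bsub>V\<^esub> \<oplus>\<^bsub>V\<^esub> v \<in> N +>\<^bsub>V\<^esub> v"
    unfolding mem_coset using N(2) by (rule bexI[rotated]) (rule refl)
  ultimately show ?thesis by (auto simp: quot_module_def)
qed

lemma quot_module_module:
  assumes V: "module K V" "submodule N K V"
  shows "module K (quot_module V N)"
proof -
  interpret abelian_subgroup N V by (rule submodule_abelian_subgroup[OF V])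
  have "abelian_group (V Quot N)"
    by (rule comm_group_abelian_groupI)
      (simp add: FactRing_def a_factorgroup_is_comm_group[unfolded A_FactGroup_def'])
  then have ab: "abelian_group (quot_module V N)"
    by (subst abelian_group_cong_iff[where W = "V Quot N"]) (simp_all add: quot_module_def)
  show ?thesis
    by (rule moduleI[OF is_cring ab])
       (auto simp: quot_carrier quot_smult[OF V] quot_add[OF V] V
         module.smult_l_distr[OF V(1)] module.smult_r_distr[OF V(1)] module.smult_assoc1[OF V(1)])
qed

lemma quot_proj_lin:
  assumes "module K V" "submodule N K V"
  shows "(\<lambda>v. N +>\<^bsub>V\<^esub> v) \<in> lin V (quot_module V N)"
  by (intro linI) (auto simp: quot_carrier quot_add[OF assms] quot_smult[OF assms])

section \<open>Free modules\<close>

lemma free_simps: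
  "x \<in> carrier (free_module K I) \<longleftrightarrow>
     finite {i. x i \<noteq> \<zero>} \<and> {i. x i \<noteq> \<zero>} \<subseteq> I \<and> (\<forall>i. x i \<in> carrier K)"
  "\<zero>\<^bsub>free_module K I\<^esub> = (\<lambda>_. \<zero>)"
  "x \<oplus>\<^bsub>free_module K I\<^esub> y = (\<lambda>i. x i \<oplus> y i)"
  "c \<odot>\<^bsub>free_module K I\<^esub> x = (\<lambda>i. c \<otimes> x i)"
  by (auto simp: free_module_def)

lemma free_module_module: "module K (free_module K I)"
proof -
  have add: "(\<lambda>i. x i \<oplus> y i) \<in> carrier (free_module K I)"
    if xy: "x \<in> carrier (free_module K I)" "y \<in> carrier (free_module K I)" for x y
  proof -
    have "{i. x i \<oplus> y i \<noteq> \<zero>} \<subseteq> {i. x i \<noteq> \<zero>} \<union> {i. y i \<noteq> \<zero>}"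
      using xy by (auto simp: free_simps)
    then show ?thesis using xy by (auto simp: free_simps intro: finite_subset)
  qed
  have smult: "(\<lambda>i. c \<otimes> x i) \<in> carrier (free_module K I)"
    if xc: "x \<in> carrier (free_module K I)" "c \<in> carrier K" for x c
  proof -
    have "{i. c \<otimes> x i \<noteq> \<zero>} \<subseteq> {i. x i \<noteq> \<zero>}"
      using xc by (auto simp: free_simps)
    then show ?thesis using xc by (auto simp: free_simps intro: finite_subset)
  qed
  have inv: "\<exists>y\<in>carrier (free_module K I). (\<lambda>i. y i \<oplus> x i) = (\<lambda>_. \<zero>)"
    if x: "x \<in> carrier (free_module K I)" for x
    using smult[OF x, of "\<ominus> \<one>"] x
    by (intro bexI[of _ "\<lambda>i. \<ominus> \<one> \<otimes> x i"] ext) (auto simp: free_simps l_minus l_neg)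
  have "abelian_group (free_module K I)"
    by (rule abelian_groupI) (use add inv in \<open>auto simp: free_simps(2,3) free_simps(1) a_ac\<close>)
  then show ?thesis
    by (rule moduleI[OF is_cring])
       (use smult in \<open>auto simp: free_simps(3,4) free_simps(1) l_distr r_distr m_assoc\<close>)
qed

lemma single_free: "i \<in> I \<Longrightarrow> single K i \<in> carrier (free_module K I)"
proof -
  have "{j. single K i j \<noteq> \<zero>} \<subseteq> {i}" by (auto simp: single_def)
  then show "i \<in> I \<Longrightarrow> ?thesis" by (auto simp: free_simps single_def intro: finite_subset)
qed

lemma free_induct [consumes 1, case_names zero step]:
  assumes "x \<in> carrier (free_module K I)"
    and "P (\<lambda>_. \<zero>)"
    and "\<And>x c i. x \<in> carrier (free_module K I) \<Longrightarrow> P x \<Longrightarrow> c \<in> carrier K \<Longrightarrow> i \<in> I \<Longrightarrow>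
      P (x \<oplus>\<^bsub>free_module K I\<^esub> c \<odot>\<^bsub>free_module K I\<^esub> single K i)"
  shows "P x"
proof -
  have "finite {i. x i \<noteq> \<zero>}" using assms(1) by (simp add: free_simps)
  then show ?thesis using assms(1)
  proof (induction "{i. x i \<noteq> \<zero>}" arbitrary: x rule: finite_induct)
    case empty
    then have "x = (\<lambda>_. \<zero>)" by auto
    then show ?case using assms(2) by simp
  next
    case (insert i S)
    define y where "y = x(i := \<zero>)"
    have S: "S = {i. y i \<noteq> \<zero>}" using insert.hyps(2,4) by (auto simp: y_def)
    have i: "i \<in> I" "x i \<in> carrier K" using insert.hyps(4) insert.prems by (auto simp: free_simps)
    have y: "y \<in> carrier (free_module K I)"
      using insert.hyps(1,2,4) insert.prems S by (auto simp: free_simps) (auto simp: y_def)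
    have "x = y \<oplus>\<^bsub>free_module K I\<^esub> x i \<odot>\<^bsub>free_module K I\<^esub> single K i"
      using insert.prems by (auto simp: free_simps y_def single_def)
    then show ?case using assms(3)[OF y insert.hyps(3)[OF S y] i(2,1)] by simp
  qed
qed

definition free_eval :: "('k, 'u, 'x) module_scheme \<Rightarrow> ('i \<Rightarrow> 'u) \<Rightarrow> ('i \<Rightarrow> 'k) \<Rightarrow> 'u"
  where "free_eval U b x = (\<Oplus>\<^bsub>U\<^esub>p\<in>{p. x p \<noteq> \<zero>}. x p \<odot>\<^bsub>U\<^esub> b p)"

lemma free_eval_superset:
  assumes U: "module K U" and b: "\<And>i. i \<in> I \<Longrightarrow> b i \<in> carrier U"
    and x: "x \<in> carrier (free_module K I)" and A: "finite A" "{i. x i \<noteq> \<zero>} \<subseteq> A" "A \<subseteq> I"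
  shows "free_eval U b x = (\<Oplus>\<^bsub>U\<^esub>p\<in>A. x p \<odot>\<^bsub>U\<^esub> b p)"
proof -
  interpret U: abelian_monoid U by (rule module_abelian_monoid[OF U])
  show ?thesis unfolding free_eval_def
    by (rule U.add.finprod_mono_neutral_cong_left) (use assms in \<open>auto simp: free_simps\<close>)
qed

lemma free_eval_lin:
  assumes U: "module K U" and b: "\<And>i. i \<in> I \<Longrightarrow> b i \<in> carrier U"
  shows "free_eval U b \<in> lin (free_module K I) U"
proof (rule linI)
  interpret U: abelian_monoid U by (rule module_abelian_monoid[OF U])
  note F = free_module_module[of I]
  fix x assume x: "x \<in> carrier (free_module K I)"
  then show "free_eval U b x \<in> carrier U"
    using assms unfolding free_eval_def by (intro U.finsum_closed) (auto simp: free_simps)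
  fix y assume y: "y \<in> carrier (free_module K I)"
  have xy: "x \<oplus>\<^bsub>free_module K I\<^esub> y \<in> carrier (free_module K I)" using x y F by simp
  define A where "A = {i. x i \<noteq> \<zero>} \<union> {i. y i \<noteq> \<zero>}"
  have A: "finite A" "A \<subseteq> I" "{i. x i \<noteq> \<zero>} \<subseteq> A" "{i. y i \<noteq> \<zero>} \<subseteq> A"
    using x y by (auto simp: A_def free_simps)
  have A': "{i. (x \<oplus>\<^bsub>free_module K I\<^esub> y) i \<noteq> \<zero>} \<subseteq> A"
    using x y by (auto simp: A_def free_simps)
  have cl: "x i \<in> carrier K" "y i \<in> carrier K" for i using x y by (auto simp: free_simps)
  have bA: "b i \<in> carrier U" if "i \<in> A" for i using b A(2) that by auto
  have "(\<Oplus>\<^bsub>U\<^esub>p\<in>A. (x \<oplus>\<^bsub>free_module K I\<^esub> y) p \<odot>\<^bsub>U\<^esub> b p) =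
      (\<Oplus>\<^bsub>U\<^esub>p\<in>A. x p \<odot>\<^bsub>U\<^esub> b p \<oplus>\<^bsub>U\<^esub> y p \<odot>\<^bsub>U\<^esub> b p)"
    using cl bA U by (intro U.finsum_cong') (auto simp: free_simps(3) module.smult_l_distr[OF U])
  also have "\<dots> = (\<Oplus>\<^bsub>U\<^esub>p\<in>A. x p \<odot>\<^bsub>U\<^esub> b p) \<oplus>\<^bsub>U\<^esub> (\<Oplus>\<^bsub>U\<^esub>p\<in>A. y p \<odot>\<^bsub>U\<^esub> b p)"
    using cl bA U by (intro U.finsum_addf) auto
  finally show "free_eval U b (x \<oplus>\<^bsub>free_module K I\<^esub> y) = free_eval U b x \<oplus>\<^bsub>U\<^esub> free_eval U b y"
    using free_eval_superset[OF U b x A(1,3,2)] free_eval_superset[OF U b y A(1,4,2)]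
      free_eval_superset[OF U b xy A(1) A' A(2)] by simp
next
  interpret U: abelian_monoid U by (rule module_abelian_monoid[OF U])
  note F = free_module_module[of I]
  fix c x assume c: "c \<in> carrier K" and x: "x \<in> carrier (free_module K I)"
  have cx: "c \<odot>\<^bsub>free_module K I\<^esub> x \<in> carrier (free_module K I)" using c x F by simp
  define A where "A = {i. x i \<noteq> \<zero>}"
  have A: "finite A" "A \<subseteq> I" "{i. x i \<noteq> \<zero>} \<subseteq> A"
    using x by (auto simp: A_def free_simps)
  have A': "{i. (c \<odot>\<^bsub>free_module K I\<^esub> x) i \<noteq> \<zero>} \<subseteq> A"
    using c by (auto simp: A_def free_simps)
  have cl: "x i \<in> carrier K" for i using x by (auto simp: free_simps)
  have bA: "b i \<in> carrier U" if "i \<in> A" for i using b A(2) that by auto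
  have "(\<Oplus>\<^bsub>U\<^esub>p\<in>A. (c \<odot>\<^bsub>free_module K I\<^esub> x) p \<odot>\<^bsub>U\<^esub> b p) = (\<Oplus>\<^bsub>U\<^esub>p\<in>A. c \<odot>\<^bsub>U\<^esub> (x p \<odot>\<^bsub>U\<^esub> b p))"
    using cl bA U c by (intro U.finsum_cong') (auto simp: free_simps(4) module.smult_assoc1[OF U])
  also have "\<dots> = c \<odot>\<^bsub>U\<^esub> (\<Oplus>\<^bsub>U\<^esub>p\<in>A. x p \<odot>\<^bsub>U\<^esub> b p)"
    using cl bA U c A by (intro module.finsum_smult_ldistr[symmetric]) auto
  finally show "free_eval U b (c \<odot>\<^bsub>free_module K I\<^esub> x) = c \<odot>\<^bsub>U\<^esub> free_eval U b x"
    using free_eval_superset[OF U b x A(1,3,2)]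
      free_eval_superset[OF U b cx A(1) A' A(2)] by simp
qed

lemma free_eval_single:
  assumes U: "module K U" and b: "b i \<in> carrier U"
  shows "free_eval U b (single K i) = b i"
proof -
  interpret U: abelian_monoid U by (rule module_abelian_monoid[OF U])
  have "{p. single K i p \<noteq> \<zero>} = {i}" by (auto simp: single_def)
  moreover have "(\<Oplus>\<^bsub>U\<^esub>p\<in>{i}. single K i p \<odot>\<^bsub>U\<^esub> b p) = single K i i \<odot>\<^bsub>U\<^esub> b i"
    using b U by (simp add: single_def)
  ultimately show ?thesis using b U by (simp add: free_eval_def single_def)
qed

section \<open>Tensor products\<close>

text \<open>Bilinearity is linearity in each variable separately, so that the closure properties of
linear maps serve for functions of several variables as well.\<close>

definition bilin ::
  "('k, 'a, 'x) module_scheme \<Rightarrow> ('k, 'b, 'y) module_scheme \<Rightarrow> ('k, 'c, 'w) module_scheme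
    \<Rightarrow> ('a \<Rightarrow> 'b \<Rightarrow> 'c) \<Rightarrow> bool"
  where "bilin V W U b \<longleftrightarrow> (\<forall>v\<in>carrier V. (\<lambda>w. b v w) \<in> lin W U) \<and>
    (\<forall>w\<in>carrier W. (\<lambda>v. b v w) \<in> lin V U)"

lemma bilinI:
  assumes "\<And>v. v \<in> carrier V \<Longrightarrow> (\<lambda>w. b v w) \<in> lin W U"
    and "\<And>w. w \<in> carrier W \<Longrightarrow> (\<lambda>v. b v w) \<in> lin V U"
  shows "bilin V W U b"
  using assms by (simp add: bilin_def)

lemma bilin1: "bilin V W U b \<Longrightarrow> w \<in> carrier W \<Longrightarrow> (\<lambda>v. b v w) \<in> lin V U"
  and bilin2: "bilin V W U b \<Longrightarrow> v \<in> carrier V \<Longrightarrow> (\<lambda>w. b v w) \<in> lin W U"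
  by (simp_all add: bilin_def)

lemma bilin_closed: "bilin V W U b \<Longrightarrow> v \<in> carrier V \<Longrightarrow> w \<in> carrier W \<Longrightarrow> b v w \<in> carrier U"
  by (rule lin_closed[OF bilin2])

lemma tensor_gens_free:
  assumes V: "module K V" and W: "module K W"
  shows "tensor_gens K V W \<subseteq> carrier (free_module K (carrier V \<times> carrier W))"
  using V W free_module_module[of "carrier V \<times> carrier W"]
  by (auto simp: tensor_gens_def Let_def a_minus_def single_free)

lemma tensor_rels_submodule:
  assumes V: "module K V" and W: "module K W"
  shows "submodule (tensor_rels K V W) K (free_module K (carrier V \<times> carrier W))"
    and "tensor_gens K V W \<subseteq> tensor_rels K V W"
proof -
  let ?F = "free_module K (carrier V \<times> carrier W)"
  have "submodule (carrier ?F) K ?F"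
    by (rule module.carrier_is_submodule[OF free_module_module])
  then show "submodule (tensor_rels K V W) K ?F"
    using tensor_gens_free[OF V W] unfolding tensor_rels_def
    by (intro Inter_submodule[OF free_module_module]) auto
  show "tensor_gens K V W \<subseteq> tensor_rels K V W" by (auto simp: tensor_rels_def)
qed

lemma tensor_eqs:
  "carrier (tensor K V W) = carrier (tensor_space K V W)"
  "zero (tensor K V W) = zero (tensor_space K V W)"
  "add (tensor K V W) = add (tensor_space K V W)"
  "smult (tensor K V W) = smult (tensor_space K V W)"
  by (simp_all add: tensor_def Let_def)

lemma tensor_module [simp]:
  assumes V: "module K V" and W: "module K W"
  shows "module K (tensor K V W)"
  unfolding module_cong_iff[OF tensor_eqs] tensor_space_def
  by (rule quot_module_module[OF free_module_module tensor_rels_submodule(1)[OF V W]])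

abbreviation tcls where "tcls V W x \<equiv> tensor_rels K V W +>\<^bsub>free_module K (carrier V \<times> carrier W)\<^esub> x"

lemma tcls_lin:
  assumes V: "module K V" and W: "module K W"
  shows "tcls V W \<in> lin (free_module K (carrier V \<times> carrier W)) (tensor K V W)"
  using quot_proj_lin[OF free_module_module tensor_rels_submodule(1)[OF V W]]
  by (simp add: lin_maps_def tensor_eqs tensor_space_def)

lemma tcls_carrier: "carrier (tensor K V W) = tcls V W ` carrier (free_module K (carrier V \<times> carrier W))"
  by (simp add: tensor_eqs tensor_space_def quot_carrier)

lemma tens_bilin:
  assumes V: "module K V" and W: "module K W"
  shows "bilin V W (tensor K V W) (tens K V W)"
proof -
  let ?F = "free_module K (carrier V \<times> carrier W)"
  note F = free_module_module[of "carrier V \<times> carrier W"]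
  note R = tensor_rels_submodule[OF V W]
  note L = tcls_lin[OF V W]
  have eq: "tcls V W x = tcls V W y"
    if "x \<ominus>\<^bsub>?F\<^esub> y \<in> tensor_gens K V W" "x \<in> carrier ?F" "y \<in> carrier ?F" for x y
    using that coset_eq_iff[OF F R(1)] R(2) by (auto simp: a_minus_def)
  have t: "tens K V W v w = tcls V W (single K (v, w))" for v w by (simp add: tens_def)
  have s: "single K (v, w) \<in> carrier ?F" if "v \<in> carrier V" "w \<in> carrier W" for v w
    using that by (simp add: single_free)
  have "tens K V W (v \<oplus>\<^bsub>V\<^esub> v') w = tens K V W v w \<oplus>\<^bsub>tensor K V W\<^esub> tens K V W v' w"
    if "v \<in> carrier V" "v' \<in> carrier V" "w \<in> carrier W" for v v' w
    unfolding t using that V W F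
    by (subst lin_add[OF L, symmetric])
       (simp_all add: s, rule eq, auto simp: s tensor_gens_def Let_def)
  moreover have "tens K V W v (w \<oplus>\<^bsub>W\<^esub> w') = tens K V W v w \<oplus>\<^bsub>tensor K V W\<^esub> tens K V W v w'"
    if "v \<in> carrier V" "w' \<in> carrier W" "w \<in> carrier W" for v w' w
    unfolding t using that V W F
    by (subst lin_add[OF L, symmetric])
       (simp_all add: s, rule eq, auto simp: s tensor_gens_def Let_def)
  moreover have "tens K V W (c \<odot>\<^bsub>V\<^esub> v) w = c \<odot>\<^bsub>tensor K V W\<^esub> tens K V W v w"
    if "v \<in> carrier V" "c \<in> carrier K" "w \<in> carrier W" for v c w
    unfolding t using that V W F
    by (subst lin_smult[OF L, symmetric])
       (simp_all add: s, rule eq, auto simp: s tensor_gens_def Let_def)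
  moreover have "tens K V W v (c \<odot>\<^bsub>W\<^esub> w) = c \<odot>\<^bsub>tensor K V W\<^esub> tens K V W v w"
    if "v \<in> carrier V" "c \<in> carrier K" "w \<in> carrier W" for v c w
    unfolding t using that V W F
    by (subst lin_smult[OF L, symmetric])
       (simp_all add: s, rule eq, auto simp: s tensor_gens_def Let_def)
  moreover have "tens K V W v w \<in> carrier (tensor K V W)"
    if "v \<in> carrier V" "w \<in> carrier W" for v w
    unfolding t using s lin_closed[OF L] that by auto
  ultimately show ?thesis by (intro bilinI linI) auto
qed

lemma tens_closed [simp]:
  "module K V \<Longrightarrow> module K W \<Longrightarrow> v \<in> carrier V \<Longrightarrow> w \<in> carrier W \<Longrightarrow>
    tens K V W v w \<in> carrier (tensor K V W)"
  by (rule bilin_closed[OF tens_bilin])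

text \<open>A scalar can be moved into the left factor, hence pure tensors generate the tensor product under addition.\<close>

lemma tens_induct [consumes 3, case_names tens add]:
  assumes V: "module K V" and W: "module K W" and "t \<in> carrier (tensor K V W)"
    and tens: "\<And>v w. v \<in> carrier V \<Longrightarrow> w \<in> carrier W \<Longrightarrow> P (tens K V W v w)"
    and add: "\<And>s t. s \<in> carrier (tensor K V W) \<Longrightarrow> t \<in> carrier (tensor K V W) \<Longrightarrow>
      P s \<Longrightarrow> P t \<Longrightarrow> P (s \<oplus>\<^bsub>tensor K V W\<^esub> t)"
  shows "P t"
proof -
  let ?F = "free_module K (carrier V \<times> carrier W)"
  note F = free_module_module[of "carrier V \<times> carrier W"]
  note L = tcls_lin[OF V W]
  obtain x where x: "x \<in> carrier ?F" "t = tcls V W x" using assms(3) by (auto simp: tcls_carrier)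
  have "P (tcls V W x)" using x(1)
  proof (induction rule: free_induct)
    case zero
    have "tens K V W \<zero>\<^bsub>V\<^esub> \<zero>\<^bsub>W\<^esub> = \<zero>\<^bsub>tensor K V W\<^esub>"
      using V W lin_zero[OF W tensor_module[OF V W] bilin2[OF tens_bilin[OF V W], of "\<zero>\<^bsub>V\<^esub>"]] by simp
    also have "\<dots> = tcls V W (\<lambda>_. \<zero>)"
      using lin_zero[OF F _ L] V W by (simp add: free_simps(2))
    finally show ?case using tens[of "\<zero>\<^bsub>V\<^esub>" "\<zero>\<^bsub>W\<^esub>"] V W by simp
  next
    case (step x c i)
    obtain v w where i: "i = (v, w)" "v \<in> carrier V" "w \<in> carrier W" using step.hyps(3) by auto
    have "tcls V W (c \<odot>\<^bsub>?F\<^esub> single K i) = tens K V W (c \<odot>\<^bsub>V\<^esub> v) w"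
      using i step.hyps(2) V W lin_smult[OF bilin1[OF tens_bilin[OF V W]]]
      by (simp add: lin_smult[OF L] single_free) (simp add: tens_def)
    then have "tcls V W (x \<oplus>\<^bsub>?F\<^esub> c \<odot>\<^bsub>?F\<^esub> single K i) =
        tcls V W x \<oplus>\<^bsub>tensor K V W\<^esub> tens K V W (c \<odot>\<^bsub>V\<^esub> v) w"
      using step i F by (simp add: lin_add[OF L] single_free)
    then show ?case using step i V W by (auto intro!: add tens simp: lin_closed[OF L])
  qed
  then show ?thesis using x by simp
qed

text \<open>The linear extension of \<open>b\<close> to the free module kills the generating relations, and its kernel, being
a subspace, contains all relations.  It is therefore constant on cosets, which is what the definition
of \<^const>\<open>tens_lift\<close> presupposes.\<close>

lemma tens_lift_tcls:
  assumes V: "module K V" and W: "module K W" and U: "module K U" and b: "bilin V W U b"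
    and x: "x \<in> carrier (free_module K (carrier V \<times> carrier W))"
  shows "tens_lift K U b (tcls V W x) = free_eval U (\<lambda>p. b (fst p) (snd p)) x"
proof -
  let ?F = "free_module K (carrier V \<times> carrier W)" and ?e = "free_eval U (\<lambda>p. b (fst p) (snd p))"
  note F = free_module_module[of "carrier V \<times> carrier W"]
  have b': "i \<in> carrier V \<times> carrier W \<Longrightarrow> b (fst i) (snd i) \<in> carrier U" for i
    using bilin_closed[OF b] by auto
  note E = free_eval_lin[where b = "\<lambda>p. b (fst p) (snd p)", OF U b']
  have s: "single K (v, w) \<in> carrier ?F" if "v \<in> carrier V" "w \<in> carrier W" for v w
    using that by (simp add: single_free)
  have e: "?e (single K (v, w)) = b v w" if "v \<in> carrier V" "w \<in> carrier W" for v w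
    using free_eval_single[of U "\<lambda>p. b (fst p) (snd p)" "(v, w)"] U bilin_closed[OF b that]
    by simp
  let ?N = "{x \<in> carrier ?F. ?e x = \<zero>\<^bsub>U\<^esub>}"
  have eq: "?e (x \<ominus>\<^bsub>?F\<^esub> y) = \<zero>\<^bsub>U\<^esub> \<longleftrightarrow> ?e x = ?e y" if "x \<in> carrier ?F" "y \<in> carrier ?F" for x y
    using that F U lin_closed[OF E] module_diff_zero[OF U, of "?e x" "?e y"]
    by (simp add: a_minus_def lin_add[OF E] lin_uminus[OF F U E])
  have "tensor_gens K V W \<subseteq> ?N"
  proof -
    have "tensor_gens K V W \<subseteq> {x. ?e x = \<zero>\<^bsub>U\<^esub>}"
      using V W F U
      by (auto simp: tensor_gens_def Let_def eq s e lin_add[OF E] lin_smult[OF E]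
        lin_add[OF bilin1[OF b]] lin_smult[OF bilin1[OF b]] lin_add[OF bilin2[OF b]]
        lin_smult[OF bilin2[OF b]])
    then show ?thesis using tensor_gens_free[OF V W] by auto
  qed
  then have R: "tensor_rels K V W \<subseteq> ?N"
    using kernel_submodule[OF F U E] unfolding tensor_rels_def by blast
  have R0: "\<zero>\<^bsub>?F\<^esub> \<in> tensor_rels K V W"
    using tensor_rels_submodule(1)[OF V W] by (simp add: submodule_iff[OF F])
  have c: "?e (r \<oplus>\<^bsub>?F\<^esub> x) = ?e x" if "r \<in> tensor_rels K V W" for r
    using R that x U lin_closed[OF E x] by (auto simp: lin_add[OF E])
  have "\<zero>\<^bsub>?F\<^esub> \<oplus>\<^bsub>?F\<^esub> x \<in> tcls V W x" using R0 by (auto simp: a_r_coset_def')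
  from imageI[OF this, of ?e] have "?e x \<in> ?e ` (tcls V W x)" unfolding c[OF R0] .
  then have "?e ` (tcls V W x) = {?e x}"
    using c by (auto simp: a_r_coset_def')
  then show ?thesis by (simp add: tens_lift_def free_eval_def)
qed

lemma tens_lift_tens [simp]:
  assumes "module K V" "module K W" "module K U" "bilin V W U b" "v \<in> carrier V" "w \<in> carrier W"
  shows "tens_lift K U b (tens K V W v w) = b v w"
  unfolding tens_def
  using assms bilin_closed[OF assms(4)]
  by (subst tens_lift_tcls) (auto simp: single_free free_eval_single)

lemma tens_lift_lin:
  assumes V: "module K V" and W: "module K W" and U: "module K U" and b: "bilin V W U b"
  shows "tens_lift K U b \<in> lin (tensor K V W) U"
proof -
  let ?F = "free_module K (carrier V \<times> carrier W)"
  note F = free_module_module[of "carrier V \<times> carrier W"]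
  note L = tcls_lin[OF V W]
  note T = tens_lift_tcls[OF V W U b]
  have E: "free_eval U (\<lambda>p. b (fst p) (snd p)) \<in> lin ?F U"
    by (rule free_eval_lin[OF U]) (auto intro: bilin_closed[OF b])
  show ?thesis
  proof (rule linI)
    fix s assume "s \<in> carrier (tensor K V W)"
    then obtain x where x: "x \<in> carrier ?F" "s = tcls V W x" by (auto simp: tcls_carrier)
    then show "tens_lift K U b s \<in> carrier U" using T lin_closed[OF E] by simp
    fix t assume "t \<in> carrier (tensor K V W)"
    then obtain y where y: "y \<in> carrier ?F" "t = tcls V W y" by (auto simp: tcls_carrier)
    have "s \<oplus>\<^bsub>tensor K V W\<^esub> t = tcls V W (x \<oplus>\<^bsub>?F\<^esub> y)" using x y lin_add[OF L] by simp
    then show "tens_lift K U b (s \<oplus>\<^bsub>tensor K V W\<^esub> t) = tens_lift K U b s \<oplus>\<^bsub>U\<^esub> tens_lift K U b t"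
      using x y F T lin_add[OF E] by simp
  next
    fix c s assume c: "c \<in> carrier K" and "s \<in> carrier (tensor K V W)"
    then obtain x where x: "x \<in> carrier ?F" "s = tcls V W x" by (auto simp: tcls_carrier)
    have "c \<odot>\<^bsub>tensor K V W\<^esub> s = tcls V W (c \<odot>\<^bsub>?F\<^esub> x)" using x c lin_smult[OF L] by simp
    then show "tens_lift K U b (c \<odot>\<^bsub>tensor K V W\<^esub> s) = c \<odot>\<^bsub>U\<^esub> tens_lift K U b s"
      using x c F T lin_smult[OF E] by simp
  qed
qed

lemma lin_tensor_eqI:
  assumes V: "module K V" and W: "module K W"
    and f: "f \<in> lin (tensor K V W) U" and g: "g \<in> lin (tensor K V W) U"
    and "\<And>v w. v \<in> carrier V \<Longrightarrow> w \<in> carrier W \<Longrightarrow> f (tens K V W v w) = g (tens K V W v w)"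
    and t: "t \<in> carrier (tensor K V W)"
  shows "f t = g t"
  using V W t by (induction rule: tens_induct) (auto simp: assms(5) lin_add[OF f] lin_add[OF g])

section \<open>Lifts of bilinear maps\<close>

lemma bilin_cong:
  assumes b: "bilin V W U b" and V: "module K V" and W: "module K W"
    and eq: "\<And>v w. v \<in> carrier V \<Longrightarrow> w \<in> carrier W \<Longrightarrow> b' v w = b v w"
  shows "bilin V W U b'"
proof (rule bilinI)
  show "(\<lambda>w. b' v w) \<in> lin W U" if "v \<in> carrier V" for v
    by (rule lin_cong[OF bilin2[OF b that] W]) (simp add: eq that)
  show "(\<lambda>v. b' v w) \<in> lin V U" if "w \<in> carrier W" for w
    by (rule lin_cong[OF bilin1[OF b that] V]) (simp add: eq that)
qed

lemma bilin_comp: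
  assumes b: "bilin V W U b" and f: "f \<in> lin V' V" and g: "g \<in> lin W' W"
  shows "bilin V' W' U (\<lambda>v w. b (f v) (g w))"
  by (intro bilinI lin_comp[OF g bilin2[OF b]] lin_comp[OF f bilin1[OF b]] lin_closed[OF f]
      lin_closed[OF g])

lemma bilin_lin:
  assumes b: "bilin V W U b" and h: "h \<in> lin U U'"
  shows "bilin V W U' (\<lambda>v w. h (b v w))"
  by (intro bilinI lin_comp[OF bilin2[OF b] h] lin_comp[OF bilin1[OF b] h])

lemma bilin_swap: "bilin V W U b \<Longrightarrow> bilin W V U (\<lambda>w v. b v w)"
  by (simp add: bilin_def)

lemma bilin_tens: "module K V \<Longrightarrow> module K W \<Longrightarrow> f \<in> lin V' V \<Longrightarrow> g \<in> lin W' W \<Longrightarrow>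
  bilin V' W' (tensor K V W) (\<lambda>v w. tens K V W (f v) (g w))"
  by (rule bilin_comp[OF tens_bilin])

lemma lin_tens1: "module K V \<Longrightarrow> module K W \<Longrightarrow> f \<in> lin X V \<Longrightarrow> w \<in> carrier W \<Longrightarrow>
  (\<lambda>x. tens K V W (f x) w) \<in> lin X (tensor K V W)"
  by (rule lin_comp[OF _ bilin1[OF tens_bilin]])

lemma lin_tens2: "module K V \<Longrightarrow> module K W \<Longrightarrow> f \<in> lin X W \<Longrightarrow> v \<in> carrier V \<Longrightarrow>
  (\<lambda>x. tens K V W v (f x)) \<in> lin X (tensor K V W)"
  by (rule lin_comp[OF _ bilin2[OF tens_bilin]])

lemma smult_bilin: "module K V \<Longrightarrow> bilin (base_module K) V V (\<lambda>c v. c \<odot>\<^bsub>V\<^esub> v)"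
  by (intro bilinI lin_scale lin_id linI)
     (auto simp: base_module_def module.smult_l_distr module.smult_assoc1)

lemma base_module_module [simp]: "module K (base_module K)"
proof -
  have "abelian_group (base_module K)"
    by (subst abelian_group_cong_iff[where W = K]) (simp_all add: base_module_def abelian_group_axioms)
  then show ?thesis
    by (rule moduleI[OF is_cring]) (auto simp: base_module_def l_distr r_distr m_assoc)
qed

lemma tens_lift_closed:
  assumes "module K V" "module K W" "module K U" "bilin V W U b" "t \<in> carrier (tensor K V W)"
  shows "tens_lift K U b t \<in> carrier U"
  by (rule lin_closed[OF tens_lift_lin[OF assms(1-4)] assms(5)])

lemma tens_lift_unique:
  assumes V: "module K V" and W: "module K W" and U: "module K U" and b: "bilin V W U b"
    and f: "f \<in> lin (tensor K V W) U"
    and eq: "\<And>v w. v \<in> carrier V \<Longrightarrow> w \<in> carrier W \<Longrightarrow> f (tens K V W v w) = b v w"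
    and t: "t \<in> carrier (tensor K V W)"
  shows "f t = tens_lift K U b t"
  by (rule lin_tensor_eqI[OF V W f tens_lift_lin[OF V W U b] _ t]) (simp add: eq V W U b)

lemma tens_lift_cong:
  assumes V: "module K V" and W: "module K W" and U: "module K U" and b: "bilin V W U b"
    and eq: "\<And>v w. v \<in> carrier V \<Longrightarrow> w \<in> carrier W \<Longrightarrow> b' v w = b v w"
    and t: "t \<in> carrier (tensor K V W)"
  shows "tens_lift K U b' t = tens_lift K U b t"
proof -
  note b' = bilin_cong[OF b V W eq]
  show ?thesis
    by (rule tens_lift_unique[OF V W U b tens_lift_lin[OF V W U b'] _ t]) (simp_all add: V W U b' eq)
qed

lemma lin_tens_lift:
  assumes V: "module K V" and W: "module K W" and U: "module K U" and U': "module K U'"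
    and b: "bilin V W U b" and h: "h \<in> lin U U'" and t: "t \<in> carrier (tensor K V W)"
  shows "h (tens_lift K U b t) = tens_lift K U' (\<lambda>v w. h (b v w)) t"
  by (rule tens_lift_unique[OF V W U' bilin_lin[OF b h] lin_comp[OF tens_lift_lin[OF V W U b] h] _ t])
     (simp add: V W U b)

lemma tens_lift_self:
  assumes V: "module K V" and W: "module K W" and t: "t \<in> carrier (tensor K V W)"
  shows "tens_lift K (tensor K V W) (tens K V W) t = t"
  by (rule tens_lift_unique[symmetric, where f = "\<lambda>t. t",
        OF V W tensor_module[OF V W] tens_bilin[OF V W] lin_id refl t])

text \<open>For nested lifts, whose inner integrand depends linearly on the variables of the outer one.\<close>

lemma lin_tens_lift_param:
  assumes X: "module K X" and V: "module K V" and W: "module K W" and U: "module K U"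
    and b: "\<And>x. x \<in> carrier X \<Longrightarrow> bilin V W U (F x)"
    and l: "\<And>v w. v \<in> carrier V \<Longrightarrow> w \<in> carrier W \<Longrightarrow> (\<lambda>x. F x v w) \<in> lin X U"
    and t: "t \<in> carrier (tensor K V W)"
  shows "(\<lambda>x. tens_lift K U (F x) t) \<in> lin X U"
  using V W t
proof (induction rule: tens_induct)
  case (tens v w)
  show ?case by (rule lin_cong[OF l[OF tens] X]) (simp add: V W U b tens)
next
  case (add s t)
  show ?case
    by (rule lin_cong[OF lin_plus[OF U add(3,4)] X])
       (simp add: lin_add[OF tens_lift_lin[OF V W U b]] add)
qed

lemma bilin_tens_lift:
  assumes V: "module K V" and W: "module K W" and U: "module K U" and X: "module K X"
    and b: "\<And>x. x \<in> carrier X \<Longrightarrow> bilin V W U (F x)"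
    and l: "\<And>v w. v \<in> carrier V \<Longrightarrow> w \<in> carrier W \<Longrightarrow> (\<lambda>x. F x v w) \<in> lin X U"
  shows "bilin (tensor K V W) X U (\<lambda>t x. tens_lift K U (F x) t)"
  by (intro bilinI lin_tens_lift_param[OF X V W U b l] tens_lift_lin[OF V W U b]) auto

definition trilin ::
  "('k, 'a, 'x) module_scheme \<Rightarrow> ('k, 'b, 'y) module_scheme \<Rightarrow> ('k, 'c, 'w) module_scheme
    \<Rightarrow> ('k, 'd, 'v) module_scheme \<Rightarrow> ('a \<Rightarrow> 'b \<Rightarrow> 'c \<Rightarrow> 'd) \<Rightarrow> bool"
  where "trilin A B C U F \<longleftrightarrow>
    (\<forall>b\<in>carrier B. \<forall>c\<in>carrier C. (\<lambda>a. F a b c) \<in> lin A U) \<and>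
    (\<forall>a\<in>carrier A. \<forall>c\<in>carrier C. (\<lambda>b. F a b c) \<in> lin B U) \<and>
    (\<forall>a\<in>carrier A. \<forall>b\<in>carrier B. (\<lambda>c. F a b c) \<in> lin C U)"

lemma trilinI:
  assumes "\<And>b c. b \<in> carrier B \<Longrightarrow> c \<in> carrier C \<Longrightarrow> (\<lambda>a. F a b c) \<in> lin A U"
    and "\<And>a c. a \<in> carrier A \<Longrightarrow> c \<in> carrier C \<Longrightarrow> (\<lambda>b. F a b c) \<in> lin B U"
    and "\<And>a b. a \<in> carrier A \<Longrightarrow> b \<in> carrier B \<Longrightarrow> (\<lambda>c. F a b c) \<in> lin C U"
  shows "trilin A B C U F"
  using assms by (simp add: trilin_def)

lemma trilinD:
  assumes "trilin A B C U F"
  shows "b \<in> carrier B \<Longrightarrow> c \<in> carrier C \<Longrightarrow> (\<lambda>a. F a b c) \<in> lin A U"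
    and "a \<in> carrier A \<Longrightarrow> c \<in> carrier C \<Longrightarrow> (\<lambda>b. F a b c) \<in> lin B U"
    and "a \<in> carrier A \<Longrightarrow> b \<in> carrier B \<Longrightarrow> (\<lambda>c. F a b c) \<in> lin C U"
    and "a \<in> carrier A \<Longrightarrow> bilin B C U (\<lambda>b c. F a b c)"
    and "c \<in> carrier C \<Longrightarrow> bilin A B U (\<lambda>a b. F a b c)"
    and "a \<in> carrier A \<Longrightarrow> b \<in> carrier B \<Longrightarrow> c \<in> carrier C \<Longrightarrow> F a b c \<in> carrier U"
proof -
  show 1: "b \<in> carrier B \<Longrightarrow> c \<in> carrier C \<Longrightarrow> (\<lambda>a. F a b c) \<in> lin A U" for b c
    using assms by (simp add: trilin_def)
  show 2: "a \<in> carrier A \<Longrightarrow> c \<in> carrier C \<Longrightarrow> (\<lambda>b. F a b c) \<in> lin B U" for a c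
    using assms by (simp add: trilin_def)
  show 3: "a \<in> carrier A \<Longrightarrow> b \<in> carrier B \<Longrightarrow> (\<lambda>c. F a b c) \<in> lin C U" for a b
    using assms by (simp add: trilin_def)
  show "a \<in> carrier A \<Longrightarrow> bilin B C U (\<lambda>b c. F a b c)" by (intro bilinI 2 3)
  show "c \<in> carrier C \<Longrightarrow> bilin A B U (\<lambda>a b. F a b c)" by (intro bilinI 1 2)
  show "a \<in> carrier A \<Longrightarrow> b \<in> carrier B \<Longrightarrow> c \<in> carrier C \<Longrightarrow> F a b c \<in> carrier U"
    by (rule lin_closed[OF 1])
qed

section \<open>Functoriality and associativity of the tensor product\<close>

lemma tens_map_lin:
  assumes "module K V" "module K W" "module K V'" "module K W'" "f \<in> lin V V'" "g \<in> lin W W'"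
  shows "tens_map K V' W' f g \<in> lin (tensor K V W) (tensor K V' W')"
  unfolding tens_map_def using assms by (intro tens_lift_lin bilin_tens) auto

lemma tens_map_closed:
  assumes "module K V" "module K W" "module K V'" "module K W'" "f \<in> lin V V'" "g \<in> lin W W'"
    "t \<in> carrier (tensor K V W)"
  shows "tens_map K V' W' f g t \<in> carrier (tensor K V' W')"
  by (rule lin_closed[OF tens_map_lin[OF assms(1-6)] assms(7)])

lemma tens_map_tens:
  assumes "module K V" "module K W" "module K V'" "module K W'" "f \<in> lin V V'" "g \<in> lin W W'"
    "v \<in> carrier V" "w \<in> carrier W"
  shows "tens_map K V' W' f g (tens K V W v w) = tens K V' W' (f v) (g w)"
  unfolding tens_map_def using assms by (simp add: bilin_tens)

lemma tens_map_cong: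
  assumes "module K V" "module K W" "module K V'" "module K W'" "f \<in> lin V V'" "g \<in> lin W W'"
    "\<And>v. v \<in> carrier V \<Longrightarrow> f' v = f v" "\<And>w. w \<in> carrier W \<Longrightarrow> g' w = g w" "t \<in> carrier (tensor K V W)"
  shows "tens_map K V' W' f' g' t = tens_map K V' W' f g t"
  unfolding tens_map_def
  by (rule tens_lift_cong[OF assms(1,2) _ _ _ assms(9)]) (simp_all add: assms bilin_tens)

lemma tens_map_id:
  assumes "module K V" "module K W" "t \<in> carrier (tensor K V W)"
    "\<And>v. v \<in> carrier V \<Longrightarrow> f v = v" "\<And>w. w \<in> carrier W \<Longrightarrow> g w = w"
  shows "tens_map K V W f g t = t"
proof -
  have "tens_map K V W f g t = tens_map K V W id id t"
    by (rule tens_map_cong[OF assms(1,2,1,2) lin_id' lin_id' _ _ assms(3)]) (simp_all add: assms)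
  also have "\<dots> = t" using tens_lift_self[OF assms(1-3)] by (simp add: tens_map_def)
  finally show ?thesis .
qed

lemma tens_map_comp:
  assumes m: "module K V" "module K W" "module K V'" "module K W'" "module K V''" "module K W''"
    and f: "f \<in> lin V V'" and g: "g \<in> lin W W'" and f': "f' \<in> lin V' V''" and g': "g' \<in> lin W' W''"
    and t: "t \<in> carrier (tensor K V W)"
  shows "tens_map K V'' W'' f' g' (tens_map K V' W' f g t) =
    tens_map K V'' W'' (\<lambda>v. f' (f v)) (\<lambda>w. g' (g w)) t"
  by (rule lin_tensor_eqI[OF m(1,2) lin_comp[OF tens_map_lin[OF m(1-4) f g] tens_map_lin[OF m(3-6) f' g']]
        tens_map_lin[OF m(1,2,5,6) lin_comp[OF f f'] lin_comp[OF g g']] _ t])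
     (simp add: tens_map_tens[OF m(1-4) f g] tens_map_tens[OF m(3-6) f' g'] lin_closed[OF f]
        lin_closed[OF g] tens_map_tens[OF m(1,2,5,6) lin_comp[OF f f'] lin_comp[OF g g']])

lemma tens_lift_tens_map:
  assumes m: "module K V" "module K W" "module K V'" "module K W'" "module K U"
    and f: "f \<in> lin V V'" and g: "g \<in> lin W W'" and b: "bilin V' W' U b"
    and t: "t \<in> carrier (tensor K V W)"
  shows "tens_lift K U b (tens_map K V' W' f g t) = tens_lift K U (\<lambda>v w. b (f v) (g w)) t"
  by (rule tens_lift_unique[OF m(1,2,5) bilin_comp[OF b f g]
        lin_comp[OF tens_map_lin[OF m(1-4) f g] tens_lift_lin[OF m(3-5) b]] _ t])
     (simp add: tens_map_tens[OF m(1-4) f g] m b lin_closed[OF f] lin_closed[OF g])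

lemma tens_assoc_trilin:
  assumes m: "module K U" "module K V" "module K W"
  shows "trilin U V W (tensor K U (tensor K V W)) (\<lambda>u v w. tens K U (tensor K V W) u (tens K V W v w))"
  using m by (intro trilinI lin_tens1 lin_tens2 lin_id) auto

lemma trilin_bilin:
  assumes m: "module K A" "module K B" "module K C" "module K U" and F: "trilin A B C U F"
  shows "bilin (tensor K A B) C U (\<lambda>s c. tens_lift K U (\<lambda>a b. F a b c) s)"
    and "bilin A (tensor K B C) U (\<lambda>a s. tens_lift K U (\<lambda>b c. F a b c) s)"
proof -
  show "bilin (tensor K A B) C U (\<lambda>s c. tens_lift K U (\<lambda>a b. F a b c) s)"
    by (intro bilin_tens_lift m trilinD[OF F])
  show "bilin A (tensor K B C) U (\<lambda>a s. tens_lift K U (\<lambda>b c. F a b c) s)"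
    by (rule bilin_swap) (intro bilin_tens_lift m trilinD[OF F])
qed

lemma tens_assoc_lin:
  assumes m: "module K U" "module K V" "module K W"
  shows "tens_assoc K U V W \<in> lin (tensor K (tensor K U V) W) (tensor K U (tensor K V W))"
  unfolding tens_assoc_def Let_def
  using m by (intro tens_lift_lin trilin_bilin(1) tens_assoc_trilin) auto

lemma tens_assoc_closed:
  assumes m: "module K U" "module K V" "module K W" and t: "t \<in> carrier (tensor K (tensor K U V) W)"
  shows "tens_assoc K U V W t \<in> carrier (tensor K U (tensor K V W))"
  by (rule lin_closed[OF tens_assoc_lin[OF m] t])

lemma tens_assoc_tens:
  assumes m: "module K U" "module K V" "module K W" and s: "s \<in> carrier (tensor K U V)"
    and w: "w \<in> carrier W"
  shows "tens_assoc K U V W (tens K (tensor K U V) W s w) =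
    tens_lift K (tensor K U (tensor K V W)) (\<lambda>u v. tens K U (tensor K V W) u (tens K V W v w)) s"
  unfolding tens_assoc_def Let_def using m s w trilin_bilin(1)[OF m _ tens_assoc_trilin[OF m]]
  by simp

lemma tens_assoc_tens_tens:
  assumes m: "module K U" "module K V" "module K W"
    and "u \<in> carrier U" "v \<in> carrier V" "w \<in> carrier W"
  shows "tens_assoc K U V W (tens K (tensor K U V) W (tens K U V u v) w) =
    tens K U (tensor K V W) u (tens K V W v w)"
  using assms trilinD(5)[OF tens_assoc_trilin[OF m], of w]
  by (simp add: tens_assoc_tens[OF m])

lemma lin_tensor3_eqI:
  assumes m: "module K U" "module K V" "module K W" "module K X"
    and f: "f \<in> lin (tensor K (tensor K U V) W) X" and g: "g \<in> lin (tensor K (tensor K U V) W) X"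
    and eq: "\<And>u v w. u \<in> carrier U \<Longrightarrow> v \<in> carrier V \<Longrightarrow> w \<in> carrier W \<Longrightarrow>
      f (tens K (tensor K U V) W (tens K U V u v) w) = g (tens K (tensor K U V) W (tens K U V u v) w)"
    and t: "t \<in> carrier (tensor K (tensor K U V) W)"
  shows "f t = g t"
proof (rule lin_tensor_eqI[OF _ m(3) f g _ t])
  show UV: "module K (tensor K U V)" using m by simp
  fix s w assume s: "s \<in> carrier (tensor K U V)" and w: "w \<in> carrier W"
  note l = lin_tens1[OF UV m(3) lin_id w]
  show "f (tens K (tensor K U V) W s w) = g (tens K (tensor K U V) W s w)"
    by (rule lin_tensor_eqI[OF m(1,2) lin_comp[OF l f] lin_comp[OF l g] _ s]) (rule eq[OF _ _ w])
qed

lemma tens_assoc_natural: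
  assumes m: "module K U" "module K V" "module K W" "module K U'" "module K V'" "module K W'"
    and f: "f \<in> lin U U'" and g: "g \<in> lin V V'" and h: "h \<in> lin W W'"
    and t: "t \<in> carrier (tensor K (tensor K U V) W)"
  shows "tens_assoc K U' V' W' (tens_map K (tensor K U' V') W' (tens_map K U' V' f g) h t) =
    tens_map K U' (tensor K V' W') f (tens_map K V' W' g h) (tens_assoc K U V W t)"
proof -
  note fg = tens_map_lin[OF m(1,2,4,5) f g] and gh = tens_map_lin[OF m(2,3,5,6) g h]
  have mm: "module K (tensor K U V)" "module K (tensor K U' V')" "module K (tensor K V W)"
    "module K (tensor K V' W')" "module K (tensor K U' (tensor K V' W'))"
    using m by auto
  show ?thesis
    by (rule lin_tensor3_eqI[OF m(1-3) mm(5)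
          lin_comp[OF tens_map_lin[OF mm(1) m(3) mm(2) m(6) fg h] tens_assoc_lin[OF m(4-6)]]
          lin_comp[OF tens_assoc_lin[OF m(1-3)] tens_map_lin[OF m(1) mm(3) m(4) mm(4) f gh]] _ t])
       (simp add: m mm tens_map_tens[OF mm(1) m(3) mm(2) m(6) fg h] tens_map_tens[OF m(1,2,4,5) f g]
          tens_map_tens[OF m(1) mm(3) m(4) mm(4) f gh] tens_map_tens[OF m(2,3,5,6) g h]
          lin_closed[OF f] lin_closed[OF g] lin_closed[OF h] tens_assoc_tens_tens)
qed

lemma tens_lift_assoc:
  assumes m: "module K A" "module K B" "module K C" "module K U" and F: "trilin A B C U F"
    and t: "t \<in> carrier (tensor K (tensor K A B) C)"
  shows "tens_lift K U (\<lambda>a s. tens_lift K U (\<lambda>b c. F a b c) s) (tens_assoc K A B C t) =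
    tens_lift K U (\<lambda>s c. tens_lift K U (\<lambda>a b. F a b c) s) t"
proof -
  note b = trilin_bilin[OF m F]
  have mm: "module K (tensor K A B)" "module K (tensor K B C)" using m by auto
  show ?thesis
    by (rule lin_tensor3_eqI[OF m lin_comp[OF tens_assoc_lin[OF m(1-3)] tens_lift_lin[OF m(1) mm(2) m(4) b(2)]]
        tens_lift_lin[OF mm(1) m(3,4) b(1)] _ t])
       (simp add: m mm b tens_assoc_tens_tens trilinD[OF F])
qed

text \<open>Any identity \<open>(\<delta> \<otimes> id)(s) = (id \<otimes> \<gamma>)(t)\<close>, in particular coassociativity, allows the two ways of
splitting into three Sweedler components to be exchanged in front of a trilinear map.\<close>

lemma tens_lift_coassoc:
  assumes m: "module K A" "module K B" "module K C" "module K U" "module K V" "module K W"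
    and F: "trilin A B C U F"
    and d: "\<delta> \<in> lin V (tensor K A B)" and e: "\<gamma> \<in> lin W (tensor K B C)"
    and s: "s \<in> carrier (tensor K V C)" and t: "t \<in> carrier (tensor K A W)"
    and eq: "tens_assoc K A B C (tens_map K (tensor K A B) C \<delta> id s) = tens_map K A (tensor K B C) id \<gamma> t"
  shows "tens_lift K U (\<lambda>v c. tens_lift K U (\<lambda>a b. F a b c) (\<delta> v)) s =
    tens_lift K U (\<lambda>a w. tens_lift K U (\<lambda>b c. F a b c) (\<gamma> w)) t"
proof -
  note b = trilin_bilin[OF m(1-4) F]
  have mm: "module K (tensor K A B)" "module K (tensor K B C)" using m by auto
  have "tens_lift K U (\<lambda>v c. tens_lift K U (\<lambda>a b. F a b c) (\<delta> v)) s =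
      tens_lift K U (\<lambda>s c. tens_lift K U (\<lambda>a b. F a b c) s) (tens_map K (tensor K A B) C \<delta> id s)"
    using tens_lift_tens_map[OF m(5,3) mm(1) m(3,4) d lin_id' b(1) s] by simp
  also have "\<dots> = tens_lift K U (\<lambda>a s. tens_lift K U (\<lambda>b c. F a b c) s)
      (tens_assoc K A B C (tens_map K (tensor K A B) C \<delta> id s))"
    by (rule tens_lift_assoc[OF m(1-4) F tens_map_closed[OF m(5,3) mm(1) m(3) d lin_id' s], symmetric])
  also have "\<dots> = tens_lift K U (\<lambda>a w. tens_lift K U (\<lambda>b c. F a b c) (\<gamma> w)) t"
    unfolding eq using tens_lift_tens_map[OF m(1,6,1) mm(2) m(4) lin_id' e b(2) t] by simp
  finally show ?thesis .
qed

section \<open>Exactness of the tensor product over a field\<close>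

lemma tens_map_plus_right:
  assumes m: "module K X" "module K V" "module K W" and f: "f \<in> lin V W" and g: "g \<in> lin V W"
    and t: "t \<in> carrier (tensor K X V)"
  shows "tens_map K X W id (\<lambda>v. f v \<oplus>\<^bsub>W\<^esub> g v) t =
    tens_map K X W id f t \<oplus>\<^bsub>tensor K X W\<^esub> tens_map K X W id g t"
proof -
  note T = tensor_module[OF m(1,3)] and fg = lin_plus[OF m(3) f g]
  show ?thesis
    by (rule lin_tensor_eqI[OF m(1,2) tens_map_lin[OF m(1,2,1,3) lin_id' fg]
          lin_plus[OF T tens_map_lin[OF m(1,2,1,3) lin_id' f] tens_map_lin[OF m(1,2,1,3) lin_id' g]] _ t])
       (simp add: tens_map_tens[OF m(1,2,1,3) lin_id' fg] tens_map_tens[OF m(1,2,1,3) lin_id' f]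
         tens_map_tens[OF m(1,2,1,3) lin_id' g] lin_closed[OF f] lin_closed[OF g]
         lin_add[OF bilin2[OF tens_bilin[OF m(1,3)]]])
qed

text \<open>Left exactness of \<open>X \<otimes> -\<close>.  With \<open>g\<close> a regular inverse of \<open>f\<close> and \<open>r = id - g f\<close> one has
\<open>t = (id \<otimes> r)(t) + (id \<otimes> g)(id \<otimes> f)(t)\<close>, and the second summand vanishes.\<close>

lemma tensor_kernel:
  assumes m: "module K X" "module K V" "module K W" and f: "f \<in> lin V W"
    and t: "t \<in> carrier (tensor K X V)" and z: "tens_map K X W id f t = \<zero>\<^bsub>tensor K X W\<^esub>"
  obtains r where "r \<in> lin V V" "\<And>v. v \<in> carrier V \<Longrightarrow> f (r v) = \<zero>\<^bsub>W\<^esub>"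
    "tens_map K X V id r t = t"
proof -
  obtain g where g: "g \<in> lin W V" "\<And>x. x \<in> carrier V \<Longrightarrow> f (g (f x)) = f x"
    using regular_inverse_exists[OF m(2,3) f] by blast
  define r where "r v = v \<oplus>\<^bsub>V\<^esub> \<ominus>\<^bsub>V\<^esub> g (f v)" for v
  note gf = lin_comp[OF f g(1)]
  have r: "r \<in> lin V V" unfolding r_def by (rule lin_minus[OF m(2,2) lin_id gf])
  have fr: "f (r v) = \<zero>\<^bsub>W\<^esub>" if v: "v \<in> carrier V" for v
    using v lin_closed[OF gf v] lin_closed[OF f v] g(2)[OF v] m
    by (simp add: r_def lin_add[OF f] lin_uminus[OF m(2,3) f])
  have sum: "r v \<oplus>\<^bsub>V\<^esub> g (f v) = v" if v: "v \<in> carrier V" for v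
    using v lin_closed[OF gf v] m by (simp add: r_def module_assoc)
  have gz: "tens_map K X V id (\<lambda>v. g (f v)) t = \<zero>\<^bsub>tensor K X V\<^esub>"
    using tens_map_comp[OF m(1,2,1,3,1,2) lin_id' f lin_id' g(1) t] z
      lin_zero[OF _ _ tens_map_lin[OF m(1,3,1,2) lin_id' g(1)]] m
    by (simp add: id_def)
  have "t = tens_map K X V id (\<lambda>v. r v \<oplus>\<^bsub>V\<^esub> g (f v)) t"
    by (rule tens_map_id[OF m(1,2) t, symmetric]) (simp_all add: sum)
  also have "\<dots> = tens_map K X V id r t \<oplus>\<^bsub>tensor K X V\<^esub> tens_map K X V id (\<lambda>v. g (f v)) t"
    by (rule tens_map_plus_right[OF m(1,2,2) r gf t])
  also have "\<dots> = tens_map K X V id r t"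
    using gz tens_map_closed[OF m(1,2,1,2) lin_id' r t] m by simp
  finally show thesis using that r fr by metis
qed

lemma tensor_equalizer:
  assumes m: "module K X" "module K V" "module K W" and f: "f \<in> lin V W" and f': "f' \<in> lin V W"
    and t: "t \<in> carrier (tensor K X V)" and eq: "tens_map K X W id f t = tens_map K X W id f' t"
  obtains r where "r \<in> lin V V" "\<And>v. v \<in> carrier V \<Longrightarrow> f (r v) = f' (r v)"
    "tens_map K X V id r t = t"
proof -
  define h where "h v = f v \<oplus>\<^bsub>W\<^esub> \<ominus>\<^bsub>W\<^esub> f' v" for v
  have h: "h \<in> lin V W" unfolding h_def by (rule lin_minus[OF m(3,2) f f'])
  note cl = tens_map_closed[OF m(1,2,1,3) lin_id' _ t]
  have hf: "h v \<oplus>\<^bsub>W\<^esub> f' v = f v" if v: "v \<in> carrier V" for v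
    using v lin_closed[OF f v] lin_closed[OF f' v] m by (simp add: h_def module_assoc)
  have "tens_map K X W id f t = tens_map K X W id (\<lambda>v. h v \<oplus>\<^bsub>W\<^esub> f' v) t"
    by (rule tens_map_cong[OF m(1,2,1,3) lin_id' lin_plus[OF m(3) h f'] _ _ t]) (simp_all add: hf)
  also have "\<dots> = tens_map K X W id h t \<oplus>\<^bsub>tensor K X W\<^esub> tens_map K X W id f' t"
    by (rule tens_map_plus_right[OF m h f' t])
  finally have *: "tens_map K X W id f' t =
    tens_map K X W id f' t \<oplus>\<^bsub>tensor K X W\<^esub> tens_map K X W id h t"
    using eq module_comm[OF tensor_module[OF m(1,3)] cl[OF h] cl[OF f']] by simp
  have "tens_map K X W id h t = \<zero>\<^bsub>tensor K X W\<^esub>"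
    using module_add_diff[OF tensor_module[OF m(1,3)] cl[OF f'] cl[OF h]] cl[OF f'] m
    unfolding *[symmetric] by simp
  then obtain r where r: "r \<in> lin V V" "\<And>v. v \<in> carrier V \<Longrightarrow> h (r v) = \<zero>\<^bsub>W\<^esub>" "tens_map K X V id r t = t"
    using tensor_kernel[OF m h t] by blast
  have "f (r v) = f' (r v)" if v: "v \<in> carrier V" for v
    using r(2)[OF v] lin_closed[OF r(1) v] lin_closed[OF f] lin_closed[OF f'] m
    by (simp add: h_def module_diff_zero)
  then show thesis using that r by blast
qed

section \<open>Composition of maps of tensor products\<close>

lemma tens_map_comp_right:
  assumes m: "module K V" "module K W" "module K W'" "module K W''"
    and g: "g \<in> lin W W'" and h: "h \<in> lin W' W''" and t: "t \<in> carrier (tensor K V W)"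
  shows "tens_map K V W'' id h (tens_map K V W' id g t) = tens_map K V W'' id (\<lambda>w. h (g w)) t"
  using tens_map_comp[OF m(1,2,1,3,1,4) lin_id' g lin_id' h t] by (simp add: id_def)

lemma tens_map_comp_left:
  assumes m: "module K V" "module K W" "module K V'" "module K V''"
    and g: "g \<in> lin V V'" and h: "h \<in> lin V' V''" and t: "t \<in> carrier (tensor K V W)"
  shows "tens_map K V'' W h id (tens_map K V' W g id t) = tens_map K V'' W (\<lambda>w. h (g w)) id t"
  using tens_map_comp[OF m(1,2,3,2,4,2) g lin_id' h lin_id' t] by (simp add: id_def)

lemma tens_map_left_right:
  assumes m: "module K V" "module K W" "module K V'" "module K W'"
    and f: "f \<in> lin V V'" and g: "g \<in> lin W W'" and t: "t \<in> carrier (tensor K V W)"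
  shows "tens_map K V' W' f id (tens_map K V W' id g t) = tens_map K V' W' f g t"
    and "tens_map K V' W' id g (tens_map K V' W f id t) = tens_map K V' W' f g t"
  using tens_map_comp[OF m(1,2,1,4,3,4) lin_id' g f lin_id' t]
    tens_map_comp[OF m(1,2,3,2,3,4) f lin_id' lin_id' g t] by simp_all

lemma tens_map_inverse_right:
  assumes m: "module K V" "module K W" "module K W'"
    and g: "g \<in> lin W W'" and h: "h \<in> lin W' W" and t: "t \<in> carrier (tensor K V W)"
    and inv: "\<And>w. w \<in> carrier W \<Longrightarrow> h (g w) = w"
  shows "tens_map K V W id h (tens_map K V W' id g t) = t"
  unfolding tens_map_comp_right[OF m(1-3,2) g h t] by (rule tens_map_id[OF m(1,2) t]) (simp_all add: inv)

lemma tens_assoc_map_right: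
  assumes m: "module K U" "module K V" "module K W" "module K W'" and h: "h \<in> lin W W'"
    and t: "t \<in> carrier (tensor K (tensor K U V) W)"
  shows "tens_assoc K U V W' (tens_map K (tensor K U V) W' id h t) =
    tens_map K U (tensor K V W') id (tens_map K V W' id h) (tens_assoc K U V W t)"
proof -
  note UV = tensor_module[OF m(1,2)]
  have "tens_map K (tensor K U V) W' (tens_map K U V id id) h t = tens_map K (tensor K U V) W' id h t"
    by (rule tens_map_cong[OF UV m(3) UV m(4) lin_id' h _ _ t]) (simp_all add: tens_map_id[OF m(1,2)])
  then show ?thesis using tens_assoc_natural[OF m(1-3,1,2,4) lin_id' lin_id' h t] by simp
qed

section \<open>Tensor products of algebras\<close>

lemma algebra_module: "assoc_algebra K A \<Longrightarrow> module K A"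
  and algebra_ring: "assoc_algebra K A \<Longrightarrow> ring A"
  by (simp_all add: assoc_algebra_def)

lemma algebra_mult_bilin: "assoc_algebra K A \<Longrightarrow> bilin A A A (\<lambda>x y. x \<otimes>\<^bsub>A\<^esub> y)"
proof -
  assume A: "assoc_algebra K A"
  interpret A: ring A by (rule algebra_ring[OF A])
  show ?thesis
    by (intro bilinI linI)
       (auto simp: A.r_distr A.l_distr assoc_algebra.smult_mult_left[OF A] assoc_algebra.smult_mult_right[OF A])
qed

text \<open>The multiplication on a tensor product is defined by lifts into the bare vector space; lifting depends
on the vector space structure of the target only.\<close>

lemma tens_lift_tensor_space: "tens_lift K (tensor_space K A B) = tens_lift K (tensor K A B)"
  by (intro ext) (simp add: tens_lift_def finsum_def tensor_eqs)

lemma tensor_mult: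
  "s \<otimes>\<^bsub>tensor K A B\<^esub> t = tens_lift K (tensor K A B) (\<lambda>a b. tens_lift K (tensor K A B)
     (\<lambda>c d. tens K A B (a \<otimes>\<^bsub>A\<^esub> c) (b \<otimes>\<^bsub>B\<^esub> d)) t) s"
  unfolding tens_lift_tensor_space[symmetric] by (simp add: tensor_def Let_def)

lemma tensor_one: "\<one>\<^bsub>tensor K A B\<^esub> = tens K A B \<one>\<^bsub>A\<^esub> \<one>\<^bsub>B\<^esub>"
  by (simp add: tensor_def Let_def)

lemma tensor_mult_tens_right_bilin:
  assumes A: "assoc_algebra K A" and B: "assoc_algebra K B" and "a \<in> carrier A" "b \<in> carrier B"
  shows "bilin A B (tensor K A B) (\<lambda>c d. tens K A B (a \<otimes>\<^bsub>A\<^esub> c) (b \<otimes>\<^bsub>B\<^esub> d))"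
  by (rule bilin_tens[OF algebra_module[OF A] algebra_module[OF B] bilin2[OF algebra_mult_bilin[OF A]]
        bilin2[OF algebra_mult_bilin[OF B]]]) fact+

lemma tensor_mult_outer_bilin:
  assumes A: "assoc_algebra K A" and B: "assoc_algebra K B" and t: "t \<in> carrier (tensor K A B)"
  shows "bilin A B (tensor K A B) (\<lambda>a b. tens_lift K (tensor K A B)
     (\<lambda>c d. tens K A B (a \<otimes>\<^bsub>A\<^esub> c) (b \<otimes>\<^bsub>B\<^esub> d)) t)"
proof -
  note mA = algebra_module[OF A] and mB = algebra_module[OF B]
  note T = tensor_module[OF mA mB]
  note bl = tensor_mult_tens_right_bilin[OF A B]
  show ?thesis
  proof (rule bilinI)
    fix a assume a: "a \<in> carrier A"
    show "(\<lambda>b. tens_lift K (tensor K A B) (\<lambda>c d. tens K A B (a \<otimes>\<^bsub>A\<^esub> c) (b \<otimes>\<^bsub>B\<^esub> d)) t)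
        \<in> lin B (tensor K A B)"
      by (rule lin_tens_lift_param[OF mB mA mB T bl[OF a] lin_tens2[OF mA mB bilin1[OF algebra_mult_bilin[OF B]]] t])
         (auto intro: bilin_closed[OF algebra_mult_bilin[OF A] a])
  next
    fix b assume b: "b \<in> carrier B"
    show "(\<lambda>a. tens_lift K (tensor K A B) (\<lambda>c d. tens K A B (a \<otimes>\<^bsub>A\<^esub> c) (b \<otimes>\<^bsub>B\<^esub> d)) t)
        \<in> lin A (tensor K A B)"
      by (rule lin_tens_lift_param[OF mA mA mB T bl[OF _ b] lin_tens1[OF mA mB bilin1[OF algebra_mult_bilin[OF A]]] t])
         (auto intro: bilin_closed[OF algebra_mult_bilin[OF B] b])
  qed
qed

lemma tensor_mult_tens_left:
  assumes A: "assoc_algebra K A" and B: "assoc_algebra K B" and "a \<in> carrier A" "b \<in> carrier B"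
    and t: "t \<in> carrier (tensor K A B)"
  shows "tens K A B a b \<otimes>\<^bsub>tensor K A B\<^esub> t =
    tens_lift K (tensor K A B) (\<lambda>c d. tens K A B (a \<otimes>\<^bsub>A\<^esub> c) (b \<otimes>\<^bsub>B\<^esub> d)) t"
  using assms tensor_mult_outer_bilin[OF A B t] algebra_module[OF A] algebra_module[OF B]
  by (simp add: tensor_mult)

lemma tensor_mult_tens:
  assumes A: "assoc_algebra K A" and B: "assoc_algebra K B" and "a \<in> carrier A" "b \<in> carrier B"
    "c \<in> carrier A" "d \<in> carrier B"
  shows "tens K A B a b \<otimes>\<^bsub>tensor K A B\<^esub> tens K A B c d = tens K A B (a \<otimes>\<^bsub>A\<^esub> c) (b \<otimes>\<^bsub>B\<^esub> d)"
  using assms algebra_module[OF A] algebra_module[OF B]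
  by (simp add: tensor_mult_tens_left[OF A B] tensor_mult_tens_right_bilin[OF A B])

lemma tensor_mult_bilin:
  assumes A: "assoc_algebra K A" and B: "assoc_algebra K B"
  shows "bilin (tensor K A B) (tensor K A B) (tensor K A B) (\<lambda>s t. s \<otimes>\<^bsub>tensor K A B\<^esub> t)"
proof -
  note mA = algebra_module[OF A] and mB = algebra_module[OF B]
  note T = tensor_module[OF mA mB]
  show ?thesis
    unfolding tensor_mult
    by (rule bilin_tens_lift[OF mA mB T T tensor_mult_outer_bilin[OF A B]
          tens_lift_lin[OF mA mB T tensor_mult_tens_right_bilin[OF A B]]])
qed

lemma tensor_mult_assoc:
  assumes A: "assoc_algebra K A" and B: "assoc_algebra K B"
    and r: "r \<in> carrier (tensor K A B)" and s: "s \<in> carrier (tensor K A B)"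
    and t: "t \<in> carrier (tensor K A B)"
  shows "(r \<otimes>\<^bsub>tensor K A B\<^esub> s) \<otimes>\<^bsub>tensor K A B\<^esub> t = r \<otimes>\<^bsub>tensor K A B\<^esub> (s \<otimes>\<^bsub>tensor K A B\<^esub> t)"
proof -
  note mA = algebra_module[OF A] and mB = algebra_module[OF B]
  interpret A: ring A by (rule algebra_ring[OF A])
  interpret B: ring B by (rule algebra_ring[OF B])
  let ?T = "tensor K A B"
  note T = tensor_module[OF mA mB]
  note m1 = bilin1[OF tensor_mult_bilin[OF A B]] and m2 = bilin2[OF tensor_mult_bilin[OF A B]]
  note mc = bilin_closed[OF tensor_mult_bilin[OF A B]]
  note tt = tensor_mult_tens[OF A B]
  note tc = tens_closed[OF mA mB]
  have 1: "(tens K A B a b \<otimes>\<^bsub>?T\<^esub> tens K A B c d) \<otimes>\<^bsub>?T\<^esub> t = tens K A B a b \<otimes>\<^bsub>?T\<^esub> (tens K A B c d \<otimes>\<^bsub>?T\<^esub> t)"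
    if *: "a \<in> carrier A" "b \<in> carrier B" "c \<in> carrier A" "d \<in> carrier B" for a b c d
    by (rule lin_tensor_eqI[OF mA mB m2[OF mc[OF tc[OF *(1,2)] tc[OF *(3,4)]]]
          lin_comp[OF m2[OF tc[OF *(3,4)]] m2[OF tc[OF *(1,2)]]] _ t])
       (simp add: * tt A.m_assoc B.m_assoc)
  have 2: "(tens K A B a b \<otimes>\<^bsub>?T\<^esub> s) \<otimes>\<^bsub>?T\<^esub> t = tens K A B a b \<otimes>\<^bsub>?T\<^esub> (s \<otimes>\<^bsub>?T\<^esub> t)"
    if *: "a \<in> carrier A" "b \<in> carrier B" for a b
    by (rule lin_tensor_eqI[OF mA mB lin_comp[OF m2[OF tc[OF *]] m1[OF t]]
          lin_comp[OF m1[OF t] m2[OF tc[OF *]]] _ s]) (rule 1[OF *])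
  show ?thesis
    by (rule lin_tensor_eqI[OF mA mB lin_comp[OF m1[OF s] m1[OF t]] m1[OF mc[OF s t]] _ r]) (rule 2)
qed

lemma tensor_l_one:
  assumes A: "assoc_algebra K A" and B: "assoc_algebra K B" and t: "t \<in> carrier (tensor K A B)"
  shows "\<one>\<^bsub>tensor K A B\<^esub> \<otimes>\<^bsub>tensor K A B\<^esub> t = t"
proof -
  note mA = algebra_module[OF A] and mB = algebra_module[OF B]
  interpret A: ring A by (rule algebra_ring[OF A])
  interpret B: ring B by (rule algebra_ring[OF B])
  show ?thesis
    unfolding tensor_one
    by (rule lin_tensor_eqI[OF mA mB bilin2[OF tensor_mult_bilin[OF A B]] lin_id _ t])
       (simp_all add: tensor_mult_tens[OF A B] mA mB)
qed

lemma tens_map_mult: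
  assumes A: "assoc_algebra K A" and B: "assoc_algebra K B" and A': "assoc_algebra K A'"
    and B': "assoc_algebra K B'" and f: "f \<in> lin A A'" and g: "g \<in> lin B B'"
    and fm: "\<And>x y. x \<in> carrier A \<Longrightarrow> y \<in> carrier A \<Longrightarrow> f (x \<otimes>\<^bsub>A\<^esub> y) = f x \<otimes>\<^bsub>A'\<^esub> f y"
    and gm: "\<And>x y. x \<in> carrier B \<Longrightarrow> y \<in> carrier B \<Longrightarrow> g (x \<otimes>\<^bsub>B\<^esub> y) = g x \<otimes>\<^bsub>B'\<^esub> g y"
    and s: "s \<in> carrier (tensor K A B)" and t: "t \<in> carrier (tensor K A B)"
  shows "tens_map K A' B' f g (s \<otimes>\<^bsub>tensor K A B\<^esub> t) =
    tens_map K A' B' f g s \<otimes>\<^bsub>tensor K A' B'\<^esub> tens_map K A' B' f g t"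
proof -
  note mA = algebra_module[OF A] and mB = algebra_module[OF B]
  note mA' = algebra_module[OF A'] and mB' = algebra_module[OF B']
  interpret A: ring A by (rule algebra_ring[OF A])
  interpret B: ring B by (rule algebra_ring[OF B])
  note m1 = bilin1[OF tensor_mult_bilin[OF A B]] and m2 = bilin2[OF tensor_mult_bilin[OF A B]]
  note m1' = bilin1[OF tensor_mult_bilin[OF A' B']] and m2' = bilin2[OF tensor_mult_bilin[OF A' B']]
  note L = tens_map_lin[OF mA mB mA' mB' f g]
  note tm = tens_map_tens[OF mA mB mA' mB' f g]
  have 1: "tens_map K A' B' f g (tens K A B a b \<otimes>\<^bsub>tensor K A B\<^esub> t) =
    tens_map K A' B' f g (tens K A B a b) \<otimes>\<^bsub>tensor K A' B'\<^esub> tens_map K A' B' f g t"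
    if *: "a \<in> carrier A" "b \<in> carrier B" for a b
    by (rule lin_tensor_eqI[OF mA mB lin_comp[OF m2[OF tens_closed[OF mA mB *]] L]
          lin_comp[OF L m2'[OF lin_closed[OF L tens_closed[OF mA mB *]]]] _ t])
       (simp add: * tensor_mult_tens[OF A B] tensor_mult_tens[OF A' B'] tm fm gm lin_closed[OF f] lin_closed[OF g])
  show ?thesis
    by (rule lin_tensor_eqI[OF mA mB lin_comp[OF m1[OF t] L] lin_comp[OF L m1'[OF lin_closed[OF L t]]] _ s])
       (rule 1)
qed

section \<open>Comodules\<close>

lemma coalgebra_module: "coalgebra K C \<Longrightarrow> module K C"
  by (simp add: coalgebra_def)

lemma left_comodule_module: "left_comodule K C M \<Longrightarrow> module K M"
  by (simp add: left_comodule_def)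

lemma left_comodule_coalgebra: "left_comodule K C M \<Longrightarrow> coalgebra K C"
  by (simp add: left_comodule_def)

lemma lcomodule_hom_lin: "f \<in> lcomodule_hom K C M N \<Longrightarrow> f \<in> lin M N"
  and lcomodule_hom_coact: "f \<in> lcomodule_hom K C M N \<Longrightarrow> m \<in> carrier M \<Longrightarrow>
    lcoact N (f m) = tens_map K C N id f (lcoact M m)"
  by (auto simp: lcomodule_hom_def)

lemma lcomodule_hom_comp:
  assumes M: "left_comodule K C M" and N: "left_comodule K C N" and P: "left_comodule K C P"
    and f: "f \<in> lcomodule_hom K C M N" and g: "g \<in> lcomodule_hom K C N P"
  shows "(\<lambda>x. g (f x)) \<in> lcomodule_hom K C M P"
proof -
  note mods = coalgebra_module[OF left_comodule_coalgebra[OF M]] left_comodule_module[OF M]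
    left_comodule_module[OF N] left_comodule_module[OF P]
  note fl = lcomodule_hom_lin[OF f] and gl = lcomodule_hom_lin[OF g]
  show ?thesis
    using lin_comp[OF fl gl] lin_closed[OF fl] lin_closed[OF left_comodule.lcoact_lin[OF M]]
    by (simp add: lcomodule_hom_def lcomodule_hom_coact[OF f] lcomodule_hom_coact[OF g]
        tens_map_comp_right[OF mods fl gl])
qed

text \<open>The map \<open>id \<otimes> (id \<otimes> i)\<close> has the left inverse \<open>id \<otimes> (id \<otimes> r)\<close>, so that the axioms for \<open>N\<close> may be
checked in \<open>C \<otimes> (C \<otimes> M)\<close>, where they become those for \<open>M\<close>.  For an inclusion \<open>i\<close> the
hypothesis \<open>stable\<close> says that \<open>N\<close> is a subcomodule; for a bijection the lemma transports the structure.\<close>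

lemma retract_left_comodule:
  fixes M :: "('k, 'c, 'm, 'y) lcomodule_scheme" and N :: "('k, 'c, 'n, 'w) lcomodule_scheme"
  assumes M: "left_comodule K C M" and mN: "module K N"
    and i: "i \<in> lin N M" and r: "r \<in> lin M N" and ri: "\<And>n. n \<in> carrier N \<Longrightarrow> r (i n) = n"
    and stable: "\<And>n. n \<in> carrier N \<Longrightarrow>
      tens_map K C M id (\<lambda>x. i (r x)) (lcoact M (i n)) = lcoact M (i n)"
    and coact: "\<And>n. n \<in> carrier N \<Longrightarrow> lcoact N n = tens_map K C N id r (lcoact M (i n))"
  shows "left_comodule K C N" and "i \<in> lcomodule_hom K C N M"
proof -
  note C = left_comodule_coalgebra[OF M]
  note mC = coalgebra_module[OF C] and mM = left_comodule_module[OF M]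
  note lM = left_comodule.lcoact_lin[OF M]
  note D = coalgebra.comult_lin[OF C] and E = coalgebra.counit_lin[OF C]
  have mm: "module K (tensor K C M)" "module K (tensor K C N)" "module K (tensor K C C)"
    using mC mM mN by auto
  note ci = tens_map_lin[OF mC mN mC mM lin_id' i] and cr = tens_map_lin[OF mC mM mC mN lin_id' r]
  have lN: "lcoact N \<in> lin N (tensor K C N)"
    by (rule lin_cong[OF lin_comp[OF i lin_comp[OF lM cr]] mN]) (simp add: coact)
  have ico: "tens_map K C M id i (lcoact N n) = lcoact M (i n)" if n: "n \<in> carrier N" for n
    using stable[OF n] tens_map_comp_right[OF mC mM mN mM r i lin_closed[OF lM lin_closed[OF i n]]]
    by (simp add: coact[OF n])
  show "i \<in> lcomodule_hom K C N M" using i ico by (simp add: lcomodule_hom_def)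
  have inv: "tens_map K C N id r (tens_map K C M id i t) = t" if "t \<in> carrier (tensor K C N)" for t
    by (rule tens_map_inverse_right[OF mC mN mM i r that ri])
  have "tens_assoc K C C N (tens_map K (tensor K C C) N (comult C) id (lcoact N n)) =
      tens_map K C (tensor K C N) id (lcoact N) (lcoact N n)" (is "?l = ?r") if n: "n \<in> carrier N" for n
  proof -
    let ?J = "tens_map K C (tensor K C M) id (tens_map K C M id i)"
    note cn = lin_closed[OF lN n]
    have l: "?l \<in> carrier (tensor K C (tensor K C N))"
      using mC mN mm cn by (intro tens_assoc_closed tens_map_closed[OF mC mN mm(3) mN D lin_id']) auto
    have r: "?r \<in> carrier (tensor K C (tensor K C N))"
      by (rule tens_map_closed[OF mC mN mC mm(2) lin_id' lN cn])
    have "?J ?l = tens_assoc K C C M (tens_map K (tensor K C C) M id i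
        (tens_map K (tensor K C C) N (comult C) id (lcoact N n)))"
      by (rule tens_assoc_map_right[OF mC mC mN mM i tens_map_closed[OF mC mN mm(3) mN D lin_id' cn], symmetric])
    also have "\<dots> = tens_assoc K C C M (tens_map K (tensor K C C) M (comult C) id (lcoact M (i n)))"
      using tens_map_left_right[OF mC mN mm(3) mM D i cn] by (simp add: ico[OF n])
    also have "\<dots> = tens_map K C (tensor K C M) id (lcoact M) (lcoact M (i n))"
      by (rule left_comodule.lcoact_coassoc[OF M lin_closed[OF i n]])
    also have "\<dots> = tens_map K C (tensor K C M) id (\<lambda>n. lcoact M (i n)) (lcoact N n)"
      using tens_map_comp_right[OF mC mN mM mm(1) i lM cn] by (simp add: ico[OF n])
    also have "\<dots> = tens_map K C (tensor K C M) id (\<lambda>n. tens_map K C M id i (lcoact N n)) (lcoact N n)"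
      by (rule tens_map_cong[OF mC mN mC mm(1) lin_id' lin_comp[OF lN ci] _ _ cn]) (simp_all add: ico)
    also have "\<dots> = ?J ?r"
      by (rule tens_map_comp_right[OF mC mN mm(2,1) lN ci cn, symmetric])
    finally have "?J ?l = ?J ?r" .
    then show ?thesis
      using tens_map_inverse_right[OF mC mm(2,1) ci cr l inv] tens_map_inverse_right[OF mC mm(2,1) ci cr r inv]
      by metis
  qed
  moreover have "tens_lift K N (\<lambda>c n. counit C c \<odot>\<^bsub>N\<^esub> n) (lcoact N n) = n" if n: "n \<in> carrier N" for n
  proof -
    note cn = lin_closed[OF lN n]
    have bN: "bilin C N N (\<lambda>c n. counit C c \<odot>\<^bsub>N\<^esub> n)" by (rule bilin_comp[OF smult_bilin[OF mN] E lin_id])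
    have bM: "bilin C M M (\<lambda>c n. counit C c \<odot>\<^bsub>M\<^esub> n)" by (rule bilin_comp[OF smult_bilin[OF mM] E lin_id])
    have bi: "bilin C N M (\<lambda>c n. counit C c \<odot>\<^bsub>M\<^esub> i n)" by (rule bilin_comp[OF smult_bilin[OF mM] E i])
    have ec: "counit C c \<in> carrier K" if "c \<in> carrier C" for c
      using lin_closed[OF E that] by (simp add: base_module_def)
    let ?e = "tens_lift K N (\<lambda>c n. counit C c \<odot>\<^bsub>N\<^esub> n) (lcoact N n)"
    have "i ?e = tens_lift K M (\<lambda>c n. i (counit C c \<odot>\<^bsub>N\<^esub> n)) (lcoact N n)"
      by (rule lin_tens_lift[OF mC mN mN mM bN i cn])
    also have "\<dots> = tens_lift K M (\<lambda>c n. counit C c \<odot>\<^bsub>M\<^esub> i n) (lcoact N n)"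
      by (rule tens_lift_cong[OF mC mN mM bi _ cn]) (simp add: lin_smult[OF i] ec)
    also have "\<dots> = tens_lift K M (\<lambda>c n. counit C c \<odot>\<^bsub>M\<^esub> n) (lcoact M (i n))"
      using tens_lift_tens_map[OF mC mN mC mM mM lin_id' i bM cn] by (simp add: ico[OF n])
    also have "\<dots> = i n" by (rule left_comodule.lcoact_counit[OF M lin_closed[OF i n]])
    finally have "r (i ?e) = r (i n)" by simp
    then show ?thesis using ri[OF n] ri[OF tens_lift_closed[OF mC mN mN bN cn]] by simp
  qed
  ultimately show "left_comodule K C N"
    using C mN lN by (simp add: left_comodule_def left_comodule_axioms_def)
qed

section \<open>Cotensor products\<close>

lemma cotensor_carrier:
  "t \<in> carrier (cotensor K C M N) \<longleftrightarrow> t \<in> carrier (tensor K M N) \<and>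
    tens_assoc K M C N (tens_map K (tensor K M C) N (rcoact M) id t) =
    tens_map K M (tensor K C N) id (lcoact N) t"
  and cotensor_zero: "\<zero>\<^bsub>cotensor K C M N\<^esub> = \<zero>\<^bsub>tensor K M N\<^esub>"
  by (simp_all add: cotensor_def)

lemma right_comodule_module: "right_comodule K C M \<Longrightarrow> module K M"
  by (simp add: right_comodule_def)

text \<open>The map \<open>id \<otimes> f\<close> is compatible with each of the two maps whose equalizer is the cotensor product.\<close>

lemma cotensor_map_equivariance:
  fixes M :: "('k, 'c, 'm, 'y) rcomodule_scheme"
  assumes M: "right_comodule K C M" and N: "left_comodule K C N" and P: "left_comodule K C P"
    and f: "f \<in> lcomodule_hom K C N P" and t: "t \<in> carrier (tensor K M N)"
  shows "tens_assoc K M C P (tens_map K (tensor K M C) P (rcoact M) id (tens_map K M P id f t)) =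
      tens_map K M (tensor K C P) id (tens_map K C P id f)
        (tens_assoc K M C N (tens_map K (tensor K M C) N (rcoact M) id t))"
    and "tens_map K M (tensor K C P) id (lcoact P) (tens_map K M P id f t) =
      tens_map K M (tensor K C P) id (tens_map K C P id f) (tens_map K M (tensor K C N) id (lcoact N) t)"
proof -
  note mC = coalgebra_module[OF left_comodule_coalgebra[OF N]] and mM = right_comodule_module[OF M]
  note mN = left_comodule_module[OF N] and mP = left_comodule_module[OF P]
  note lN = left_comodule.lcoact_lin[OF N] and lP = left_comodule.lcoact_lin[OF P]
  note rM = right_comodule.rcoact_lin[OF M]
  note fl = lcomodule_hom_lin[OF f]
  have mm: "module K (tensor K M C)" "module K (tensor K C N)" "module K (tensor K C P)"
    using mC mM mN mP by auto
  note cf = tens_map_lin[OF mC mN mC mP lin_id' fl]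
  show "tens_assoc K M C P (tens_map K (tensor K M C) P (rcoact M) id (tens_map K M P id f t)) =
      tens_map K M (tensor K C P) id (tens_map K C P id f)
        (tens_assoc K M C N (tens_map K (tensor K M C) N (rcoact M) id t))"
    using tens_map_left_right[OF mM mN mm(1) mP rM fl t]
      tens_assoc_map_right[OF mM mC mN mP fl tens_map_closed[OF mM mN mm(1) mN rM lin_id' t]] by simp
  have "tens_map K M (tensor K C P) id (lcoact P) (tens_map K M P id f t) =
      tens_map K M (tensor K C P) id (\<lambda>n. lcoact P (f n)) t"
    by (rule tens_map_comp_right[OF mM mN mP mm(3) fl lP t])
  also have "\<dots> = tens_map K M (tensor K C P) id (\<lambda>n. tens_map K C P id f (lcoact N n)) t"
    by (rule tens_map_cong[OF mM mN mM mm(3) lin_id' lin_comp[OF lN cf] _ _ t])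
       (simp_all add: lcomodule_hom_coact[OF f])
  also have "\<dots> = tens_map K M (tensor K C P) id (tens_map K C P id f) (tens_map K M (tensor K C N) id (lcoact N) t)"
    by (rule tens_map_comp_right[OF mM mN mm(2,3) lN cf t, symmetric])
  finally show "tens_map K M (tensor K C P) id (lcoact P) (tens_map K M P id f t) =
      tens_map K M (tensor K C P) id (tens_map K C P id f) (tens_map K M (tensor K C N) id (lcoact N) t)" .
qed

lemma cotensor_map_closed:
  fixes M :: "('k, 'c, 'm, 'y) rcomodule_scheme"
  assumes M: "right_comodule K C M" and N: "left_comodule K C N" and P: "left_comodule K C P"
    and f: "f \<in> lcomodule_hom K C N P" and t: "t \<in> carrier (cotensor K C M N)"
  shows "tens_map K M P id f t \<in> carrier (cotensor K C M P)"
proof -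
  have tc: "t \<in> carrier (tensor K M N)" using t by (simp add: cotensor_carrier)
  show ?thesis
    unfolding cotensor_carrier cotensor_map_equivariance[OF M N P f tc]
    using t tens_map_closed[OF right_comodule_module[OF M] left_comodule_module[OF N]
      right_comodule_module[OF M] left_comodule_module[OF P] lin_id' lcomodule_hom_lin[OF f] tc]
    unfolding cotensor_carrier by metis
qed

text \<open>Since \<open>f\<close> has a left inverse, \<open>id \<otimes> (id \<otimes> f)\<close> is injective on the space in which the two sides of the
equalizer condition are compared.\<close>

lemma cotensor_map_reflects:
  fixes M :: "('k, 'c, 'm, 'y) rcomodule_scheme"
  assumes M: "right_comodule K C M" and N: "left_comodule K C N" and P: "left_comodule K C P"
    and f: "f \<in> lcomodule_hom K C N P" and g: "g \<in> lin P N" and gf: "\<And>n. n \<in> carrier N \<Longrightarrow> g (f n) = n"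
    and t: "t \<in> carrier (tensor K M N)" and ft: "tens_map K M P id f t \<in> carrier (cotensor K C M P)"
  shows "t \<in> carrier (cotensor K C M N)"
proof -
  note mC = coalgebra_module[OF left_comodule_coalgebra[OF N]] and mM = right_comodule_module[OF M]
  note mN = left_comodule_module[OF N] and mP = left_comodule_module[OF P]
  note lN = left_comodule.lcoact_lin[OF N]
  note rM = right_comodule.rcoact_lin[OF M]
  note fl = lcomodule_hom_lin[OF f]
  have mm: "module K (tensor K M C)" "module K (tensor K C N)" "module K (tensor K C P)"
    using mC mM mN mP by auto
  note cf = tens_map_lin[OF mC mN mC mP lin_id' fl] and cg = tens_map_lin[OF mC mP mC mN lin_id' g]
  let ?J = "tens_map K M (tensor K C P) id (tens_map K C P id f)"
  let ?l = "tens_assoc K M C N (tens_map K (tensor K M C) N (rcoact M) id t)"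
  let ?r = "tens_map K M (tensor K C N) id (lcoact N) t"
  have l: "?l \<in> carrier (tensor K M (tensor K C N))"
    by (intro tens_assoc_closed tens_map_closed[OF mM mN mm(1) mN rM lin_id' t] mM mC mN)
  have r: "?r \<in> carrier (tensor K M (tensor K C N))"
    by (rule tens_map_closed[OF mM mN mM mm(2) lin_id' lN t])
  have inv: "tens_map K C N id g (tens_map K C P id f u) = u" if "u \<in> carrier (tensor K C N)" for u
    by (rule tens_map_inverse_right[OF mC mN mP fl g that gf])
  have "?J ?l = ?J ?r"
    using ft unfolding cotensor_carrier cotensor_map_equivariance[OF M N P f t] by (rule conjunct2)
  note J = this
  let ?G = "tens_map K M (tensor K C N) id (tens_map K C N id g)"
  have "?l = ?G (?J ?l)" by (rule tens_map_inverse_right[OF mM mm(2,3) cf cg l inv, symmetric])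
  also have "\<dots> = ?G (?J ?r)" by (simp only: J)
  also have "\<dots> = ?r" by (rule tens_map_inverse_right[OF mM mm(2,3) cf cg r inv])
  finally have "?l = ?r" .
  then show ?thesis using t by (simp add: cotensor_carrier)
qed

section \<open>Faithful coflatness\<close>

text \<open>A coaction takes values in a tensor product with the comodule itself.  A comodule record is therefore
built in two steps, the coaction being filled in afterwards; this has no influence on the tensor product.\<close>

lemma tens_map_lcoact_update: "tens_map K C (N\<lparr>lcoact := h\<rparr>) = tens_map K C N"
  by (intro ext) (simp add: tens_map_def tensor_def tensor_space_def tens_def tensor_rels_def tensor_gens_def Let_def)

lemma transport_module:
  assumes N: "module K N" and kj: "\<And>x. x \<in> carrier N \<Longrightarrow> k (j x) = x"
    and N': "carrier N' = j ` carrier N" "\<zero>\<^bsub>N'\<^esub> = j \<zero>\<^bsub>N\<^esub>"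
      "\<And>x y. x \<oplus>\<^bsub>N'\<^esub> y = j (k x \<oplus>\<^bsub>N\<^esub> k y)" "\<And>c x. c \<odot>\<^bsub>N'\<^esub> x = j (c \<odot>\<^bsub>N\<^esub> k x)"
  shows "module K N'" and "j \<in> lin N N'" and "k \<in> lin N' N"
proof -
  have inv: "\<exists>y\<in>carrier N'. y \<oplus>\<^bsub>N'\<^esub> x = \<zero>\<^bsub>N'\<^esub>" if "x \<in> carrier N'" for x
    using that N by (intro bexI[of _ "j (\<ominus>\<^bsub>N\<^esub> (k x))"]) (auto simp: N' kj)
  have "abelian_group N'"
    by (rule abelian_groupI) (use N inv in \<open>auto simp: N' kj module_assoc intro!: arg_cong[where f = j] module_comm\<close>)
  then show "module K N'"
    by (rule moduleI[OF is_cring])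
       (use N in \<open>auto simp: N' kj module.smult_l_distr module.smult_r_distr module.smult_assoc1\<close>)
  show "j \<in> lin N N'" "k \<in> lin N' N"
    using N by (auto intro!: linI simp: N' kj)
qed

text \<open>Everything but the coaction.  The fields \<open>mult\<close> and \<open>one\<close> carry no meaning for a comodule.\<close>

definition transport_base :: "('k, 'c, 'n, 'w) lcomodule_scheme \<Rightarrow> ('n \<Rightarrow> 'v) \<Rightarrow> ('k, 'c, 'v) lcomodule"
  where "transport_base N j =
    \<lparr>carrier = j ` carrier N, mult = undefined, one = undefined, zero = j \<zero>\<^bsub>N\<^esub>,
     add = (\<lambda>x y. j (inv_into (carrier N) j x \<oplus>\<^bsub>N\<^esub> inv_into (carrier N) j y)),
     smult = (\<lambda>c x. j (c \<odot>\<^bsub>N\<^esub> inv_into (carrier N) j x)), lcoact = undefined\<rparr>"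

definition transport_comodule ::
  "('k, 'c, 'x) coalgebra_scheme \<Rightarrow> ('k, 'c, 'n, 'w) lcomodule_scheme \<Rightarrow> ('n \<Rightarrow> 'v) \<Rightarrow> ('k, 'c, 'v) lcomodule"
  where "transport_comodule C N j = (transport_base N j)
    \<lparr>lcoact := (\<lambda>x. tens_map K C (transport_base N j) id j (lcoact N (inv_into (carrier N) j x)))\<rparr>"

lemma transport_comodule:
  fixes N :: "('k, 'c, 'n, 'w) lcomodule_scheme"
  assumes N: "left_comodule K C N" and j: "inj_on j (carrier N)"
  shows "left_comodule K C (transport_comodule C N j)"
    and "j \<in> lcomodule_hom K C N (transport_comodule C N j)"
    and "inv_into (carrier N) j \<in> lcomodule_hom K C (transport_comodule C N j) N"
    and "carrier (transport_comodule C N j) = j ` carrier N"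
    and "\<zero>\<^bsub>transport_comodule C N j\<^esub> = j \<zero>\<^bsub>N\<^esub>"
proof -
  let ?N = "transport_comodule C N j" and ?k = "inv_into (carrier N) j"
  have kj: "?k (j x) = x" if "x \<in> carrier N" for x using j that by simp
  show car: "carrier ?N = j ` carrier N" and zero: "\<zero>\<^bsub>?N\<^esub> = j \<zero>\<^bsub>N\<^esub>"
    by (simp_all add: transport_comodule_def transport_base_def)
  have add: "x \<oplus>\<^bsub>?N\<^esub> y = j (?k x \<oplus>\<^bsub>N\<^esub> ?k y)" for x y
    by (simp add: transport_comodule_def transport_base_def)
  have smult: "c \<odot>\<^bsub>?N\<^esub> x = j (c \<odot>\<^bsub>N\<^esub> ?k x)" for c x
    by (simp add: transport_comodule_def transport_base_def)
  have co: "lcoact ?N x = tens_map K C ?N id j (lcoact N (?k x))" for x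
    unfolding transport_comodule_def tens_map_lcoact_update by simp
  note mN = left_comodule_module[OF N]
  note mC = coalgebra_module[OF left_comodule_coalgebra[OF N]]
  note T = transport_module[where N' = ?N, OF mN kj car zero add smult]
  have jk: "?k x \<in> carrier N" "j (?k x) = x" if "x \<in> carrier ?N" for x using that kj by (auto simp: car)
  note lN = left_comodule.lcoact_lin[OF N]
  have st: "tens_map K C N id (\<lambda>x. ?k (j x)) (lcoact N (?k n)) = lcoact N (?k n)" if "n \<in> carrier ?N" for n
    by (rule tens_map_id[OF mC mN lin_closed[OF lN jk(1)[OF that]]]) (simp_all add: kj)
  show "left_comodule K C ?N" "?k \<in> lcomodule_hom K C ?N N"
    using retract_left_comodule[OF N T(1,3,2) jk(2) st co] by auto
  show "j \<in> lcomodule_hom K C N ?N" using T(2) kj by (simp add: lcomodule_hom_def co)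
qed

text \<open>All three comodules are copied along the injections; cotensoring turns the isomorphisms
with the copies into isomorphisms, which carry exactness back and forth.\<close>

lemma faithfully_coflat_reflects_exact:
  fixes L :: "('k, 'c, 'l, 'x1) lcomodule_scheme" and N :: "('k, 'c, 'n, 'x2) lcomodule_scheme"
    and P :: "('k, 'c, 'p, 'x3) lcomodule_scheme" and M :: "('k, 'c, 'm, 'x4) rcomodule_scheme"
    and jL :: "'l \<Rightarrow> 'v" and jN :: "'n \<Rightarrow> 'v" and jP :: "'p \<Rightarrow> 'v"
  assumes fc: "faithfully_coflat TYPE('v) K C M"
    and L: "left_comodule K C L" and N: "left_comodule K C N" and P: "left_comodule K C P"
    and jL: "inj_on jL (carrier L)" and jN: "inj_on jN (carrier N)" and jP: "inj_on jP (carrier P)"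
    and f: "f \<in> lcomodule_hom K C L N" and g: "g \<in> lcomodule_hom K C N P"
    and ex: "exact_at (cotensor K C M L) (cotensor K C M N) (cotensor K C M P)
      (cotensor_map K M N f) (cotensor_map K M P g)"
  shows "exact_at L N P f g"
proof -
  have M: "right_comodule K C M" using fc by (simp add: faithfully_coflat_def)
  note TL = transport_comodule[OF L jL] and TN = transport_comodule[OF N jN]
    and TP = transport_comodule[OF P jP]
  define kL where "kL = inv_into (carrier L) jL"
  define kN where "kN = inv_into (carrier N) jN"
  define kP where "kP = inv_into (carrier P) jP"
  define L' where "L' = transport_comodule C L jL"
  define N' where "N' = transport_comodule C N jN"
  define P' where "P' = transport_comodule C P jP"
  note TL = TL[folded kL_def L'_def] and TN = TN[folded kN_def N'_def] and TP = TP[folded kP_def P'_def]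
  note mM = right_comodule_module[OF M]
  note mL = left_comodule_module[OF L] and mN = left_comodule_module[OF N] and mP = left_comodule_module[OF P]
  note mL' = left_comodule_module[OF TL(1)] and mN' = left_comodule_module[OF TN(1)]
    and mP' = left_comodule_module[OF TP(1)]
  have kj: "x \<in> carrier L \<Longrightarrow> kL (jL x) = x" "y \<in> carrier N \<Longrightarrow> kN (jN y) = y"
    "z \<in> carrier P \<Longrightarrow> kP (jP z) = z" for x y z
    using jL jN jP by (simp_all add: kL_def kN_def kP_def)
  have jk: "x \<in> carrier L' \<Longrightarrow> jL (kL x) = x" "y \<in> carrier N' \<Longrightarrow> jN (kN y) = y" for x y
    using kj by (auto simp: TL(4) TN(4))
  define f' where "f' x = jN (f (kL x))" for x
  define g' where "g' x = jP (g (kN x))" for x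
  have f': "f' \<in> lcomodule_hom K C L' N'" unfolding f'_def
    by (rule lcomodule_hom_comp[OF TL(1) L TN(1) TL(3) lcomodule_hom_comp[OF L N TN(1) f TN(2)]])
  have g': "g' \<in> lcomodule_hom K C N' P'" unfolding g'_def
    by (rule lcomodule_hom_comp[OF TN(1) N TP(1) TN(3) lcomodule_hom_comp[OF N P TP(1) g TP(2)]])
  note fl = lcomodule_hom_lin[OF f] and gl = lcomodule_hom_lin[OF g]
  note fl' = lcomodule_hom_lin[OF f'] and gl' = lcomodule_hom_lin[OF g']
  note jl = lcomodule_hom_lin[OF TL(2)] lcomodule_hom_lin[OF TN(2)] lcomodule_hom_lin[OF TP(2)]
  note kl = lcomodule_hom_lin[OF TL(3)] lcomodule_hom_lin[OF TN(3)] lcomodule_hom_lin[OF TP(3)]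
  note comp = tens_map_comp_right[OF mM]
  have sq1: "tens_map K M N' id f' (tens_map K M L' id jL s) = tens_map K M N' id jN (tens_map K M N id f s)"
    if s: "s \<in> carrier (tensor K M L)" for s
    unfolding comp[OF mL mL' mN' jl(1) fl' s] comp[OF mL mN mN' fl jl(2) s]
    by (rule tens_map_cong[OF mM mL mM mN' lin_id' lin_comp[OF fl jl(2)] _ _ s]) (simp_all add: f'_def kj)
  have sq2: "tens_map K M P' id g' (tens_map K M N' id jN s) = tens_map K M P' id jP (tens_map K M P id g s)"
    if s: "s \<in> carrier (tensor K M N)" for s
    unfolding comp[OF mN mN' mP' jl(2) gl' s] comp[OF mN mP mP' gl jl(3) s]
    by (rule tens_map_cong[OF mM mN mM mP' lin_id' lin_comp[OF gl jl(3)] _ _ s]) (simp_all add: g'_def kj)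
  note zP = lin_zero[OF tensor_module[OF mM mP] tensor_module[OF mM mP'] tens_map_lin[OF mM mP mM mP' lin_id' jl(3)]]
  note zP' = lin_zero[OF tensor_module[OF mM mP'] tensor_module[OF mM mP] tens_map_lin[OF mM mP' mM mP lin_id' kl(3)]]
  have ker: "tens_map K M N id f ` carrier (cotensor K C M L) =
      {t \<in> carrier (cotensor K C M N). tens_map K M P id g t = \<zero>\<^bsub>tensor K M P\<^esub>}"
    using ex by (simp add: exact_at_def a_kernel_def' cotensor_zero)
  have "tens_map K M N' id f' ` carrier (cotensor K C M L') =
      {t \<in> carrier (cotensor K C M N'). tens_map K M P' id g' t = \<zero>\<^bsub>tensor K M P'\<^esub>}" (is "?A = ?B")
  proof
    show "?A \<subseteq> ?B"
    proof
      fix t' assume "t' \<in> ?A"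
      then obtain s' where s': "s' \<in> carrier (cotensor K C M L')" "t' = tens_map K M N' id f' s'" by auto
      have s't: "s' \<in> carrier (tensor K M L')" using s'(1) by (simp add: cotensor_carrier)
      define s where "s = tens_map K M L id kL s'"
      have s: "s \<in> carrier (cotensor K C M L)"
        unfolding s_def by (rule cotensor_map_closed[OF M TL(1) L TL(3) s'(1)])
      have st: "s \<in> carrier (tensor K M L)" using s by (simp add: cotensor_carrier)
      have "s' = tens_map K M L' id jL s" unfolding s_def
        by (rule tens_map_inverse_right[OF mM mL' mL kl(1) jl(1) s't jk(1), symmetric])
      then have t': "t' = tens_map K M N' id jN (tens_map K M N id f s)"
        using s'(2) sq1[OF st] by simp
      have fs: "tens_map K M N id f s \<in> carrier (cotensor K C M N)"
          "tens_map K M P id g (tens_map K M N id f s) = \<zero>\<^bsub>tensor K M P\<^esub>"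
        using ker s by auto
      have fst: "tens_map K M N id f s \<in> carrier (tensor K M N)" using fs(1) by (simp add: cotensor_carrier)
      show "t' \<in> ?B"
        using cotensor_map_closed[OF M N TN(1) TN(2) fs(1)] sq2[OF fst] fs(2) zP by (simp add: t')
    qed
    show "?B \<subseteq> ?A"
    proof
      fix t' assume "t' \<in> ?B"
      then have t': "t' \<in> carrier (cotensor K C M N')" "tens_map K M P' id g' t' = \<zero>\<^bsub>tensor K M P'\<^esub>" by auto
      have t't: "t' \<in> carrier (tensor K M N')" using t'(1) by (simp add: cotensor_carrier)
      define t where "t = tens_map K M N id kN t'"
      have t: "t \<in> carrier (cotensor K C M N)"
        unfolding t_def by (rule cotensor_map_closed[OF M TN(1) N TN(3) t'(1)])
      have tt: "t \<in> carrier (tensor K M N)" using t by (simp add: cotensor_carrier)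
      have t'e: "t' = tens_map K M N' id jN t" unfolding t_def
        by (rule tens_map_inverse_right[OF mM mN' mN kl(2) jl(2) t't jk(2), symmetric])
      note gt = tens_map_closed[OF mM mN mM mP lin_id' gl tt]
      have "tens_map K M P id g t = tens_map K M P id kP (tens_map K M P' id jP (tens_map K M P id g t))"
        by (rule tens_map_inverse_right[OF mM mP mP' jl(3) kl(3) gt kj(3), symmetric])
      also have "\<dots> = \<zero>\<^bsub>tensor K M P\<^esub>" using sq2[OF tt] t'(2) zP' by (simp add: t'e)
      finally have "t \<in> {t \<in> carrier (cotensor K C M N). tens_map K M P id g t = \<zero>\<^bsub>tensor K M P\<^esub>}"
        using t by simp
      then obtain s where s: "s \<in> carrier (cotensor K C M L)" "t = tens_map K M N id f s"
        unfolding ker[symmetric] by auto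
      have st: "s \<in> carrier (tensor K M L)" using s by (simp add: cotensor_carrier)
      have "t' = tens_map K M N' id f' (tens_map K M L' id jL s)"
        using sq1[OF st] t'e s(2) by simp
      then show "t' \<in> ?A" using cotensor_map_closed[OF M L TL(1) TL(2) s(1)] by auto
    qed
  qed
  then have "exact_at (cotensor K C M L') (cotensor K C M N') (cotensor K C M P')
      (cotensor_map K M N' f') (cotensor_map K M P' g')"
    by (simp add: exact_at_def a_kernel_def' cotensor_zero)
  then have "exact_at L' N' P' f' g'"
    using fc TL(1) TN(1) TP(1) f' g' unfolding faithfully_coflat_def by metis
  then have ker': "f' ` carrier L' = {x \<in> carrier N'. g' x = \<zero>\<^bsub>P'\<^esub>}"
    by (simp add: exact_at_def a_kernel_def')
  have "f ` carrier L = {y \<in> carrier N. g y = \<zero>\<^bsub>P\<^esub>}" (is "?A = ?B")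
  proof
    show "?A \<subseteq> ?B"
    proof
      fix y assume "y \<in> ?A"
      then obtain x where x: "x \<in> carrier L" "y = f x" by auto
      have yc: "y \<in> carrier N" using lin_closed[OF fl] x by simp
      have "f' (jL x) \<in> f' ` carrier L'" using x(1) by (auto simp: TL(4))
      then have "g' (f' (jL x)) = \<zero>\<^bsub>P'\<^esub>" unfolding ker' by simp
      then have "jP (g y) = jP \<zero>\<^bsub>P\<^esub>" using x yc by (simp add: f'_def g'_def kj TP(5))
      then have "kP (jP (g y)) = kP (jP \<zero>\<^bsub>P\<^esub>)" by (rule arg_cong)
      then show "y \<in> ?B" using yc lin_closed[OF gl] mP by (simp add: kj)
    qed
    show "?B \<subseteq> ?A"
    proof
      fix y assume y: "y \<in> ?B"
      then have "jN y \<in> {x \<in> carrier N'. g' x = \<zero>\<^bsub>P'\<^esub>}" by (auto simp: TN(4) g'_def kj TP(5))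
      then obtain x' where x': "x' \<in> carrier L'" "jN y = f' x'" unfolding ker'[symmetric] by auto
      have kx: "kL x' \<in> carrier L" by (rule lin_closed[OF kl(1) x'(1)])
      have "kN (jN y) = kN (jN (f (kL x')))" using x'(2) by (simp add: f'_def)
      then show "y \<in> ?A" using y kx lin_closed[OF fl kx] by (simp add: kj)
    qed
  qed
  then show ?thesis by (simp add: exact_at_def a_kernel_def')
qed

section \<open>Modules over a Hopf algebra\<close>

lemma hopf_algebra_algebra: "hopf_algebra K H \<Longrightarrow> assoc_algebra K H"
  and hopf_algebra_coalgebra: "hopf_algebra K H \<Longrightarrow> coalgebra K H"
  and hopf_algebra_module: "hopf_algebra K H \<Longrightarrow> module K H"
  and hopf_algebra_ring: "hopf_algebra K H \<Longrightarrow> ring H"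
  by (simp_all add: hopf_algebra_def assoc_algebra_def)

definition action ::
  "('k, 'a, 'x) module_scheme \<Rightarrow> ('k, 'm, 'y) module_scheme \<Rightarrow> ('a \<Rightarrow> 'm \<Rightarrow> 'm) \<Rightarrow> bool"
  where "action A X act \<longleftrightarrow> bilin A X X act \<and>
    (\<forall>a\<in>carrier A. \<forall>b\<in>carrier A. \<forall>x\<in>carrier X. act (a \<otimes>\<^bsub>A\<^esub> b) x = act a (act b x)) \<and>
    (\<forall>x\<in>carrier X. act \<one>\<^bsub>A\<^esub> x = x)"

lemma action_bilin: "action A X act \<Longrightarrow> bilin A X X act"
  and action_mult: "action A X act \<Longrightarrow> a \<in> carrier A \<Longrightarrow> b \<in> carrier A \<Longrightarrow> x \<in> carrier X \<Longrightarrow>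
    act (a \<otimes>\<^bsub>A\<^esub> b) x = act a (act b x)"
  and action_one: "action A X act \<Longrightarrow> x \<in> carrier X \<Longrightarrow> act \<one>\<^bsub>A\<^esub> x = x"
  by (simp_all add: action_def)

text \<open>The map \<open>g \<otimes> x \<mapsto> g\<^sub>1 \<otimes> \<beta>(g\<^sub>2)x\<close>.  For \<open>X = H\<close> and \<open>\<beta> = id\<close> it is the canonical map of \<open>H\<close> as a Hopf-Galois
extension of the base field, and \<open>\<beta> = S\<close> gives its inverse.\<close>

definition twist ::
  "('k, 'a, 'x) coalgebra_scheme \<Rightarrow> ('k, 'm, 'y) module_scheme \<Rightarrow> ('a \<Rightarrow> 'm \<Rightarrow> 'm) \<Rightarrow> ('a \<Rightarrow> 'a)
    \<Rightarrow> ('k, 'a, 'm) tens \<Rightarrow> ('k, 'a, 'm) tens"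
  where "twist H X act \<beta> = tens_lift K (tensor K H X) (\<lambda>g x.
    tens_lift K (tensor K H X) (\<lambda>a b. tens K H X a (act (\<beta> b) x)) (comult H g))"

context
  fixes H :: "('k, 'a, 'x) hopf_scheme"
  assumes H: "hopf_algebra K H"
begin

lemma hopf_facts:
  shows "module K H" "assoc_algebra K H" "coalgebra K H" "ring H"
    "comult H \<in> lin H (tensor K H H)" "counit H \<in> lin H (base_module K)" "antipode H \<in> lin H H"
  using hopf_algebra_module[OF H] hopf_algebra_algebra[OF H] hopf_algebra_coalgebra[OF H]
    hopf_algebra_ring[OF H] coalgebra.comult_lin[OF hopf_algebra_coalgebra[OF H]]
    coalgebra.counit_lin[OF hopf_algebra_coalgebra[OF H]] hopf_algebra.antipode_lin[OF H] by auto

lemma comult_coassoc: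
  assumes U: "module K U" and F: "trilin H H H U F" and x: "x \<in> carrier H"
  shows "tens_lift K U (\<lambda>a b. tens_lift K U (\<lambda>c d. F c d b) (comult H a)) (comult H x) =
    tens_lift K U (\<lambda>a b. tens_lift K U (\<lambda>c d. F a c d) (comult H b)) (comult H x)"
  using tens_lift_coassoc[OF hopf_facts(1,1,1) U hopf_facts(1,1) F hopf_facts(5,5)
      lin_closed[OF hopf_facts(5) x] lin_closed[OF hopf_facts(5) x] coalgebra.coassoc[OF hopf_facts(3) x]] .

lemma twist_trilin:
  assumes X: "module K X" and act: "bilin H X X act" and \<beta>: "\<beta> \<in> lin H H"
  shows "trilin H H X (tensor K H X) (\<lambda>a b x. tens K H X a (act (\<beta> b) x))"
  by (intro trilinI lin_tens1 lin_tens2 lin_id lin_comp[OF \<beta> bilin1[OF act]] bilin2[OF act]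
      hopf_facts(1) X bilin_closed[OF act] lin_closed[OF \<beta>])

lemma twist_bilin:
  assumes X: "module K X" and act: "bilin H X X act" and \<beta>: "\<beta> \<in> lin H H"
  shows "bilin H X (tensor K H X) (\<lambda>g x.
    tens_lift K (tensor K H X) (\<lambda>a b. tens K H X a (act (\<beta> b) x)) (comult H g))"
  by (rule bilin_comp[OF trilin_bilin(1)[OF hopf_facts(1,1) X tensor_module[OF hopf_facts(1) X]
        twist_trilin[OF X act \<beta>]] hopf_facts(5) lin_id])

lemma twist_lin:
  assumes X: "module K X" and act: "bilin H X X act" and \<beta>: "\<beta> \<in> lin H H"
  shows "twist H X act \<beta> \<in> lin (tensor K H X) (tensor K H X)"
  unfolding twist_def
  by (rule tens_lift_lin[OF hopf_facts(1) X tensor_module[OF hopf_facts(1) X] twist_bilin[OF X act \<beta>]])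

lemma twist_tens:
  assumes X: "module K X" and act: "bilin H X X act" and \<beta>: "\<beta> \<in> lin H H"
    and "g \<in> carrier H" "x \<in> carrier X"
  shows "twist H X act \<beta> (tens K H X g x) =
    tens_lift K (tensor K H X) (\<lambda>a b. tens K H X a (act (\<beta> b) x)) (comult H g)"
  unfolding twist_def
  by (rule tens_lift_tens[OF hopf_facts(1) X tensor_module[OF hopf_facts(1) X] twist_bilin[OF X act \<beta>] assms(4,5)])

lemma counit_carrier: "x \<in> carrier H \<Longrightarrow> counit H x \<in> carrier K"
  using lin_closed[OF hopf_facts(6)] by (simp add: base_module_def)

text \<open>The composite is \<open>g \<otimes> x \<mapsto> g\<^sub>1 \<otimes> \<beta>(g\<^sub>2)\<gamma>(g\<^sub>3)x\<close> by coassociativity, and the hypothesis says that the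
convolution product of \<open>\<beta>\<close> and \<open>\<gamma>\<close> is trivial.\<close>

lemma twist_twist:
  assumes X: "module K X" and act: "action H X act" and \<beta>: "\<beta> \<in> lin H H" and \<gamma>: "\<gamma> \<in> lin H H"
    and conv: "\<And>h. h \<in> carrier H \<Longrightarrow>
      tens_lift K H (\<lambda>a b. \<beta> a \<otimes>\<^bsub>H\<^esub> \<gamma> b) (comult H h) = counit H h \<odot>\<^bsub>H\<^esub> \<one>\<^bsub>H\<^esub>"
    and t: "t \<in> carrier (tensor K H X)"
  shows "twist H X act \<beta> (twist H X act \<gamma> t) = t"
proof -
  interpret H: ring H by (rule hopf_facts(4))
  note mH = hopf_facts(1) and D = hopf_facts(5)
  note T = tensor_module[OF mH X]
  note ab = action_bilin[OF act] and mb = algebra_mult_bilin[OF hopf_facts(2)]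
  have "twist H X act \<beta> (twist H X act \<gamma> (tens K H X g x)) = tens K H X g x"
    if g: "g \<in> carrier H" and x: "x \<in> carrier X" for g x
  proof -
    note Dg = lin_closed[OF D g]
    let ?T = "tensor K H X"
    have b0: "bilin H H ?T (\<lambda>a b. tens K H X a (act (\<gamma> b) x))"
      by (rule trilinD(5)[OF twist_trilin[OF X ab \<gamma>] x])
    have F: "trilin H H H ?T (\<lambda>c d b. tens K H X c (act (\<beta> d) (act (\<gamma> b) x)))"
      by (intro trilinI lin_tens1 lin_tens2 lin_id lin_comp[OF \<beta> bilin1[OF ab]]
        lin_comp[OF lin_comp[OF \<gamma> bilin1[OF ab]] bilin2[OF ab]]
        mH X bilin_closed[OF ab] lin_closed[OF \<beta>] lin_closed[OF \<gamma>] x)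
    have e: "bilin H H ?T (\<lambda>a b. tens K H X (counit H b \<odot>\<^bsub>H\<^esub> a) x)"
      using bilin_lin[OF bilin_swap[OF bilin_comp[OF smult_bilin[OF mH] hopf_facts(6) lin_id]]
          lin_tens1[OF mH X lin_id x]] .
    have "twist H X act \<beta> (twist H X act \<gamma> (tens K H X g x)) =
        twist H X act \<beta> (tens_lift K ?T (\<lambda>a b. tens K H X a (act (\<gamma> b) x)) (comult H g))"
      by (simp only: twist_tens[OF X ab \<gamma> g x])
    also have "\<dots> = tens_lift K ?T (\<lambda>a b. twist H X act \<beta> (tens K H X a (act (\<gamma> b) x))) (comult H g)"
      by (rule lin_tens_lift[OF mH mH T T b0 twist_lin[OF X ab \<beta>] Dg])
    also have "\<dots> = tens_lift K ?T (\<lambda>a b. tens_lift K ?T (\<lambda>c d. tens K H X c (act (\<beta> d) (act (\<gamma> b) x)))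
        (comult H a)) (comult H g)"
      by (rule tens_lift_cong[OF mH mH T _ _ Dg, symmetric, OF bilin_lin[OF b0 twist_lin[OF X ab \<beta>]]])
         (rule twist_tens[OF X ab \<beta>, symmetric], assumption, intro bilin_closed[OF ab] lin_closed[OF \<gamma>] x)
    also have "\<dots> = tens_lift K ?T (\<lambda>a b. tens_lift K ?T (\<lambda>c d. tens K H X a (act (\<beta> c) (act (\<gamma> d) x)))
        (comult H b)) (comult H g)"
      by (rule comult_coassoc[OF T F g])
    also have "\<dots> = tens_lift K ?T (\<lambda>a b. tens K H X (counit H b \<odot>\<^bsub>H\<^esub> a) x) (comult H g)"
    proof (rule tens_lift_cong[OF mH mH T e _ Dg])
      fix a b assume a: "a \<in> carrier H" and b: "b \<in> carrier H"
      have l: "(\<lambda>y. tens K H X a (act y x)) \<in> lin H ?T"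
        by (intro lin_tens2 mH X a bilin1[OF ab] x)
      have bb: "bilin H H H (\<lambda>c d. \<beta> c \<otimes>\<^bsub>H\<^esub> \<gamma> d)" by (rule bilin_comp[OF mb \<beta> \<gamma>])
      have bt: "bilin H H ?T (\<lambda>c d. tens K H X a (act (\<beta> c \<otimes>\<^bsub>H\<^esub> \<gamma> d) x))" by (rule bilin_lin[OF bb l])
      have "tens_lift K ?T (\<lambda>c d. tens K H X a (act (\<beta> c) (act (\<gamma> d) x))) (comult H b) =
          tens_lift K ?T (\<lambda>c d. tens K H X a (act (\<beta> c \<otimes>\<^bsub>H\<^esub> \<gamma> d) x)) (comult H b)"
        by (rule tens_lift_cong[OF mH mH T bt _ lin_closed[OF D b]])
           (simp add: action_mult[OF act] lin_closed[OF \<beta>] lin_closed[OF \<gamma>] x)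
      also have "\<dots> = tens K H X a (act (tens_lift K H (\<lambda>c d. \<beta> c \<otimes>\<^bsub>H\<^esub> \<gamma> d) (comult H b)) x)"
        by (rule lin_tens_lift[OF mH mH mH T bb l lin_closed[OF D b], symmetric])
      also have "\<dots> = tens K H X a (act (counit H b \<odot>\<^bsub>H\<^esub> \<one>\<^bsub>H\<^esub>) x)" by (simp only: conv[OF b])
      also have "\<dots> = counit H b \<odot>\<^bsub>?T\<^esub> tens K H X a x"
        using lin_smult[OF l counit_carrier[OF b] H.one_closed] action_one[OF act x] by simp
      also have "\<dots> = tens K H X (counit H b \<odot>\<^bsub>H\<^esub> a) x"
        by (rule lin_smult[OF bilin1[OF tens_bilin[OF mH X] x] counit_carrier[OF b] a, symmetric])
      finally show "tens_lift K ?T (\<lambda>c d. tens K H X a (act (\<beta> c) (act (\<gamma> d) x))) (comult H b) =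
          tens K H X (counit H b \<odot>\<^bsub>H\<^esub> a) x" .
    qed
    also have "\<dots> = tens K H X (tens_lift K H (\<lambda>a b. counit H b \<odot>\<^bsub>H\<^esub> a) (comult H g)) x"
      by (rule lin_tens_lift[OF mH mH mH T bilin_swap[OF bilin_comp[OF smult_bilin[OF mH] hopf_facts(6) lin_id]]
            lin_tens1[OF mH X lin_id x] Dg, symmetric])
    also have "\<dots> = tens K H X g x"
      by (simp only: coalgebra.counit_right[OF hopf_facts(3) g])
    finally show ?thesis .
  qed
  then show ?thesis
    by (intro lin_tensor_eqI[OF mH X lin_comp[OF twist_lin[OF X ab \<gamma>] twist_lin[OF X ab \<beta>]] lin_id _ t])
qed

lemma twist_antipode:
  assumes X: "module K X" and act: "action H X act" and t: "t \<in> carrier (tensor K H X)"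
  shows "twist H X act (\<lambda>h. h) (twist H X act (antipode H) t) = t"
    and "twist H X act (antipode H) (twist H X act (\<lambda>h. h) t) = t"
  using twist_twist[OF X act lin_id hopf_facts(7) hopf_algebra.antipode_right[OF H] t]
    twist_twist[OF X act hopf_facts(7) lin_id hopf_algebra.antipode_left[OF H] t] by auto

text \<open>Used with \<open>f\<close> the coaction \<open>H \<rightarrow> L \<otimes> H\<close> and with \<open>f\<close> the counit; in this way the coproduct and the
counit of an antipode never have to be computed.\<close>

lemma twist_natural:
  assumes X: "module K X" and Y: "module K Y" and actX: "bilin H X X actX" and actY: "bilin H Y Y actY"
    and \<beta>: "\<beta> \<in> lin H H" and f: "f \<in> lin X Y"
    and eqv: "\<And>h x. h \<in> carrier H \<Longrightarrow> x \<in> carrier X \<Longrightarrow> f (actX h x) = actY h (f x)"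
    and t: "t \<in> carrier (tensor K H X)"
  shows "tens_map K H Y id f (twist H X actX \<beta> t) = twist H Y actY \<beta> (tens_map K H Y id f t)"
proof -
  note mH = hopf_facts(1) and D = hopf_facts(5)
  note TX = tensor_module[OF mH X] and TY = tensor_module[OF mH Y]
  note fl = tens_map_lin[OF mH X mH Y lin_id' f]
  note ft = tens_map_tens[OF mH X mH Y lin_id' f]
  have "tens_map K H Y id f (twist H X actX \<beta> (tens K H X g x)) =
      twist H Y actY \<beta> (tens_map K H Y id f (tens K H X g x))"
    if g: "g \<in> carrier H" and x: "x \<in> carrier X" for g x
  proof -
    note Dg = lin_closed[OF D g]
    have b0: "bilin H H (tensor K H X) (\<lambda>a b. tens K H X a (actX (\<beta> b) x))"
      by (rule trilinD(5)[OF twist_trilin[OF X actX \<beta>] x])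
    have b1: "bilin H H (tensor K H Y) (\<lambda>a b. tens K H Y a (actY (\<beta> b) (f x)))"
      by (rule trilinD(5)[OF twist_trilin[OF Y actY \<beta>] lin_closed[OF f x]])
    have "tens_map K H Y id f (twist H X actX \<beta> (tens K H X g x)) =
        tens_lift K (tensor K H Y) (\<lambda>a b. tens_map K H Y id f (tens K H X a (actX (\<beta> b) x))) (comult H g)"
      unfolding twist_tens[OF X actX \<beta> g x] by (rule lin_tens_lift[OF mH mH TX TY b0 fl Dg])
    also have "\<dots> = tens_lift K (tensor K H Y) (\<lambda>a b. tens K H Y a (actY (\<beta> b) (f x))) (comult H g)"
      by (rule tens_lift_cong[OF mH mH TY b1 _ Dg])
         (simp add: ft bilin_closed[OF actX] lin_closed[OF \<beta>] x eqv)
    also have "\<dots> = twist H Y actY \<beta> (tens_map K H Y id f (tens K H X g x))"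
      unfolding ft[OF g x] id_apply by (rule twist_tens[OF Y actY \<beta> g lin_closed[OF f x], symmetric])
    finally show ?thesis .
  qed
  then show ?thesis
    by (intro lin_tensor_eqI[OF mH X lin_comp[OF twist_lin[OF X actX \<beta>] fl]
          lin_comp[OF fl twist_lin[OF Y actY \<beta>]] _ t])
qed

end

section \<open>Records with the same underlying algebra\<close>

text \<open>Regarding a Hopf algebra as a comodule changes its record type.  The tensor product has the same type
in both readings, so that the two tensor products can be equal and not just isomorphic.\<close>

definition same_structure :: "('k, 'a, 'x) module_scheme \<Rightarrow> ('k, 'a, 'y) module_scheme \<Rightarrow> bool"
  where "same_structure V V' \<longleftrightarrow> carrier V = carrier V' \<and> mult V = mult V' \<and> one V = one V' \<and>
    zero V = zero V' \<and> add V = add V' \<and> smult V = smult V'"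

lemma same_structure_refl: "same_structure V V"
  by (simp add: same_structure_def)

lemma same_structure_tensor:
  assumes "same_structure V V'" "same_structure W W'"
  shows "tensor K V W = tensor K V' W'" and "tens K V W = tens K V' W'"
    and "tens_map K V W = tens_map K V' W'"
proof -
  show 1: "tens K V W = tens K V' W'"
    using assms by (intro ext) (simp add: tens_def tensor_rels_def tensor_gens_def same_structure_def)
  show 2: "tensor K V W = tensor K V' W'"
    using assms unfolding tensor_def 1
    by (simp add: tensor_space_def tensor_rels_def tensor_gens_def same_structure_def)
  show "tens_map K V W = tens_map K V' W'"
    by (intro ext) (simp add: tens_map_def 1 2)
qed

lemma same_structure_assoc:
  assumes "same_structure U U'" "same_structure V V'" "same_structure W W'"
  shows "tens_assoc K U V W = tens_assoc K U' V' W'"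
  unfolding tens_assoc_def same_structure_tensor[OF assms(2,3)]
    same_structure_tensor[OF assms(1) same_structure_refl] by simp

lemma same_structure_lift:
  assumes "same_structure U U'"
  shows "tens_lift K U = tens_lift K U'"
  using assms by (intro ext) (simp add: tens_lift_def finsum_def finprod_def same_structure_def)

lemma same_structure_lin:
  assumes "same_structure V V'" "same_structure W W'"
  shows "lin V W = lin V' W'"
  using assms by (simp add: lin_maps_def same_structure_def)

lemma same_structure_module: "same_structure V V' \<Longrightarrow> module K V \<longleftrightarrow> module K V'"
  by (rule module_cong_iff) (simp_all add: same_structure_def)

lemma tens_map_zero:
  assumes m: "module K V" "module K W" "module K W'" and t: "t \<in> carrier (tensor K V W)"
  shows "tens_map K V W' id (\<lambda>_. \<zero>\<^bsub>W'\<^esub>) t = \<zero>\<^bsub>tensor K V W'\<^esub>"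
proof -
  note z = lin_const_zero[OF m(3), where V = W]
  show ?thesis
    by (rule lin_tensor_eqI[OF m(1,2) tens_map_lin[OF m(1,2,1,3) lin_id' z]
          lin_const_zero[OF tensor_module[OF m(1,3)]] _ t])
       (simp add: tens_map_tens[OF m(1,2,1,3) lin_id' z] lin_zero[OF m(3) _ bilin2[OF tens_bilin]] m)
qed

section \<open>Transport of a Hopf algebra along a bijection\<close>

text \<open>On \<open>\<psi>(y)\<close> every axiom for \<open>Q\<close> is the image under \<open>\<psi>\<close>, \<open>\<psi> \<otimes> \<psi>\<close> or \<open>\<psi> \<otimes> (\<psi> \<otimes> \<psi>)\<close> of the axiom for \<open>L\<close> at \<open>y\<close>.\<close>

lemma hopf_transport:
  fixes L :: "('k, 'b, 'x) hopf_scheme" and Q :: "('k, 'q, 'y) hopf_scheme"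
  assumes L: "hopf_algebra K L" and mQ: "module K Q" and psi: "psi \<in> lin L Q"
    and bij: "bij_betw psi (carrier L) (carrier Q)" and one: "\<one>\<^bsub>Q\<^esub> = psi \<one>\<^bsub>L\<^esub>"
    and mult: "\<And>x y. x \<in> carrier L \<Longrightarrow> y \<in> carrier L \<Longrightarrow> psi x \<otimes>\<^bsub>Q\<^esub> psi y = psi (x \<otimes>\<^bsub>L\<^esub> y)"
    and com: "\<And>y. y \<in> carrier L \<Longrightarrow> comult Q (psi y) = tens_map K Q Q psi psi (comult L y)"
    and cou: "\<And>y. y \<in> carrier L \<Longrightarrow> counit Q (psi y) = counit L y"
    and ant: "\<And>y. y \<in> carrier L \<Longrightarrow> antipode Q (psi y) = psi (antipode L y)"
  shows "hopf_algebra K Q" and "inv_into (carrier L) psi \<in> hopf_iso K Q L"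
proof -
  interpret L: ring L by (rule hopf_facts(4)[OF L])
  note mL = hopf_facts(1)[OF L] and aL = hopf_facts(2)[OF L] and cL = hopf_facts(3)[OF L]
    and D = hopf_facts(5)[OF L] and E = hopf_facts(6)[OF L] and S = hopf_facts(7)[OF L]
  note LL = tensor_module[OF mL mL] and QQ = tensor_module[OF mQ mQ]
  let ?phi = "inv_into (carrier L) psi"
  have Q: "carrier Q = psi ` carrier L" using bij by (simp add: bij_betw_def)
  have inj: "inj_on psi (carrier L)" using bij by (simp add: bij_betw_def)
  have pp: "?phi (psi y) = y" if "y \<in> carrier L" for y using inj that by simp
  have qE: "\<exists>y\<in>carrier L. x = psi y" if "x \<in> carrier Q" for x using that Q by auto
  have psic: "psi y \<in> carrier Q" if "y \<in> carrier L" for y using that Q by auto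
  have phi: "?phi \<in> lin Q L"
  proof (rule linI)
    fix x assume "x \<in> carrier Q" then show "?phi x \<in> carrier L" using qE pp by force
  next
    fix x y assume "x \<in> carrier Q" "y \<in> carrier Q"
    then obtain a b where "a \<in> carrier L" "b \<in> carrier L" "x = psi a" "y = psi b" using qE by meson
    then show "?phi (x \<oplus>\<^bsub>Q\<^esub> y) = ?phi x \<oplus>\<^bsub>L\<^esub> ?phi y"
      by (simp add: lin_add[OF psi, symmetric] pp)
  next
    fix c x assume "c \<in> carrier K" "x \<in> carrier Q"
    moreover then obtain a where "a \<in> carrier L" "x = psi a" using qE by meson
    ultimately show "?phi (c \<odot>\<^bsub>Q\<^esub> x) = c \<odot>\<^bsub>L\<^esub> ?phi x"
      using mL by (simp add: lin_smult[OF psi, symmetric] pp)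
  qed
  note tp = tens_map_lin[OF mL mL mQ mQ psi psi]
  have rQ: "ring Q"
  proof (rule ringI)
    show "abelian_group Q" by (rule module_abelian_group[OF mQ])
    show "Group.monoid Q"
      by (rule monoidI) (use L.m_assoc in \<open>auto simp: Q one mult\<close>)
  qed (auto simp: Q mult lin_add[OF psi, symmetric] L.l_distr L.r_distr)
  have aQ: "assoc_algebra K Q"
    unfolding assoc_algebra_def assoc_algebra_axioms_def
    using field_axioms rQ mQ mL
    by (auto simp: Q mult lin_smult[OF psi, symmetric] assoc_algebra.smult_mult_left[OF aL]
      assoc_algebra.smult_mult_right[OF aL])
  have DQ: "comult Q \<in> lin Q (tensor K Q Q)"
    by (rule lin_cong[OF lin_comp[OF phi lin_comp[OF D tp]] mQ]) (auto simp: Q com pp)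
  have EQ: "counit Q \<in> lin Q (base_module K)"
    by (rule lin_cong[OF lin_comp[OF phi E] mQ]) (auto simp: Q cou pp)
  have SQ: "antipode Q \<in> lin Q Q"
    by (rule lin_cong[OF lin_comp[OF phi lin_comp[OF S psi]] mQ]) (auto simp: Q ant pp)
  have dQ: "comult Q (psi y) \<in> carrier (tensor K Q Q)" if "y \<in> carrier L" for y
    by (rule lin_closed[OF DQ psic[OF that]])
  have coass: "tens_assoc K Q Q Q (tens_map K (tensor K Q Q) Q (comult Q) id (comult Q (psi y))) =
      tens_map K Q (tensor K Q Q) id (comult Q) (comult Q (psi y))" if y: "y \<in> carrier L" for y
  proof -
    note Dy = lin_closed[OF D y]
    have 1: "tens_map K (tensor K Q Q) Q (comult Q) id (comult Q (psi y)) =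
        tens_map K (tensor K Q Q) Q (tens_map K Q Q psi psi) psi (tens_map K (tensor K L L) L (comult L) id (comult L y))"
      unfolding com[OF y] tens_map_comp[OF mL mL mQ mQ QQ mQ psi psi DQ lin_id' Dy]
        tens_map_comp[OF mL mL LL mL QQ mQ D lin_id' tp psi Dy] id_apply
      by (rule tens_map_cong[OF mL mL QQ mQ lin_comp[OF D tp] psi _ _ Dy]) (simp_all add: com)
    have 2: "tens_map K Q (tensor K Q Q) id (comult Q) (comult Q (psi y)) =
        tens_map K Q (tensor K Q Q) psi (tens_map K Q Q psi psi) (tens_map K L (tensor K L L) id (comult L) (comult L y))"
      unfolding com[OF y] tens_map_comp[OF mL mL mQ mQ mQ QQ psi psi lin_id' DQ Dy]
        tens_map_comp[OF mL mL mL LL mQ QQ lin_id' D psi tp Dy] id_apply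
      by (rule tens_map_cong[OF mL mL mQ QQ psi lin_comp[OF D tp] _ _ Dy]) (simp_all add: com)
    show ?thesis
      unfolding 1 2 coalgebra.coassoc[OF cL y, symmetric]
      by (rule tens_assoc_natural[OF mL mL mL mQ mQ mQ psi psi psi tens_map_closed[OF mL mL LL mL D lin_id' Dy]])
  qed
  have lift: "tens_lift K Q b' (comult Q (psi y)) = psi (tens_lift K L b (comult L y))"
    if b: "bilin L L L b" and b': "bilin Q Q Q b'" and y: "y \<in> carrier L"
      and bb: "\<And>u v. u \<in> carrier L \<Longrightarrow> v \<in> carrier L \<Longrightarrow> b' (psi u) (psi v) = psi (b u v)" for b b' y
  proof -
    note Dy = lin_closed[OF D y]
    show ?thesis
      unfolding com[OF y] tens_lift_tens_map[OF mL mL mQ mQ mQ psi psi b' Dy]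
        lin_tens_lift[OF mL mL mL mQ b psi Dy]
      by (rule tens_lift_cong[OF mL mL mQ bilin_lin[OF b psi] bb Dy])
  qed
  have ec: "counit L y \<in> carrier K" if "y \<in> carrier L" for y by (rule counit_carrier[OF L that])
  have sm: "bilin V V V (\<lambda>a b. h a \<odot>\<^bsub>V\<^esub> b)" "bilin V V V (\<lambda>a b. h b \<odot>\<^bsub>V\<^esub> a)"
    if "module K V" "h \<in> lin V (base_module K)" for h and V :: "('k, 'v, 'z1) module_scheme"
    by (rule bilin_comp[OF smult_bilin[OF that(1)] that(2) lin_id])
       (rule bilin_swap[OF bilin_comp[OF smult_bilin[OF that(1)] that(2) lin_id]])
  have cu: "tens_lift K Q (\<lambda>a b. counit Q a \<odot>\<^bsub>Q\<^esub> b) (comult Q (psi y)) = psi y"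
      "tens_lift K Q (\<lambda>a b. counit Q b \<odot>\<^bsub>Q\<^esub> a) (comult Q (psi y)) = psi y" if y: "y \<in> carrier L" for y
    using lift[OF sm(1)[OF mL E] sm(1)[OF mQ EQ] y] lift[OF sm(2)[OF mL E] sm(2)[OF mQ EQ] y]
      coalgebra.counit_left[OF cL y] coalgebra.counit_right[OF cL y]
    by (simp_all add: cou lin_smult[OF psi] ec)
  have cQ: "coalgebra K Q"
    unfolding coalgebra_def coalgebra_axioms_def
    using field_axioms mQ DQ EQ coass cu by (auto simp: Q)
  note mbL = algebra_mult_bilin[OF aL] and mbQ = algebra_mult_bilin[OF aQ]
  have anti: "tens_lift K Q (\<lambda>a b. antipode Q a \<otimes>\<^bsub>Q\<^esub> b) (comult Q (psi y)) = counit Q (psi y) \<odot>\<^bsub>Q\<^esub> \<one>\<^bsub>Q\<^esub>"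
      "tens_lift K Q (\<lambda>a b. a \<otimes>\<^bsub>Q\<^esub> antipode Q b) (comult Q (psi y)) = counit Q (psi y) \<odot>\<^bsub>Q\<^esub> \<one>\<^bsub>Q\<^esub>"
    if y: "y \<in> carrier L" for y
    using lift[OF bilin_comp[OF mbL S lin_id] bilin_comp[OF mbQ SQ lin_id] y]
      lift[OF bilin_comp[OF mbL lin_id S] bilin_comp[OF mbQ lin_id SQ] y]
      hopf_algebra.antipode_left[OF L y] hopf_algebra.antipode_right[OF L y]
    by (simp_all add: ant mult lin_closed[OF S] cou y one lin_smult[OF psi] ec)
  have ch: "comult Q \<in> ring_hom Q (tensor K Q Q)"
  proof (rule ring_hom_memI)
    fix x y assume "x \<in> carrier Q" "y \<in> carrier Q"
    then obtain a b where *: "a \<in> carrier L" "b \<in> carrier L" "x = psi a" "y = psi b" using qE by meson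
    show "comult Q x \<in> carrier (tensor K Q Q)" using dQ * by simp
    show "comult Q (x \<oplus>\<^bsub>Q\<^esub> y) = comult Q x \<oplus>\<^bsub>tensor K Q Q\<^esub> comult Q y"
      using * psic by (simp add: lin_add[OF DQ])
    show "comult Q (x \<otimes>\<^bsub>Q\<^esub> y) = comult Q x \<otimes>\<^bsub>tensor K Q Q\<^esub> comult Q y"
      using tens_map_mult[OF aL aL aQ aQ psi psi mult[symmetric] mult[symmetric] lin_closed[OF D] lin_closed[OF D]] *
      by (simp add: mult com ring_hom_mult[OF hopf_algebra.comult_hom[OF L]])
  next
    show "comult Q \<one>\<^bsub>Q\<^esub> = \<one>\<^bsub>tensor K Q Q\<^esub>"
      by (simp add: one com ring_hom_one[OF hopf_algebra.comult_hom[OF L]] tensor_one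
        tens_map_tens[OF mL mL mQ mQ psi psi])
  qed
  have eh: "counit Q \<in> ring_hom Q K"
  proof (rule ring_hom_memI)
    fix x y assume "x \<in> carrier Q" "y \<in> carrier Q"
    then obtain a b where *: "a \<in> carrier L" "b \<in> carrier L" "x = psi a" "y = psi b" using qE by meson
    note h = hopf_algebra.counit_hom[OF L]
    show "counit Q x \<in> carrier K" using * by (simp add: cou ec)
    show "counit Q (x \<oplus>\<^bsub>Q\<^esub> y) = counit Q x \<oplus> counit Q y"
      using * by (simp add: lin_add[OF psi, symmetric] cou ring_hom_add[OF h])
    show "counit Q (x \<otimes>\<^bsub>Q\<^esub> y) = counit Q x \<otimes> counit Q y"
      using * by (simp add: mult cou ring_hom_mult[OF h])
  next
    show "counit Q \<one>\<^bsub>Q\<^esub> = \<one>" by (simp add: one cou ring_hom_one[OF hopf_algebra.counit_hom[OF L]])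
  qed
  show HQ: "hopf_algebra K Q"
    unfolding hopf_algebra_def hopf_algebra_axioms_def
    using aQ cQ ch eh SQ anti by (auto simp: Q)
  have "?phi \<in> ring_hom Q L"
    by (rule ring_hom_memI) (auto simp: Q mult one pp lin_add[OF psi, symmetric])
  moreover have "comult L (?phi x) = tens_map K L L ?phi ?phi (comult Q x) \<and> counit L (?phi x) = counit Q x \<and>
      antipode L (?phi x) = ?phi (antipode Q x)" if "x \<in> carrier Q" for x
  proof -
    obtain y where y: "y \<in> carrier L" "x = psi y" using qE[OF \<open>x \<in> carrier Q\<close>] by auto
    note Dy = lin_closed[OF D y(1)]
    have "tens_map K L L ?phi ?phi (comult Q x) = comult L y"
      unfolding y(2) com[OF y(1)] tens_map_comp[OF mL mL mQ mQ mL mL psi psi phi phi Dy]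
      by (rule tens_map_id[OF mL mL Dy pp pp])
    then show ?thesis using y by (simp add: pp cou ant lin_closed[OF S])
  qed
  moreover have "bij_betw ?phi (carrier Q) (carrier L)"
    by (rule bij_betw_inv_into[OF bij])
  ultimately show "?phi \<in> hopf_iso K Q L"
    using phi by (simp add: hopf_iso_def hopf_hom_def)
qed

lemma the_elem_image_const:
  assumes "x \<in> A" "\<And>a. a \<in> A \<Longrightarrow> f a = c"
  shows "the_elem (f ` A) = c"
proof -
  have "f ` A = {c}" using assms by force
  then show ?thesis by simp
qed

end

section \<open>Homomorphisms of Hopf algebras\<close>

locale hopf_map = base_field K
  for K :: "('k, 'z) ring_scheme" (structure) +
  fixes H :: "('k, 'h) hopf" and L :: "('k, 'b) hopf" and \<pi> :: "'h \<Rightarrow> 'b"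
  assumes H: "hopf_algebra K H" and L: "hopf_algebra K L" and \<pi>: "\<pi> \<in> hopf_hom K H L"
begin

lemmas mH = hopf_facts(1)[OF H] and aH = hopf_facts(2)[OF H] and cH = hopf_facts(3)[OF H]
  and rH = hopf_facts(4)[OF H] and D = hopf_facts(5)[OF H] and E = hopf_facts(6)[OF H] and S = hopf_facts(7)[OF H]
lemmas mL = hopf_facts(1)[OF L] and aL = hopf_facts(2)[OF L] and cL = hopf_facts(3)[OF L]
  and rL = hopf_facts(4)[OF L] and DL = hopf_facts(5)[OF L] and EL = hopf_facts(6)[OF L]

lemma pi_lin: "\<pi> \<in> lin H L"
  and pi_ring_hom: "\<pi> \<in> ring_hom H L"
  and pi_comult: "x \<in> carrier H \<Longrightarrow> comult L (\<pi> x) = tens_map K L L \<pi> \<pi> (comult H x)"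
  and pi_counit: "x \<in> carrier H \<Longrightarrow> counit L (\<pi> x) = counit H x"
  and pi_antipode: "x \<in> carrier H \<Longrightarrow> antipode L (\<pi> x) = \<pi> (antipode H x)"
  using \<pi> by (auto simp: hopf_hom_def)

lemma pi_mult: "x \<in> carrier H \<Longrightarrow> y \<in> carrier H \<Longrightarrow> \<pi> (x \<otimes>\<^bsub>H\<^esub> y) = \<pi> x \<otimes>\<^bsub>L\<^esub> \<pi> y"
  and pi_one: "\<pi> \<one>\<^bsub>H\<^esub> = \<one>\<^bsub>L\<^esub>"
  using ring_hom_mult[OF pi_ring_hom] ring_hom_one[OF pi_ring_hom] by auto

lemma units_closed: "\<one>\<^bsub>H\<^esub> \<in> carrier H" "\<one>\<^bsub>L\<^esub> \<in> carrier L"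
  using ring.ring_simprules(6)[OF rH] ring.ring_simprules(6)[OF rL] by auto

text \<open>The coaction denoted by \<open>\<lambda>\<close> in the explanations.\<close>

definition coactL :: "'h \<Rightarrow> ('k, 'b, 'h) tens"
  where "coactL h = tens_map K L H \<pi> id (comult H h)"

definition coactR :: "'h \<Rightarrow> ('k, 'h, 'b) tens"
  where "coactR h = tens_map K H L id \<pi> (comult H h)"

definition unit_tens :: "'h \<Rightarrow> ('k, 'b, 'h) tens"
  where "unit_tens h = tens K L H \<one>\<^bsub>L\<^esub> h"

lemma coactL_lin: "coactL \<in> lin H (tensor K L H)"
  unfolding coactL_def[abs_def] by (rule lin_comp[OF D tens_map_lin[OF mH mH mL mH pi_lin lin_id']])

lemma coactR_lin: "coactR \<in> lin H (tensor K H L)"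
  unfolding coactR_def[abs_def] by (rule lin_comp[OF D tens_map_lin[OF mH mH mH mL lin_id' pi_lin]])

lemma unit_tens_lin: "unit_tens \<in> lin H (tensor K L H)"
  unfolding unit_tens_def[abs_def] by (rule lin_tens2[OF mL mH lin_id units_closed(2)])

lemma coactL_mult:
  assumes "x \<in> carrier H" "y \<in> carrier H"
  shows "coactL (x \<otimes>\<^bsub>H\<^esub> y) = coactL x \<otimes>\<^bsub>tensor K L H\<^esub> coactL y"
  unfolding coactL_def ring_hom_mult[OF hopf_algebra.comult_hom[OF H] assms]
  by (rule tens_map_mult[OF aH aH aL aH pi_lin lin_id' pi_mult _ lin_closed[OF D] lin_closed[OF D]])
     (simp_all add: assms)

lemma coactL_one: "coactL \<one>\<^bsub>H\<^esub> = \<one>\<^bsub>tensor K L H\<^esub>"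
  unfolding coactL_def ring_hom_one[OF hopf_algebra.comult_hom[OF H]] tensor_one
  by (simp add: tens_map_tens[OF mH mH mL mH pi_lin lin_id'] units_closed pi_one)

text \<open>The algebra map \<open>\<lambda>\<close> makes \<open>L \<otimes> H\<close> an \<open>H\<close>-module for which \<open>\<lambda>\<close> is linear.\<close>

abbreviation diag_act :: "'h \<Rightarrow> ('k, 'b, 'h) tens \<Rightarrow> ('k, 'b, 'h) tens"
  where "diag_act g x \<equiv> coactL g \<otimes>\<^bsub>tensor K L H\<^esub> x"

lemma action_mult_self: "action H H (\<lambda>g x. g \<otimes>\<^bsub>H\<^esub> x)"
proof -
  interpret H: ring H by (rule rH)
  show ?thesis using algebra_mult_bilin[OF aH] by (auto simp: action_def H.m_assoc)
qed

lemma action_diag: "action H (tensor K L H) diag_act"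
  unfolding action_def
  using bilin_comp[OF tensor_mult_bilin[OF aL aH] coactL_lin lin_id]
    tensor_mult_assoc[OF aL aH lin_closed[OF coactL_lin] lin_closed[OF coactL_lin]] tensor_l_one[OF aL aH]
  by (simp add: coactL_mult coactL_one)

lemma action_counit: "action H (base_module K) (\<lambda>h c. counit H h \<otimes> c)"
proof -
  have b: "bilin H (base_module K) (base_module K) (\<lambda>h c. counit H h \<otimes> c)"
    using bilin_comp[OF smult_bilin[OF base_module_module] E lin_id] by (simp add: base_module_def)
  show ?thesis
    unfolding action_def using b counit_carrier[OF H]
    by (auto simp: base_module_def m_assoc ring_hom_mult[OF hopf_algebra.counit_hom[OF H]]
        ring_hom_one[OF hopf_algebra.counit_hom[OF H]])
qed

text \<open>In Sweedler notation, \<open>b(1 \<otimes> x) = \<pi>(b\<^sub>1) \<otimes> b\<^sub>2 x\<close>.\<close>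

lemma diag_act_unit:
  assumes b: "b \<in> carrier H" and x: "x \<in> carrier H"
  shows "diag_act b (unit_tens x) =
    tens_lift K (tensor K L H) (\<lambda>c d. tens K L H (\<pi> c) (d \<otimes>\<^bsub>H\<^esub> x)) (comult H b)"
proof -
  interpret H: ring H by (rule rH)
  interpret L: ring L by (rule rL)
  note T = tensor_module[OF mL mH]
  have u: "unit_tens x \<in> carrier (tensor K L H)" by (rule lin_closed[OF unit_tens_lin x])
  have b0: "bilin H H (tensor K L H) (\<lambda>c d. tens K L H (\<pi> c) (id d))"
    by (rule bilin_tens[OF mL mH pi_lin lin_id'])
  have b1: "bilin H H (tensor K L H) (\<lambda>c d. tens K L H (\<pi> c) (d \<otimes>\<^bsub>H\<^esub> x))"
    by (rule bilin_tens[OF mL mH pi_lin bilin1[OF algebra_mult_bilin[OF aH] x]])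
  have "diag_act b (unit_tens x) =
      tens_lift K (tensor K L H) (\<lambda>c d. tens K L H (\<pi> c) (id d) \<otimes>\<^bsub>tensor K L H\<^esub> unit_tens x) (comult H b)"
    unfolding coactL_def tens_map_def
    by (rule lin_tens_lift[OF mH mH T T b0 bilin1[OF tensor_mult_bilin[OF aL aH] u] lin_closed[OF D b]])
  also have "\<dots> = tens_lift K (tensor K L H) (\<lambda>c d. tens K L H (\<pi> c) (d \<otimes>\<^bsub>H\<^esub> x)) (comult H b)"
    by (rule tens_lift_cong[OF mH mH T b1 _ lin_closed[OF D b]])
       (simp add: unit_tens_def tensor_mult_tens[OF aL aH] lin_closed[OF pi_lin] x)
  finally show ?thesis .
qed

text \<open>Both sides send \<open>g \<otimes> x\<close> to \<open>g\<^sub>1 \<otimes> (\<pi>(g\<^sub>2) \<otimes> g\<^sub>3 x)\<close>.  The twist of \<open>L \<otimes> H\<close> thus relates the condition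
\<open>\<lambda>(x) = 1 \<otimes> x\<close> of coinvariance to the right coaction in the cotensor condition.\<close>

lemma twist_unit_tens:
  assumes t: "t \<in> carrier (tensor K H H)"
  shows "twist H (tensor K L H) diag_act (\<lambda>h. h) (tens_map K H (tensor K L H) id unit_tens t) =
    tens_assoc K H L H (tens_map K (tensor K H L) H coactR id (twist H H (\<lambda>g x. g \<otimes>\<^bsub>H\<^esub> x) (\<lambda>h. h) t))"
proof -
  interpret H: ring H by (rule rH)
  let ?Y = "tensor K L H" and ?HL = "tensor K H L"
  note Y = tensor_module[OF mL mH] and HL = tensor_module[OF mH mL] and HH = tensor_module[OF mH mH]
  note U = tensor_module[OF mH Y]
  note aY = action_bilin[OF action_diag] and aS = action_bilin[OF action_mult_self]
  note ul = tens_map_lin[OF mH mH mH Y lin_id' unit_tens_lin]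
  note rl = tens_map_lin[OF mH mH HL mH coactR_lin lin_id']
  note al = tens_assoc_lin[OF mH mL mH]
  note ml = bilin1[OF algebra_mult_bilin[OF aH]]
  have "twist H ?Y diag_act (\<lambda>h. h) (tens_map K H ?Y id unit_tens (tens K H H g x)) =
    tens_assoc K H L H (tens_map K ?HL H coactR id (twist H H (\<lambda>g x. g \<otimes>\<^bsub>H\<^esub> x) (\<lambda>h. h) (tens K H H g x)))"
    if g: "g \<in> carrier H" and x: "x \<in> carrier H" for g x
  proof -
    note Dg = lin_closed[OF D g]
    define F where "F a c d = tens K H ?Y a (tens K L H (\<pi> c) (d \<otimes>\<^bsub>H\<^esub> x))" for a c d
    have F: "trilin H H H (tensor K H ?Y) F" unfolding F_def[abs_def]
      by (intro trilinI lin_tens1[OF mH Y lin_id] lin_tens2[OF mH Y] lin_tens1[OF mL mH pi_lin]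
          lin_tens2[OF mL mH] ml x tens_closed[OF mL mH] lin_closed[OF pi_lin] H.m_closed)
    note FB = trilin_bilin[OF mH mH mH U F]
    have "twist H ?Y diag_act (\<lambda>h. h) (tens_map K H ?Y id unit_tens (tens K H H g x)) =
        tens_lift K (tensor K H ?Y) (\<lambda>a b. tens K H ?Y a (diag_act b (unit_tens x))) (comult H g)"
      unfolding tens_map_tens[OF mH mH mH Y lin_id' unit_tens_lin g x] id_apply
      by (rule twist_tens[OF H Y aY lin_id g lin_closed[OF unit_tens_lin x]])
    also have "\<dots> = tens_lift K (tensor K H ?Y) (\<lambda>a b. tens_lift K (tensor K H ?Y) (\<lambda>c d. F a c d) (comult H b)) (comult H g)"
    proof (rule tens_lift_cong[OF mH mH U bilin_comp[OF FB(2) lin_id D] _ Dg])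
      fix a b assume a: "a \<in> carrier H" and b: "b \<in> carrier H"
      have b1: "bilin H H ?Y (\<lambda>c d. tens K L H (\<pi> c) (d \<otimes>\<^bsub>H\<^esub> x))"
        by (rule bilin_tens[OF mL mH pi_lin ml[OF x]])
      show "tens K H ?Y a (diag_act b (unit_tens x)) = tens_lift K (tensor K H ?Y) (\<lambda>c d. F a c d) (comult H b)"
        unfolding diag_act_unit[OF b x] F_def
        by (rule lin_tens_lift[OF mH mH Y U b1 lin_tens2[OF mH Y lin_id a] lin_closed[OF D b]])
    qed
    also have "\<dots> = tens_lift K (tensor K H ?Y) (\<lambda>a b. tens_lift K (tensor K H ?Y) (\<lambda>c d. F c d b) (comult H a)) (comult H g)"
      by (rule comult_coassoc[OF H U F g, symmetric])
    also have "\<dots> = tens_lift K (tensor K H ?Y) (\<lambda>a b. tens_assoc K H L H (tens_map K ?HL H coactR id (tens K H H a (b \<otimes>\<^bsub>H\<^esub> x)))) (comult H g)"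
    proof (rule tens_lift_cong[OF mH mH U _ _ Dg])
      show "bilin H H (tensor K H ?Y) (\<lambda>a b. tens_assoc K H L H (tens_map K ?HL H coactR id (tens K H H a (b \<otimes>\<^bsub>H\<^esub> x))))"
        by (intro bilin_lin[OF bilin_tens[OF mH mH lin_id ml[OF x]] lin_comp[OF rl al]])
      fix a b assume a: "a \<in> carrier H" and b: "b \<in> carrier H"
      have bx: "b \<otimes>\<^bsub>H\<^esub> x \<in> carrier H" using b x by simp
      have b2: "bilin H L (tensor K H ?Y) (\<lambda>u v. tens K H ?Y u (tens K L H v (b \<otimes>\<^bsub>H\<^esub> x)))"
        by (rule trilinD(5)[OF tens_assoc_trilin[OF mH mL mH] bx])
      have "tens_assoc K H L H (tens_map K ?HL H coactR id (tens K H H a (b \<otimes>\<^bsub>H\<^esub> x))) =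
          tens_lift K (tensor K H ?Y) (\<lambda>u v. tens K H ?Y u (tens K L H v (b \<otimes>\<^bsub>H\<^esub> x))) (coactR a)"
        unfolding tens_map_tens[OF mH mH HL mH coactR_lin lin_id' a bx] id_apply
        by (rule tens_assoc_tens[OF mH mL mH lin_closed[OF coactR_lin a] bx])
      also have "\<dots> = tens_lift K (tensor K H ?Y) (\<lambda>c d. F c d b) (comult H a)"
        unfolding coactR_def F_def
        using tens_lift_tens_map[OF mH mH mH mL U lin_id' pi_lin b2 lin_closed[OF D a]] by simp
      finally show "tens_lift K (tensor K H ?Y) (\<lambda>c d. F c d b) (comult H a) =
        tens_assoc K H L H (tens_map K ?HL H coactR id (tens K H H a (b \<otimes>\<^bsub>H\<^esub> x)))" by simp
    qed
    also have "\<dots> = tens_assoc K H L H (tens_map K ?HL H coactR id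
        (tens_lift K (tensor K H H) (\<lambda>a b. tens K H H a (b \<otimes>\<^bsub>H\<^esub> x)) (comult H g)))"
      by (rule lin_tens_lift[OF mH mH HH U bilin_tens[OF mH mH lin_id ml[OF x]] lin_comp[OF rl al] Dg, symmetric])
    also have "\<dots> = tens_assoc K H L H (tens_map K ?HL H coactR id (twist H H (\<lambda>g x. g \<otimes>\<^bsub>H\<^esub> x) (\<lambda>h. h) (tens K H H g x)))"
      by (simp only: twist_tens[OF H mH aS lin_id g x])
    finally show ?thesis .
  qed
  then show ?thesis
    by (intro lin_tensor_eqI[OF mH mH lin_comp[OF ul twist_lin[OF H Y aY lin_id]]
          lin_comp[OF twist_lin[OF H mH aS lin_id] lin_comp[OF rl al]] _ t])
qed

definition coinv_plus :: "'h set"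
  where "coinv_plus = augmentation_part K H (left_coinvariants K H L \<pi>)"

text \<open>This is \<open>HA\<^sup>+\<close>, a left ideal.\<close>

definition coinv_ideal :: "'h set"
  where "coinv_ideal = ideal_prod H (carrier H) coinv_plus"

lemma coinv_plus_iff:
  "x \<in> coinv_plus \<longleftrightarrow> x \<in> carrier H \<and> coactL x = unit_tens x \<and> counit H x = \<zero>"
  by (auto simp: coinv_plus_def augmentation_part_def left_coinvariants_def coactL_def unit_tens_def)

text \<open>With the hypothesis on \<open>p\<close>, which is to be a projection onto \<open>HA\<^sup>+\<close>, the conclusion says that
\<open>t\<close> lies in \<open>H \<otimes> HA\<^sup>+\<close>.  The element \<open>u = g\<^sub>1 \<otimes> S(g\<^sub>2)x\<close> obtained from \<open>t = g \<otimes> x\<close> satisfies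
\<open>(id \<otimes> \<lambda>)(u) = (id \<otimes> (1 \<otimes> -))(u)\<close> because both sides are the twist by the antipode of the element of
\<open>H \<otimes> (L \<otimes> H)\<close> expressed in two ways by the cotensor condition, and \<open>(id \<otimes> \<epsilon>)(u) = 0\<close> because \<open>\<epsilon>\<close> factors
through \<open>\<pi>\<close>.  Hence \<open>u\<close> lies in \<open>H \<otimes> A\<^sup>+\<close>.\<close>

lemma cotensor_kernel:
  assumes t: "t \<in> carrier (tensor K H H)"
    and cot: "tens_assoc K H L H (tens_map K (tensor K H L) H coactR id t) = tens_map K H (tensor K L H) id coactL t"
    and ker: "tens_map K H L id \<pi> t = \<zero>\<^bsub>tensor K H L\<^esub>"
    and p: "p \<in> lin H H" and pI: "\<And>x. x \<in> coinv_ideal \<Longrightarrow> p x = x"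
  shows "tens_map K H H id p t = t"
proof -
  let ?Y = "tensor K L H" and ?B = "base_module K"
  let ?mul = "\<lambda>g x. g \<otimes>\<^bsub>H\<^esub> x"
  note Y = tensor_module[OF mL mH] and HH = tensor_module[OF mH mH] and HL = tensor_module[OF mH mL]
    and B = base_module_module
  note aY = action_bilin[OF action_diag] and aS = action_bilin[OF action_mult_self]
    and aB = action_bilin[OF action_counit]
  (* u is the image of t under g (x) x |-> g_1 (x) S(g_2)x *)
  define u where "u = twist H H ?mul (antipode H) t"
  have u: "u \<in> carrier (tensor K H H)" unfolding u_def by (rule lin_closed[OF twist_lin[OF H mH aS S] t])
  have tu: "twist H H ?mul (\<lambda>h. h) u = t" unfolding u_def by (rule twist_antipode(1)[OF H mH action_mult_self t])
  have ju: "tens_map K H ?Y id unit_tens u \<in> carrier (tensor K H ?Y)"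
    by (rule tens_map_closed[OF mH mH mH Y lin_id' unit_tens_lin u])
  have "tens_map K H ?Y id coactL u = twist H ?Y diag_act (antipode H) (tens_map K H ?Y id coactL t)"
    unfolding u_def by (rule twist_natural[where actX = ?mul and actY = diag_act and f = coactL,
        OF H mH Y aS aY S coactL_lin coactL_mult t])
  also have "\<dots> = twist H ?Y diag_act (antipode H) (twist H ?Y diag_act (\<lambda>h. h) (tens_map K H ?Y id unit_tens u))"
    unfolding twist_unit_tens[OF u] tu cot ..
  also have "\<dots> = tens_map K H ?Y id unit_tens u"
    by (rule twist_antipode(2)[OF H Y action_diag ju])
  finally have lu: "tens_map K H ?Y id coactL u = tens_map K H ?Y id unit_tens u" .
  obtain r1 where r1: "r1 \<in> lin H H" "\<And>v. v \<in> carrier H \<Longrightarrow> coactL (r1 v) = unit_tens (r1 v)"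
      "tens_map K H H id r1 u = u"
    using tensor_equalizer[OF mH mH Y coactL_lin unit_tens_lin u lu] by blast
  have "tens_map K H ?B id (counit H) t = tens_map K H ?B id (counit L) (tens_map K H L id \<pi> t)"
    unfolding tens_map_comp_right[OF mH mH mL B pi_lin EL t]
    by (rule tens_map_cong[OF mH mH mH B lin_id' E _ _ t, symmetric]) (simp_all add: pi_counit)
  also have "\<dots> = \<zero>\<^bsub>tensor K H ?B\<^esub>"
    unfolding ker by (rule lin_zero[OF HL tensor_module[OF mH B] tens_map_lin[OF mH mL mH B lin_id' EL]])
  finally have et: "tens_map K H ?B id (counit H) t = \<zero>\<^bsub>tensor K H ?B\<^esub>" .
  have "tens_map K H ?B id (counit H) u =
      twist H ?B (\<lambda>h c. counit H h \<otimes> c) (antipode H) (tens_map K H ?B id (counit H) t)"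
    unfolding u_def
    by (rule twist_natural[where actX = ?mul and actY = "\<lambda>h c. counit H h \<otimes> c" and f = "counit H",
        OF H mH B aS aB S E ring_hom_mult[OF hopf_algebra.counit_hom[OF H]] t])
  also have "\<dots> = \<zero>\<^bsub>tensor K H ?B\<^esub>"
    unfolding et
    by (rule lin_zero[OF tensor_module[OF mH B] tensor_module[OF mH B] twist_lin[OF H B aB S]])
  finally have eu: "tens_map K H ?B id (counit H) u = \<zero>\<^bsub>tensor K H ?B\<^esub>" .
  have "tens_map K H ?B id (\<lambda>v. counit H (r1 v)) u = \<zero>\<^bsub>tensor K H ?B\<^esub>"
    using tens_map_comp_right[OF mH mH mH B r1(1) E u] r1(3) eu by simp
  then obtain r2 where r2: "r2 \<in> lin H H" "\<And>v. v \<in> carrier H \<Longrightarrow> counit H (r1 (r2 v)) = \<zero>\<^bsub>?B\<^esub>"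
      "tens_map K H H id r2 u = u"
    using tensor_kernel[OF mH mH B lin_comp[OF r1(1) E] u] by blast
  (* r1 takes values in the coinvariants; r2 corrects r1 so that the counit vanishes too,
     and u is still fixed since both id (x) r1 and id (x) r2 fix it *)
  define r where "r v = r1 (r2 v)" for v
  have r: "r \<in> lin H H" unfolding r_def[abs_def] by (rule lin_comp[OF r2(1) r1(1)])
  have ru: "tens_map K H H id r u = u"
    using tens_map_comp_right[OF mH mH mH mH r2(1) r1(1) u] r1(3) r2(3) by (simp add: r_def[abs_def])
  have rK: "r v \<in> coinv_plus" if v: "v \<in> carrier H" for v
    unfolding coinv_plus_iff
    using r1(2)[OF lin_closed[OF r2(1) v]] r2(2)[OF v] lin_closed[OF r v]
    by (simp add: r_def base_module_def)
  note pl = tens_map_lin[OF mH mH mH mH lin_id' p] and rl = tens_map_lin[OF mH mH mH mH lin_id' r]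
  note tw = twist_lin[OF H mH aS lin_id]
  have "tens_map K H H id p (twist H H ?mul (\<lambda>h. h) (tens_map K H H id r (tens K H H g x))) =
      twist H H ?mul (\<lambda>h. h) (tens_map K H H id r (tens K H H g x))"
    if g: "g \<in> carrier H" and x: "x \<in> carrier H" for g x
  proof -
    note Dg = lin_closed[OF D g] and rx = lin_closed[OF r x]
    have b0: "bilin H H (tensor K H H) (\<lambda>a b. tens K H H a (b \<otimes>\<^bsub>H\<^esub> r x))"
      by (rule trilinD(5)[OF twist_trilin[OF H mH aS lin_id] rx])
    have e: "twist H H ?mul (\<lambda>h. h) (tens_map K H H id r (tens K H H g x)) =
        tens_lift K (tensor K H H) (\<lambda>a b. tens K H H a (b \<otimes>\<^bsub>H\<^esub> r x)) (comult H g)"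
      unfolding tens_map_tens[OF mH mH mH mH lin_id' r g x] id_apply
      by (rule twist_tens[OF H mH aS lin_id g rx])
    have "tens_map K H H id p (tens_lift K (tensor K H H) (\<lambda>a b. tens K H H a (b \<otimes>\<^bsub>H\<^esub> r x)) (comult H g)) =
        tens_lift K (tensor K H H) (\<lambda>a b. tens_map K H H id p (tens K H H a (b \<otimes>\<^bsub>H\<^esub> r x))) (comult H g)"
      by (rule lin_tens_lift[OF mH mH HH HH b0 pl Dg])
    also have "\<dots> = tens_lift K (tensor K H H) (\<lambda>a b. tens K H H a (b \<otimes>\<^bsub>H\<^esub> r x)) (comult H g)"
    proof (rule tens_lift_cong[OF mH mH HH b0 _ Dg])
      fix a b assume a: "a \<in> carrier H" and b: "b \<in> carrier H"
      have "b \<otimes>\<^bsub>H\<^esub> r x \<in> coinv_ideal" unfolding coinv_ideal_def by (rule ideal_prod.prod[OF b rK[OF x]])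
      then show "tens_map K H H id p (tens K H H a (b \<otimes>\<^bsub>H\<^esub> r x)) = tens K H H a (b \<otimes>\<^bsub>H\<^esub> r x)"
        using tens_map_tens[OF mH mH mH mH lin_id' p a bilin_closed[OF aS b rx]] by (simp add: pI)
    qed
    finally show ?thesis unfolding e .
  qed
  then have "tens_map K H H id p (twist H H ?mul (\<lambda>h. h) (tens_map K H H id r u)) =
      twist H H ?mul (\<lambda>h. h) (tens_map K H H id r u)"
    by (intro lin_tensor_eqI[OF mH mH lin_comp[OF rl lin_comp[OF tw pl]] lin_comp[OF rl tw] _ u])
  then show ?thesis unfolding ru tu .
qed

section \<open>Exactness after cotensoring\<close>

definition Hco :: "('k, 'b, 'h) lcomodule"
  where "Hco = \<lparr>carrier = carrier H, mult = mult H, one = one H, zero = zero H, add = add H,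
    smult = smult H, lcoact = coactL\<rparr>"

definition Lco :: "('k, 'b, 'b) lcomodule"
  where "Lco = \<lparr>carrier = carrier L, mult = mult L, one = one L, zero = zero L, add = add L,
    smult = smult L, lcoact = comult L\<rparr>"

abbreviation Hr :: "('k, 'b, 'h) rcomodule"
  where "Hr \<equiv> induced_rcomodule K H L \<pi>"

lemma same_Hco: "same_structure Hco H" and same_Lco: "same_structure Lco L"
  and same_Hr: "same_structure Hr H"
  and lcoact_Hco: "lcoact Hco = coactL" and lcoact_Lco: "lcoact Lco = comult L" and rcoact_Hr: "rcoact Hr = coactR"
  by (simp_all add: same_structure_def Hco_def Lco_def induced_rcomodule_def coactR_def fun_eq_iff)

lemmas Hco_eqs = same_structure_tensor[OF same_structure_refl same_Hco]
  same_structure_assoc[OF same_structure_refl same_structure_refl same_Hco]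
  same_structure_lift[OF same_Hco] same_structure_lin[OF same_Hco same_structure_refl]
  same_structure_lin[OF same_structure_refl same_Hco] same_structure_module[OF same_Hco]

lemmas Lco_eqs = same_structure_tensor[OF same_structure_refl same_Lco]
  same_structure_assoc[OF same_structure_refl same_structure_refl same_Lco]
  same_structure_lift[OF same_Lco] same_structure_lin[OF same_Lco same_structure_refl]
  same_structure_lin[OF same_structure_refl same_Lco] same_structure_module[OF same_Lco]

lemmas Hr_eqs = same_structure_tensor[OF same_Hr same_structure_refl]
  same_structure_assoc[OF same_Hr same_structure_refl same_structure_refl]

lemma carrier_co: "carrier Hco = carrier H" "carrier Lco = carrier L" "\<zero>\<^bsub>Lco\<^esub> = \<zero>\<^bsub>L\<^esub>" "\<zero>\<^bsub>Hco\<^esub> = \<zero>\<^bsub>H\<^esub>"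
  "x \<oplus>\<^bsub>Hco\<^esub> y = x \<oplus>\<^bsub>H\<^esub> y" "c \<odot>\<^bsub>Hco\<^esub> x = c \<odot>\<^bsub>H\<^esub> x" "c \<odot>\<^bsub>Lco\<^esub> y' = c \<odot>\<^bsub>L\<^esub> y'"
  by (simp_all add: Hco_def Lco_def)

lemma left_comodule_Lco: "left_comodule K L Lco"
  unfolding left_comodule_def left_comodule_axioms_def Lco_eqs lcoact_Lco carrier_co
  using cL mL DL coalgebra.coassoc[OF cL] coalgebra.counit_left[OF cL] by simp

text \<open>Coassociativity of \<open>\<lambda>\<close> is the image of that of \<open>\<Delta>\<close> under \<open>\<pi> \<otimes> (\<pi> \<otimes> id)\<close>.\<close>

lemma left_comodule_Hco: "left_comodule K L Hco"
proof -
  note HH = tensor_module[OF mH mH] and LL = tensor_module[OF mL mL] and LH = tensor_module[OF mL mH]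
  note pp = tens_map_lin[OF mH mH mL mL pi_lin pi_lin] and pid = tens_map_lin[OF mH mH mL mH pi_lin lin_id']
  have co: "tens_assoc K L L H (tens_map K (tensor K L L) H (comult L) id (coactL h)) =
      tens_map K L (tensor K L H) id coactL (coactL h)" if h: "h \<in> carrier H" for h
  proof -
    note Dh = lin_closed[OF D h]
    have "tens_map K (tensor K L L) H (comult L) id (coactL h) =
        tens_map K (tensor K L L) H (\<lambda>x. comult L (\<pi> x)) id (comult H h)"
      unfolding coactL_def by (rule tens_map_comp_left[OF mH mH mL LL pi_lin DL Dh])
    also have "\<dots> = tens_map K (tensor K L L) H (\<lambda>x. tens_map K L L \<pi> \<pi> (comult H x)) id (comult H h)"
      by (rule tens_map_cong[OF mH mH LL mH lin_comp[OF D pp] lin_id' _ _ Dh]) (simp_all add: pi_comult)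
    also have "\<dots> = tens_map K (tensor K L L) H (tens_map K L L \<pi> \<pi>) id
        (tens_map K (tensor K H H) H (comult H) id (comult H h))"
      by (rule tens_map_comp_left[OF mH mH HH LL D pp Dh, symmetric])
    finally have "tens_assoc K L L H (tens_map K (tensor K L L) H (comult L) id (coactL h)) =
        tens_assoc K L L H (tens_map K (tensor K L L) H (tens_map K L L \<pi> \<pi>) id
          (tens_map K (tensor K H H) H (comult H) id (comult H h)))" by simp
    also have "\<dots> = tens_map K L (tensor K L H) \<pi> (tens_map K L H \<pi> id)
        (tens_assoc K H H H (tens_map K (tensor K H H) H (comult H) id (comult H h)))"
      by (rule tens_assoc_natural[OF mH mH mH mL mL mH pi_lin pi_lin lin_id'
            tens_map_closed[OF mH mH HH mH D lin_id' Dh]])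
    also have "\<dots> = tens_map K L (tensor K L H) \<pi> (tens_map K L H \<pi> id)
        (tens_map K H (tensor K H H) id (comult H) (comult H h))"
      by (simp only: coalgebra.coassoc[OF cH h])
    also have "\<dots> = tens_map K L (tensor K L H) \<pi> coactL (comult H h)"
      using tens_map_comp[OF mH mH mH HH mL LH lin_id' D pi_lin pid Dh] by (simp add: coactL_def[abs_def])
    also have "\<dots> = tens_map K L (tensor K L H) id coactL (coactL h)"
      unfolding coactL_def[of h] by (rule tens_map_left_right(2)[OF mH mH mL LH pi_lin coactL_lin Dh, symmetric])
    finally show ?thesis .
  qed
  have cu: "tens_lift K H (\<lambda>c n. counit L c \<odot>\<^bsub>H\<^esub> n) (coactL h) = h" if h: "h \<in> carrier H" for h
  proof -
    note Dh = lin_closed[OF D h]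
    have b: "bilin L H H (\<lambda>c n. counit L c \<odot>\<^bsub>H\<^esub> n)" by (rule bilin_comp[OF smult_bilin[OF mH] EL lin_id])
    have b': "bilin H H H (\<lambda>c n. counit H c \<odot>\<^bsub>H\<^esub> n)" by (rule bilin_comp[OF smult_bilin[OF mH] E lin_id])
    have "tens_lift K H (\<lambda>c n. counit L c \<odot>\<^bsub>H\<^esub> n) (coactL h) =
        tens_lift K H (\<lambda>c n. counit L (\<pi> c) \<odot>\<^bsub>H\<^esub> id n) (comult H h)"
      unfolding coactL_def by (rule tens_lift_tens_map[OF mH mH mL mH mH pi_lin lin_id' b Dh])
    also have "\<dots> = tens_lift K H (\<lambda>c n. counit H c \<odot>\<^bsub>H\<^esub> n) (comult H h)"
      by (rule tens_lift_cong[OF mH mH mH b' _ Dh]) (simp add: pi_counit)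
    also have "\<dots> = h" by (rule coalgebra.counit_left[OF cH h])
    finally show ?thesis .
  qed
  show ?thesis
    unfolding left_comodule_def left_comodule_axioms_def Hco_eqs lcoact_Hco carrier_co
    using cL mH coactL_lin co cu by simp
qed

lemma pi_comodule_hom: "\<pi> \<in> lcomodule_hom K L Hco Lco"
  unfolding lcomodule_hom_def Lco_eqs Hco_eqs lcoact_Hco lcoact_Lco carrier_co
  using pi_lin tens_map_left_right(2)[OF mH mH mL mL pi_lin pi_lin lin_closed[OF D]]
  by (simp add: pi_comult coactL_def)

lemma coinv_plus_closed: "x \<in> coinv_plus \<Longrightarrow> x \<in> carrier H"
  by (simp add: coinv_plus_iff)

lemma coinv_ideal_closed: "x \<in> coinv_ideal \<Longrightarrow> x \<in> carrier H"
  unfolding coinv_ideal_def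
proof -
  interpret H: ring H by (rule rH)
  show "x \<in> carrier H" if "x \<in> ideal_prod H (carrier H) coinv_plus"
    using that by (induction rule: ideal_prod.induct) (auto intro: coinv_plus_closed)
qed

lemma coinv_ideal_submodule: "submodule coinv_ideal K H"
proof -
  interpret H: ring H by (rule rH)
  have z: "\<zero>\<^bsub>H\<^esub> \<in> coinv_plus"
    unfolding coinv_plus_iff
    using lin_zero[OF mH tensor_module[OF mL mH] coactL_lin] lin_zero[OF mH tensor_module[OF mL mH] unit_tens_lin]
      lin_zero[OF mH base_module_module E] by (simp add: base_module_def)
  have "\<zero>\<^bsub>H\<^esub> \<otimes>\<^bsub>H\<^esub> \<zero>\<^bsub>H\<^esub> \<in> coinv_ideal" unfolding coinv_ideal_def by (rule ideal_prod.prod) (simp_all add: z)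
  then have "\<zero>\<^bsub>H\<^esub> \<in> coinv_ideal" by simp
  moreover have "x \<oplus>\<^bsub>H\<^esub> y \<in> coinv_ideal" if "x \<in> coinv_ideal" "y \<in> coinv_ideal" for x y
    using that unfolding coinv_ideal_def by (rule ideal_prod.sum)
  moreover have "c \<odot>\<^bsub>H\<^esub> x \<in> coinv_ideal" if c: "c \<in> carrier K" and "x \<in> coinv_ideal" for c x
    using that(2) unfolding coinv_ideal_def
  proof (induction rule: ideal_prod.induct)
    case (prod i j)
    then have "c \<odot>\<^bsub>H\<^esub> (i \<otimes>\<^bsub>H\<^esub> j) = (c \<odot>\<^bsub>H\<^esub> i) \<otimes>\<^bsub>H\<^esub> j"
      using c assoc_algebra.smult_mult_left[OF aH] coinv_plus_closed by simp
    then show ?case using prod c mH by (simp add: ideal_prod.prod)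
  next
    case (sum s1 s2)
    then have "s1 \<in> carrier H" "s2 \<in> carrier H"
      using coinv_ideal_closed by (simp_all add: coinv_ideal_def)
    then show ?case using sum c by (simp add: module.smult_r_distr[OF mH] ideal_prod.sum)
  qed
  ultimately show ?thesis using coinv_ideal_closed by (auto simp: submodule_iff[OF mH])
qed

text \<open>Applying \<open>id \<otimes> \<epsilon>\<close> to \<open>\<pi>(k\<^sub>1) \<otimes> k\<^sub>2 = 1 \<otimes> k\<close> gives \<open>\<pi>(k) = \<epsilon>(k)1 = 0\<close> for \<open>k \<in> A\<^sup>+\<close>.\<close>

lemma coinv_ideal_kernel:
  assumes x: "x \<in> coinv_ideal"
  shows "\<pi> x = \<zero>\<^bsub>L\<^esub>"
proof -
  interpret H: ring H by (rule rH)
  interpret L: ring L by (rule rL)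
  have k: "\<pi> k = \<zero>\<^bsub>L\<^esub>" if k: "k \<in> coinv_plus" for k
  proof -
    have kc: "k \<in> carrier H" and lk: "coactL k = unit_tens k" and ek: "counit H k = \<zero>"
      using k by (simp_all add: coinv_plus_iff)
    note Dk = lin_closed[OF D kc]
    have b: "bilin L H L (\<lambda>l h. counit H h \<odot>\<^bsub>L\<^esub> l)"
      by (rule bilin_swap[OF bilin_comp[OF smult_bilin[OF mL] E lin_id]])
    have b': "bilin H H H (\<lambda>a b. counit H b \<odot>\<^bsub>H\<^esub> a)"
      by (rule bilin_swap[OF bilin_comp[OF smult_bilin[OF mH] E lin_id]])
    have "\<pi> k = \<pi> (tens_lift K H (\<lambda>a b. counit H b \<odot>\<^bsub>H\<^esub> a) (comult H k))"
      by (simp only: coalgebra.counit_right[OF cH kc])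
    also have "\<dots> = tens_lift K L (\<lambda>a b. \<pi> (counit H b \<odot>\<^bsub>H\<^esub> a)) (comult H k)"
      by (rule lin_tens_lift[OF mH mH mH mL b' pi_lin Dk])
    also have "\<dots> = tens_lift K L (\<lambda>a b. counit H (id b) \<odot>\<^bsub>L\<^esub> \<pi> a) (comult H k)"
      by (rule tens_lift_cong[OF mH mH mL bilin_comp[OF b pi_lin lin_id'] _ Dk])
         (simp add: lin_smult[OF pi_lin] counit_carrier[OF H])
    also have "\<dots> = tens_lift K L (\<lambda>l h. counit H h \<odot>\<^bsub>L\<^esub> l) (coactL k)"
      unfolding coactL_def by (rule tens_lift_tens_map[OF mH mH mL mH mL pi_lin lin_id' b Dk, symmetric])
    also have "\<dots> = \<zero>\<^bsub>L\<^esub>"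
      unfolding lk unit_tens_def by (simp add: mL mH b kc ek)
    finally show ?thesis .
  qed
  show ?thesis
    using x unfolding coinv_ideal_def
  proof (induction rule: ideal_prod.induct)
    case (prod i j)
    then show ?case using k coinv_plus_closed by (simp add: pi_mult lin_closed[OF pi_lin])
  next
    case (sum s1 s2)
    then have "s1 \<in> carrier H" "s2 \<in> carrier H"
      using coinv_ideal_closed by (simp_all add: coinv_ideal_def)
    then show ?case using sum by (simp add: lin_add[OF pi_lin])
  qed
qed

text \<open>The subspace \<open>HA\<^sup>+\<close> is a subcomodule: \<open>\<lambda>(hk) = \<lambda>(h)(1 \<otimes> k)\<close> has its second components in \<open>HA\<^sup>+\<close>.\<close>

lemma coinv_ideal_stable:
  assumes p: "p \<in> lin H H" and pI: "\<And>x. x \<in> coinv_ideal \<Longrightarrow> p x = x" and x: "x \<in> coinv_ideal"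
  shows "tens_map K L H id p (coactL x) = coactL x"
proof -
  interpret H: ring H by (rule rH)
  interpret L: ring L by (rule rL)
  note pl = tens_map_lin[OF mL mH mL mH lin_id' p]
  show ?thesis
    using x unfolding coinv_ideal_def
  proof (induction rule: ideal_prod.induct)
    case (prod h k)
    have k: "k \<in> carrier H" and lk: "coactL k = unit_tens k" using prod(2) by (simp_all add: coinv_plus_iff)
    have uk: "unit_tens k \<in> carrier (tensor K L H)" by (rule lin_closed[OF unit_tens_lin k])
    note ml = bilin1[OF tensor_mult_bilin[OF aL aH] uk]
    have t: "tens_map K L H id p (tens K L H a b \<otimes>\<^bsub>tensor K L H\<^esub> unit_tens k) =
        tens K L H a b \<otimes>\<^bsub>tensor K L H\<^esub> unit_tens k" if a: "a \<in> carrier L" and b: "b \<in> carrier H" for a b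
    proof -
      have "b \<otimes>\<^bsub>H\<^esub> k \<in> coinv_ideal" unfolding coinv_ideal_def by (rule ideal_prod.prod[OF b prod(2)])
      then show ?thesis using a b k
        by (simp add: unit_tens_def tensor_mult_tens[OF aL aH] tens_map_tens[OF mL mH mL mH lin_id' p] pI)
    qed
    show ?case
      unfolding coactL_mult[OF prod(1) k] lk
      by (rule lin_tensor_eqI[OF mL mH lin_comp[OF ml pl] ml t lin_closed[OF coactL_lin prod(1)]])
  next
    case (sum s1 s2)
    then have s: "s1 \<in> carrier H" "s2 \<in> carrier H"
      using coinv_ideal_closed by (simp_all add: coinv_ideal_def)
    show ?case
      unfolding lin_add[OF coactL_lin s] lin_add[OF pl lin_closed[OF coactL_lin s(1)] lin_closed[OF coactL_lin s(2)]]
      using sum(3,4) by (simp only:)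
  qed
qed

text \<open>Faithful coflatness is applied to \<open>HA\<^sup>+ \<rightarrow> H \<rightarrow> L\<close>.  After cotensoring with \<open>H\<close>, an element \<open>t\<close> of the kernel
is fixed by \<open>id \<otimes> p\<close> for a projection \<open>p\<close> onto \<open>HA\<^sup>+\<close>, by \<open>cotensor_kernel\<close>; it therefore comes
from \<open>H \<otimes> HA\<^sup>+\<close>, and from the cotensor product since the inclusion of \<open>HA\<^sup>+\<close> splits linearly.\<close>

lemma kernel_eq_coinv_ideal:
  fixes e :: "'h \<Rightarrow> 'v"
  assumes fc: "faithfully_coflat TYPE('v) K L Hr" and e: "inj e"
    and surj: "\<pi> ` carrier H = carrier L"
  shows "coinv_ideal = {h \<in> carrier H. \<pi> h = \<zero>\<^bsub>L\<^esub>}"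
proof -
  have R: "right_comodule K L Hr" using fc by (simp add: faithfully_coflat_def)
  define I0 where "I0 = Hco\<lparr>carrier := coinv_ideal\<rparr>"
  have mHco: "module K Hco" unfolding Hco_eqs by (rule mH)
  have "submodule coinv_ideal K Hco"
    using coinv_ideal_submodule unfolding submodule_iff[OF mH] submodule_iff[OF mHco] carrier_co .
  then have mI0: "module K I0" unfolding I0_def by (rule submodule_module[OF mHco])
  have I0: "carrier I0 = coinv_ideal" "x \<oplus>\<^bsub>I0\<^esub> y = x \<oplus>\<^bsub>H\<^esub> y" "c \<odot>\<^bsub>I0\<^esub> x = c \<odot>\<^bsub>H\<^esub> x" for x y c
    by (simp_all add: I0_def carrier_co)
  have i0: "(\<lambda>x. x) \<in> lin I0 H" by (intro linI) (auto simp: I0 coinv_ideal_closed)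
  obtain p where p: "p \<in> lin H I0" "\<And>x. x \<in> carrier I0 \<Longrightarrow> p x = x"
    using regular_inverse_exists[OF mI0 mH i0] by blast
  (* the projection p is used both as a map into the subspace and as an operator on H *)
  have pH: "p \<in> lin H H" using lin_comp[OF p(1) i0] .
  have pI: "p x = x" if "x \<in> coinv_ideal" for x using p(2) that by (simp add: I0)
  define Ico where "Ico = I0\<lparr>lcoact := (\<lambda>x. tens_map K L I0 id p (coactL x))\<rparr>"
  have same: "same_structure Ico I0" by (simp add: same_structure_def Ico_def)
  have lcoI: "lcoact Ico x = tens_map K L Ico id p (coactL x)" for x
    unfolding Ico_def tens_map_lcoact_update by simp
  have carI: "carrier Ico = coinv_ideal" by (simp add: Ico_def I0)
  have mI: "module K Ico" unfolding same_structure_module[OF same] by (rule mI0)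
  have iI: "(\<lambda>x. x) \<in> lin Ico Hco"
    unfolding Hco_eqs same_structure_lin[OF same same_structure_refl] by (rule i0)
  have pIl: "p \<in> lin Hco Ico"
    unfolding Hco_eqs same_structure_lin[OF same_structure_refl same] by (rule p(1))
  have st: "tens_map K L Hco id (\<lambda>x. p x) (lcoact Hco n) = lcoact Hco n" if "n \<in> carrier Ico" for n
    unfolding Hco_eqs lcoact_Hco using coinv_ideal_stable[OF pH pI] that by (simp add: carI)
  have Ico: "left_comodule K L Ico" and ih: "(\<lambda>x. x) \<in> lcomodule_hom K L Ico Hco"
    using retract_left_comodule[where N = Ico and i = "\<lambda>x. x" and r = p,
        OF left_comodule_Hco mI iI pIl _ st] pI lcoI by (auto simp: carI lcoact_Hco)
  note mR = right_comodule_module[OF R]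
  have mLco: "module K Lco" unfolding Lco_eqs by (rule mL)
  have piH: "\<pi> \<in> lin Hco Lco" by (rule lcomodule_hom_lin[OF pi_comodule_hom])
  have "tens_map K Hr Hco id (\<lambda>x. x) ` carrier (cotensor K L Hr Ico) =
    {t \<in> carrier (cotensor K L Hr Hco). tens_map K Hr Lco id \<pi> t = \<zero>\<^bsub>tensor K Hr Lco\<^esub>}" (is "?A = ?B")
  proof
    show "?A \<subseteq> ?B"
    proof
      fix t assume "t \<in> ?A"
      then obtain s where s: "s \<in> carrier (cotensor K L Hr Ico)" "t = tens_map K Hr Hco id (\<lambda>x. x) s" by auto
      have st: "s \<in> carrier (tensor K Hr Ico)" using s(1) by (simp add: cotensor_carrier)
      have "t \<in> carrier (cotensor K L Hr Hco)"
        unfolding s(2) by (rule cotensor_map_closed[OF R Ico left_comodule_Hco ih s(1)])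
      moreover have "tens_map K Hr Lco id \<pi> t = tens_map K Hr Lco id \<pi> s"
        unfolding s(2) by (rule tens_map_comp_right[OF mR mI mHco mLco iI piH st])
      moreover have "\<dots> = tens_map K Hr Lco id (\<lambda>_. \<zero>\<^bsub>Lco\<^esub>) s"
        by (rule tens_map_cong[OF mR mI mR mLco lin_id' lin_const_zero[OF mLco] _ _ st])
           (simp_all add: carI carrier_co coinv_ideal_kernel)
      moreover have "\<dots> = \<zero>\<^bsub>tensor K Hr Lco\<^esub>" by (rule tens_map_zero[OF mR mI mLco st])
      ultimately show "t \<in> ?B" by simp
    qed
    show "?B \<subseteq> ?A"
    proof
      fix t assume "t \<in> ?B"
      then have t: "t \<in> carrier (cotensor K L Hr Hco)" "tens_map K Hr Lco id \<pi> t = \<zero>\<^bsub>tensor K Hr Lco\<^esub>" by auto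
      have tt: "t \<in> carrier (tensor K Hr Hco)" using t(1) by (simp add: cotensor_carrier)
      have "tens_map K H H id p t = t"
        using t cotensor_kernel[OF _ _ _ pH pI] unfolding cotensor_carrier Hco_eqs Lco_eqs Hr_eqs
          rcoact_Hr lcoact_Hco by blast
      then have pt: "tens_map K Hr Hco id p t = t" unfolding Hco_eqs Hr_eqs .
      define t' where "t' = tens_map K Hr Ico id p t"
      have t't: "t' \<in> carrier (tensor K Hr Ico)"
        unfolding t'_def by (rule tens_map_closed[OF mR mHco mR mI lin_id' pIl tt])
      have it': "tens_map K Hr Hco id (\<lambda>x. x) t' = t"
        unfolding t'_def using tens_map_comp_right[OF mR mHco mI mHco pIl iI tt] pt by simp
      have "t' \<in> carrier (cotensor K L Hr Ico)"
        by (rule cotensor_map_reflects[OF R Ico left_comodule_Hco ih pIl _ t't])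
           (simp_all add: it' t(1) pI carI)
      then show "t \<in> ?A" using it' by (metis imageI)
    qed
  qed
  then have ex: "exact_at (cotensor K L Hr Ico) (cotensor K L Hr Hco) (cotensor K L Hr Lco)
      (cotensor_map K Hr Hco (\<lambda>x. x)) (cotensor_map K Hr Lco \<pi>)"
    by (simp add: exact_at_def a_kernel_def' cotensor_zero)
  have jI: "inj_on e (carrier Ico)" and jH: "inj_on e (carrier Hco)"
    using e by (auto intro: inj_on_subset)
  (* L need not be contained in the test type; a section of \<pi> embeds it into H first *)
  have jL: "inj_on (\<lambda>y. e (inv_into (carrier H) \<pi> y)) (carrier Lco)"
    unfolding carrier_co surj[symmetric]
    by (rule inj_onI) (metis e injD f_inv_into_f)
  have "exact_at Ico Hco Lco (\<lambda>x. x) \<pi>"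
    by (rule faithfully_coflat_reflects_exact[OF fc Ico left_comodule_Hco left_comodule_Lco jI jH jL ih pi_comodule_hom ex])
  then show ?thesis by (simp add: exact_at_def a_kernel_def' carI carrier_co)
qed

section \<open>The quotient by the kernel\<close>

text \<open>The bijection \<open>\<psi>\<close> sends \<open>y\<close> to the fibre of \<open>\<pi>\<close> over \<open>y\<close>, which is a coset of the kernel.  All
structure maps of the quotient are constant on such fibres because \<open>\<pi>\<close> preserves them.\<close>

lemma kernel_quotient:
  assumes surj: "\<pi> ` carrier H = carrier L"
  defines "I \<equiv> {h \<in> carrier H. \<pi> h = \<zero>\<^bsub>L\<^esub>}"
  shows "hopf_algebra K (quot_hopf K H I)"
    and "\<exists>\<phi>\<in>hopf_iso K (quot_hopf K H I) L. \<forall>h\<in>carrier H. \<phi> (I +>\<^bsub>H\<^esub> h) = \<pi> h"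
proof -
  interpret H: ring H by (rule rH)
  interpret L: ring L by (rule rL)
  define psi where "psi y = {h \<in> carrier H. \<pi> h = y}" for y
  let ?Q = "quot_hopf K H I" and ?M = "quot_module H I"
  have I: "submodule I K H" unfolding I_def by (rule kernel_submodule[OF mH mL pi_lin])
  interpret \<pi>: ring_hom_ring H L \<pi> by (rule ring_hom_ringI2[OF rH rL pi_ring_hom])
  have "a_kernel H L \<pi> = I" unfolding I_def by (rule a_kernel_def')
  with \<pi>.kernel_is_ideal have idl: "ideal I H" by (simp only:)
  have coset: "I +>\<^bsub>H\<^esub> h = psi (\<pi> h)" if h: "h \<in> carrier H" for h
  proof
    show "I +>\<^bsub>H\<^esub> h \<subseteq> psi (\<pi> h)"
      using h by (auto simp: mem_coset psi_def I_def lin_add[OF pi_lin] lin_closed[OF pi_lin])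
    show "psi (\<pi> h) \<subseteq> I +>\<^bsub>H\<^esub> h"
    proof
      fix x assume "x \<in> psi (\<pi> h)"
      then have x: "x \<in> carrier H" "\<pi> x = \<pi> h" by (simp_all add: psi_def)
      have "x \<oplus>\<^bsub>H\<^esub> \<ominus>\<^bsub>H\<^esub> h \<in> I"
        using x h lin_closed[OF pi_lin h] by (simp add: I_def lin_add[OF pi_lin] L.r_neg)
      moreover have "x = (x \<oplus>\<^bsub>H\<^esub> \<ominus>\<^bsub>H\<^esub> h) \<oplus>\<^bsub>H\<^esub> h" using x h by (simp add: H.a_assoc H.l_neg)
      ultimately show "x \<in> I +>\<^bsub>H\<^esub> h" unfolding mem_coset by blast
    qed
  qed
  have same: "same_structure ?Q ?M" by (simp add: same_structure_def quot_hopf_def Let_def)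
  have mQ0: "module K ?M" by (rule quot_module_module[OF mH I])
  have mQ: "module K ?Q" using mQ0 same_structure_module[OF same] by simp
  note tQ = same_structure_tensor(3)[OF same same]
  have Qf: "carrier ?Q = carrier ?M" "mult ?Q = rcoset_mult H I" "one ?Q = I +>\<^bsub>H\<^esub> \<one>\<^bsub>H\<^esub>"
    "add ?Q = add ?M" "smult ?Q = smult ?M"
    by (simp_all add: quot_hopf_def Let_def) (simp_all add: quot_module_def FactRing_def)
  have carQ: "carrier ?Q = psi ` carrier L"
    unfolding Qf quot_carrier surj[symmetric] image_image by (rule image_cong[OF refl coset])
  have lE: "\<exists>h\<in>carrier H. y = \<pi> h" if "y \<in> carrier L" for y using that surj by auto
  have mem: "h \<in> psi (\<pi> h)" if "h \<in> carrier H" for h using that by (simp add: psi_def)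
  have psiD: "h \<in> carrier H" "\<pi> h = y" if "h \<in> psi y" for h y using that by (simp_all add: psi_def)
  have psi_lin: "psi \<in> lin L ?Q"
  proof (rule linI)
    fix x assume "x \<in> carrier L" then show "psi x \<in> carrier ?Q" by (simp add: carQ)
  next
    fix x y assume "x \<in> carrier L" "y \<in> carrier L"
    then obtain a b where *: "a \<in> carrier H" "b \<in> carrier H" "x = \<pi> a" "y = \<pi> b"
      using lE by meson
    have "psi (x \<oplus>\<^bsub>L\<^esub> y) = I +>\<^bsub>H\<^esub> (a \<oplus>\<^bsub>H\<^esub> b)"
      by (simp only: *(3,4) lin_add[OF pi_lin *(1,2)] coset[OF H.a_closed[OF *(1,2)]])
    also have "\<dots> = (I +>\<^bsub>H\<^esub> a) \<oplus>\<^bsub>?M\<^esub> (I +>\<^bsub>H\<^esub> b)"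
      by (rule quot_add[OF mH I *(1,2), symmetric])
    also have "\<dots> = (I +>\<^bsub>H\<^esub> a) \<oplus>\<^bsub>?Q\<^esub> (I +>\<^bsub>H\<^esub> b)"
      by (rule fun_cong[OF fun_cong[OF Qf(4)], symmetric])
    also have "\<dots> = psi x \<oplus>\<^bsub>?Q\<^esub> psi y"
      unfolding *(3,4) coset[OF *(1)] coset[OF *(2)] by (rule refl)
    finally show "psi (x \<oplus>\<^bsub>L\<^esub> y) = psi x \<oplus>\<^bsub>?Q\<^esub> psi y" .
  next
    fix c x assume c: "c \<in> carrier K" and "x \<in> carrier L"
    then obtain a where *: "a \<in> carrier H" "x = \<pi> a" using lE by meson
    have ca: "c \<odot>\<^bsub>H\<^esub> a \<in> carrier H" using c *(1) mH by simp
    have "psi (c \<odot>\<^bsub>L\<^esub> x) = I +>\<^bsub>H\<^esub> (c \<odot>\<^bsub>H\<^esub> a)"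
      by (simp only: *(2) lin_smult[OF pi_lin c *(1)] coset[OF ca])
    also have "\<dots> = c \<odot>\<^bsub>?M\<^esub> (I +>\<^bsub>H\<^esub> a)"
      by (rule quot_smult[OF mH I *(1) c, symmetric])
    also have "\<dots> = c \<odot>\<^bsub>?Q\<^esub> (I +>\<^bsub>H\<^esub> a)"
      by (rule fun_cong[OF fun_cong[OF Qf(5)], symmetric])
    also have "\<dots> = c \<odot>\<^bsub>?Q\<^esub> psi x"
      unfolding *(2) coset[OF *(1)] by (rule refl)
    finally show "psi (c \<odot>\<^bsub>L\<^esub> x) = c \<odot>\<^bsub>?Q\<^esub> psi x" .
  qed
  have inj: "inj_on psi (carrier L)"
  proof (rule inj_onI)
    fix x y assume "x \<in> carrier L" "y \<in> carrier L" "psi x = psi y"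
    moreover then obtain h where "h \<in> carrier H" "x = \<pi> h" using lE by meson
    ultimately show "x = y" using mem[of h] psiD(2)[of h y] by simp
  qed
  then have bij: "bij_betw psi (carrier L) (carrier ?Q)" by (simp add: bij_betw_def carQ)
  have one: "\<one>\<^bsub>?Q\<^esub> = psi \<one>\<^bsub>L\<^esub>" by (simp add: Qf coset pi_one)
  have mult: "psi x \<otimes>\<^bsub>?Q\<^esub> psi y = psi (x \<otimes>\<^bsub>L\<^esub> y)" if "x \<in> carrier L" "y \<in> carrier L" for x y
  proof -
    obtain a b where *: "a \<in> carrier H" "b \<in> carrier H" "x = \<pi> a" "y = \<pi> b" using lE \<open>x \<in> carrier L\<close> \<open>y \<in> carrier L\<close> by meson
    have "psi x \<otimes>\<^bsub>?Q\<^esub> psi y = (I +>\<^bsub>H\<^esub> a) \<otimes>\<^bsub>?Q\<^esub> (I +>\<^bsub>H\<^esub> b)"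
      unfolding *(3,4) coset[OF *(1)] coset[OF *(2)] by (rule refl)
    also have "\<dots> = rcoset_mult H I (I +>\<^bsub>H\<^esub> a) (I +>\<^bsub>H\<^esub> b)"
      by (rule fun_cong[OF fun_cong[OF Qf(2)]])
    also have "\<dots> = I +>\<^bsub>H\<^esub> (a \<otimes>\<^bsub>H\<^esub> b)" by (rule ideal.rcoset_mult_add[OF idl *(1,2)])
    also have "\<dots> = psi (x \<otimes>\<^bsub>L\<^esub> y)"
      unfolding *(3,4) pi_mult[OF *(1,2), symmetric] by (rule coset[OF H.m_closed[OF *(1,2)]])
    finally show ?thesis .
  qed
  have com: "comult ?Q (psi y) = tens_map K ?Q ?Q psi psi (comult L y)" if y: "y \<in> carrier L" for y
  proof -
    obtain h where h: "h \<in> carrier H" "y = \<pi> h" using lE[OF y] by auto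
    have "comult ?Q (psi y) = the_elem ((\<lambda>h. tens_map K ?Q ?Q (\<lambda>h. I +>\<^bsub>H\<^esub> h) (\<lambda>h. I +>\<^bsub>H\<^esub> h) (comult H h)) ` psi y)"
      unfolding tQ by (simp add: quot_hopf_def Let_def)
    also have "\<dots> = tens_map K ?Q ?Q psi psi (comult L y)"
    proof (rule the_elem_image_const[of h])
      show "h \<in> psi y" using mem h by simp
      fix g assume "g \<in> psi y"
      then have g: "g \<in> carrier H" "\<pi> g = y" by (simp_all add: psi_def)
      note Dg = lin_closed[OF D g(1)]
      have "tens_map K ?Q ?Q (\<lambda>h. I +>\<^bsub>H\<^esub> h) (\<lambda>h. I +>\<^bsub>H\<^esub> h) (comult H g) =
          tens_map K ?Q ?Q (\<lambda>h. psi (\<pi> h)) (\<lambda>h. psi (\<pi> h)) (comult H g)"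
        by (rule tens_map_cong[OF mH mH mQ mQ lin_comp[OF pi_lin psi_lin] lin_comp[OF pi_lin psi_lin] coset coset Dg])
      also have "\<dots> = tens_map K ?Q ?Q psi psi (tens_map K L L \<pi> \<pi> (comult H g))"
        by (rule tens_map_comp[OF mH mH mL mL mQ mQ pi_lin pi_lin psi_lin psi_lin Dg, symmetric])
      also have "\<dots> = tens_map K ?Q ?Q psi psi (comult L y)"
        unfolding pi_comult[OF g(1), symmetric] g(2) ..
      finally show "tens_map K ?Q ?Q (\<lambda>h. I +>\<^bsub>H\<^esub> h) (\<lambda>h. I +>\<^bsub>H\<^esub> h) (comult H g) =
          tens_map K ?Q ?Q psi psi (comult L y)" .
    qed
    finally show ?thesis .
  qed
  have cou: "counit ?Q (psi y) = counit L y" if y: "y \<in> carrier L" for y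
  proof -
    obtain h where h: "h \<in> carrier H" "y = \<pi> h" using lE[OF y] by auto
    have "counit ?Q (psi y) = the_elem (counit H ` psi y)" by (simp add: quot_hopf_def Let_def)
    also have "\<dots> = counit L y"
    proof (rule the_elem_image_const[of h])
      show "h \<in> psi y" using mem h by simp
      show "counit H g = counit L y" if "g \<in> psi y" for g
        unfolding psiD(2)[OF that, symmetric] by (rule pi_counit[OF psiD(1)[OF that], symmetric])
    qed
    finally show ?thesis .
  qed
  have ant: "antipode ?Q (psi y) = psi (antipode L y)" if y: "y \<in> carrier L" for y
  proof -
    obtain h where h: "h \<in> carrier H" "y = \<pi> h" using lE[OF y] by auto
    have "antipode ?Q (psi y) = the_elem ((\<lambda>h. I +>\<^bsub>H\<^esub> antipode H h) ` psi y)"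
      by (simp add: quot_hopf_def Let_def)
    also have "\<dots> = psi (antipode L y)"
    proof (rule the_elem_image_const[of h])
      show "h \<in> psi y" using mem h by simp
      fix g assume "g \<in> psi y"
      then have g: "g \<in> carrier H" "\<pi> g = y" by (simp_all add: psi_def)
      show "I +>\<^bsub>H\<^esub> antipode H g = psi (antipode L y)"
        unfolding coset[OF lin_closed[OF S g(1)]] pi_antipode[OF g(1), symmetric] g(2) ..
    qed
    finally show ?thesis .
  qed
  note T = hopf_transport[OF L mQ psi_lin bij one mult com cou ant]
  show "hopf_algebra K ?Q" by (rule T(1))
  show "\<exists>\<phi>\<in>hopf_iso K ?Q L. \<forall>h\<in>carrier H. \<phi> (I +>\<^bsub>H\<^esub> h) = \<pi> h"
    using T(2) inj by (intro bexI[of _ "inv_into (carrier L) psi"]) (auto simp: coset lin_closed[OF pi_lin])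
qed

end

theorem theorem3p2:
  fixes K :: "('k, 'z) ring_scheme"
    and H :: "('k, 'h) hopf"
    and Hbar :: "('k, 'b) hopf"
    and \<pi> :: "'h \<Rightarrow> 'b"
  assumes "field K"
    and "hopf_algebra K H"
    and "hopf_algebra K Hbar"
    and "\<pi> \<in> hopf_hom K H Hbar"
    and "\<pi> ` carrier H = carrier Hbar"
    and "faithfully_coflat TYPE(('h, 'u) universe) K Hbar (induced_rcomodule K H Hbar \<pi>)"
  shows "let I = ideal_prod H (carrier H)
                  (augmentation_part K H (left_coinvariants K H Hbar \<pi>));
             Q = quot_hopf K H I
         in hopf_algebra K Q \<and>
            (\<exists>\<phi> \<in> hopf_iso K Q Hbar. \<forall>h\<in>carrier H. \<phi> (I +>\<^bsub>H\<^esub> h) = \<pi> h)"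
proof -
  interpret hopf_map K H Hbar \<pi>
    by (intro hopf_map.intro base_field.intro hopf_map_axioms.intro assms)
  have "inj (Inl :: 'h \<Rightarrow> ('h, 'u) universe)" by simp
  note I = kernel_eq_coinv_ideal[OF assms(6) this assms(5)]
  show ?thesis
    unfolding Let_def coinv_plus_def[symmetric] coinv_ideal_def[symmetric] I
    by (intro conjI kernel_quotient[OF assms(5)])
qed

end
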